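(* Let $M$ be a connected, geodesically complete Riemannian manifold, let $D\subseteq M$ be open and convex and let $f,F\colon D\to\mathbb{R}$ be convex functions. Suppose that $f$ is $(\beta_1,\beta_2)$-compatible with $F$ (with $\beta_1,\beta_2\ge0$) and $F$ is $1$-self-concordant. Then the function $$G\colon E_f^\circ\to\mathbb{R},\quad G(p,t)=-\log(t-f(p))+F(p),$$ defined on the open epigraph $E^\circ_f=\{(p,t)\in D\times\mathbb{R}: f(p)<t\}$, is convex and $\alpha$-self-concordant, with $$\alpha:=\frac{1}{\max\left\{1+\beta_1^2,\ \beta_1+\frac12\beta_2^2,\ \frac23\beta_2^2\right\}}.$$ Furthermore, for every $(p,t)\in E_f^\circ$ one has $$\lambda_{G,\alpha}(p,t)^2=\frac{\lambda_G(p,t)^2}{\alpha}\le\frac{1+\lambda_F(p)^2}{\alpha}.$$ If in addition $F$ is strongly $1$-self-concordant and $f$ has a closed convex extension, then $G$ is strongly $\alpha$-self-concordant. In particular, if $F$ is a $\theta$-barrier for $D$ and $f$ has a closed convex extension, then $G/\alpha$ is a $(1+\theta)/\alpha$-barrier for $E_f^\circ$.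
   Context: Functions are $C^\infty$-smooth unless stated otherwise; $\nabla$ is the Levi-Civita connection. The notions below apply to any connected geodesically complete Riemannian manifold $N$ (here $N=M$ or $N=M\times\mathbb{R}$ with the product metric). Convexity: $D\subseteq N$ is convex if every geodesic $\gamma\colon[0,1]\to N$ with endpoints in $D$ stays in $D$; a function on a convex set is convex if its composition with every such geodesic is convex, and closed convex if moreover its epigraph $\{(x,s)\in D\times\mathbb{R}: h(x)\le s\}$ is closed in $N\times\mathbb{R}$. A function on $D$ has a closed convex extension if it extends to a closed convex (not necessarily continuous) function on some convex superset of $D$. Self-concordance: with $\nabla^3h=\nabla(\nabla^2h)$, $(\nabla^3h)_x(u,v,w)=(\nabla_u(\nabla^2h))_x(v,w)$, a convex $h\colon D\to\mathbb{R}$ on an open convex $D$ is $\alpha$-self-concordant if $|(\nabla^3h)_x(u,v,w)|\le\frac{2}{\sqrt\alpha}\sqrt{(\nabla^2h)_x(u,u)}\sqrt{(\nabla^2h)_x(v,v)}\sqrt{(\nabla^2h)_x(w,w)}$ for all $x\in D$, $u,v,w\in T_xN$; strongly $\alpha$-self-concordant if moreover closed convex. Compatibility: $f$ is $(\beta_1,\beta_2)$-compatible with $F$ if for all $p\in D$ and $u,v\in T_pM$, $$|(\nabla^3f)_p(u,v,v)|\le2\beta_1\sqrt{(\nabla^2F)_p(u,u)}\,(\nabla^2f)_p(v,v)+2\beta_2\sqrt{(\nabla^2F)_p(v,v)}\sqrt{(\nabla^2f)_p(u,u)}\sqrt{(\nabla^2f)_p(v,v)}.$$ Newton decrement: $\lambda_{h,\alpha}(x)=\inf\{c\ge0: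 |dh_x(v)|\le c\sqrt{\alpha(\nabla^2h)_x(v,v)}\ \forall v\in T_xN\}$ (infimum of the empty set being $+\infty$), $\lambda_h:=\lambda_{h,1}$. Barrier: $F\colon D\to\mathbb{R}$ is a $\theta$-barrier for the open convex set $D$ ($\theta\ge0$) if it is strongly $1$-self-concordant with positive definite Hessian and $\lambda_F(x)\le\sqrt\theta$ for all $x\in D$. *)

theory Defs
  imports "HOL-Analysis.Analysis"
begin

text \<open>
  Riemannian manifolds are given by a topological type of points together with an atlas, whose
  charts carry the components of the metric. The model space is a finite-dimensional
  \<^class>\<open>real_inner\<close> space; unlike \<^class>\<open>euclidean_space\<close> this admits dimension 0.
  Only its topology and smooth structure matter, not its inner product.

  A tangent vector at \<open>p\<close> is represented by its coordinate vector in a chart around \<open>p\<close>, and tensors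
  by their components. A tensorial statement over all tangent vectors at \<open>p\<close> is therefore
  quantified over every chart around \<open>p\<close> and all coordinate vectors in that chart; since the
  components transform tensorially, every chart around \<open>p\<close> makes the same statement.
\<close>

text \<open>For open \<open>S\<close> in a finite-dimensional space this is the usual notion of \<open>C\<^sup>k\<close>.\<close>

primrec Ck_on :: "nat \<Rightarrow> 'a::real_normed_vector set \<Rightarrow> ('a \<Rightarrow> 'b::real_normed_vector) \<Rightarrow> bool" where
  "Ck_on 0 S f = continuous_on S f"
| "Ck_on (Suc k) S f =
     ((\<forall>x\<in>S. f differentiable (at x)) \<and> (\<forall>v. Ck_on k S (\<lambda>x. frechet_derivative f (at x) v)))"

definition smooth_on :: "'a::real_normed_vector set \<Rightarrow> ('a \<Rightarrow> 'b::real_normed_vector) \<Rightarrow> bool" where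
  "smooth_on S f \<longleftrightarrow> (\<forall>k. Ck_on k S f)"

record ('m, 'e) rchart =
  chart_dom :: "'m set"
  chart_map :: "'m \<Rightarrow> 'e"
  chart_metric :: "'m \<Rightarrow> 'e \<Rightarrow> 'e \<Rightarrow> real"

definition chart_inv :: "('m, 'e) rchart \<Rightarrow> 'e \<Rightarrow> 'm" where
  "chart_inv c = inv_into (chart_dom c) (chart_map c)"

definition is_chart :: "('m::topological_space, 'e::real_inner) rchart \<Rightarrow> bool" where
  "is_chart c \<longleftrightarrow>
     open (chart_dom c) \<and> open (chart_map c ` chart_dom c) \<and>
     homeomorphism (chart_dom c) (chart_map c ` chart_dom c) (chart_map c) (chart_inv c) \<and>
     (\<forall>p\<in>chart_dom c. bilinear (chart_metric c p) \<and>
        (\<forall>u v. chart_metric c p u v = chart_metric c p v u) \<and>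
        (\<forall>u. u \<noteq> 0 \<longrightarrow> chart_metric c p u u > 0)) \<and>
     (\<forall>u v. smooth_on (chart_map c ` chart_dom c) (\<lambda>x. chart_metric c (chart_inv c x) u v))"

definition compatible_charts ::
    "('m, 'e::real_inner) rchart \<Rightarrow> ('m, 'e) rchart \<Rightarrow> bool" where
  "compatible_charts c c' \<longleftrightarrow>
     smooth_on (chart_map c ` (chart_dom c \<inter> chart_dom c')) (chart_map c' \<circ> chart_inv c) \<and>
     (\<forall>p \<in> chart_dom c \<inter> chart_dom c'. \<forall>u v.
        let J = frechet_derivative (chart_map c' \<circ> chart_inv c) (at (chart_map c p))
        in chart_metric c p u v = chart_metric c' p (J u) (J v))"

definition riemannian_manifold ::
    "('m::{t2_space, second_countable_topology}, 'e::real_inner) rchart set \<Rightarrow> bool" where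
  "riemannian_manifold A \<longleftrightarrow>
     (\<exists>B :: 'e set. finite B \<and> span B = UNIV) \<and>
     (\<Union>c\<in>A. chart_dom c) = UNIV \<and>
     (\<forall>c\<in>A. is_chart c) \<and>
     (\<forall>c\<in>A. \<forall>c'\<in>A. compatible_charts c c')"

text \<open>Any atlas will do, so the product is described by the charts \<open>\<phi> \<times> \<psi>\<close> alone.\<close>

definition prod_rchart :: "('m, 'e) rchart \<Rightarrow> ('n, 'd) rchart \<Rightarrow> ('m \<times> 'n, 'e \<times> 'd) rchart" where
  "prod_rchart c d = \<lparr>
     chart_dom = chart_dom c \<times> chart_dom d,
     chart_map = map_prod (chart_map c) (chart_map d),
     chart_metric = (\<lambda>p u v. chart_metric c (fst p) (fst u) (fst v) +
                             chart_metric d (snd p) (snd u) (snd v))\<rparr>"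

definition prod_manifold ::
    "('m, 'e) rchart set \<Rightarrow> ('n, 'd) rchart set \<Rightarrow> ('m \<times> 'n, 'e \<times> 'd) rchart set" where
  "prod_manifold A B = (\<lambda>(c, d). prod_rchart c d) ` (A \<times> B)"

definition real_line :: "(real, real) rchart set" where
  "real_line = {\<lparr>chart_dom = UNIV, chart_map = id, chart_metric = (\<lambda>_ u v. u * v)\<rparr>}"

text \<open>Derivative of a function on the manifold along the constant coordinate field \<open>u\<close> of a chart;
  it equals \<open>dh\<^sub>p(u)\<close>.\<close>

definition cderiv ::
    "('m, 'e::real_normed_vector) rchart \<Rightarrow> ('m \<Rightarrow> real) \<Rightarrow> 'm \<Rightarrow> 'e \<Rightarrow> real" where
  "cderiv c h p u = frechet_derivative (h \<circ> chart_inv c) (at (chart_map c p)) u"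

text \<open>Christoffel map of the Levi-Civita connection: \<open>\<Gamma>\<^sub>p(u,v) = (\<nabla>\<^sub>u v)\<^sub>p\<close> for constant coordinate
  fields \<open>u\<close> and \<open>v\<close>, characterised by the Koszul formula (the Lie brackets vanish).\<close>

definition christoffel ::
    "('m, 'e::real_normed_vector) rchart \<Rightarrow> 'm \<Rightarrow> 'e \<Rightarrow> 'e \<Rightarrow> 'e" where
  "christoffel c p u v = (THE z. \<forall>w. chart_metric c p z w =
      (cderiv c (\<lambda>q. chart_metric c q v w) p u +
       cderiv c (\<lambda>q. chart_metric c q u w) p v -
       cderiv c (\<lambda>q. chart_metric c q u v) p w) / 2)"

text \<open>The Leibniz rule for constant coordinate fields:
  \<open>(\<nabla>\<^sup>2h)(u,v) = u(v h) - (\<nabla>\<^sub>u v) h\<close> and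
  \<open>(\<nabla>\<^sup>3h)(u,v,w) = u((\<nabla>\<^sup>2h)(v,w)) - (\<nabla>\<^sup>2h)(\<nabla>\<^sub>u v, w) - (\<nabla>\<^sup>2h)(v, \<nabla>\<^sub>u w)\<close>.\<close>

definition hess ::
    "('m, 'e::real_normed_vector) rchart \<Rightarrow> ('m \<Rightarrow> real) \<Rightarrow> 'm \<Rightarrow> 'e \<Rightarrow> 'e \<Rightarrow> real" where
  "hess c h p u v =
     cderiv c (\<lambda>q. cderiv c h q v) p u - cderiv c h p (christoffel c p u v)"

definition nabla3 ::
    "('m, 'e::real_normed_vector) rchart \<Rightarrow> ('m \<Rightarrow> real) \<Rightarrow> 'm \<Rightarrow> 'e \<Rightarrow> 'e \<Rightarrow> 'e \<Rightarrow> real" where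
  "nabla3 c h p u v w =
     cderiv c (\<lambda>q. hess c h q v w) p u
     - hess c h p (christoffel c p u v) w - hess c h p v (christoffel c p u w)"

definition smooth_fun ::
    "('m, 'e::real_normed_vector) rchart set \<Rightarrow> 'm set \<Rightarrow> ('m \<Rightarrow> real) \<Rightarrow> bool" where
  "smooth_fun A D h \<longleftrightarrow>
     (\<forall>c\<in>A. smooth_on (chart_map c ` (chart_dom c \<inter> D)) (h \<circ> chart_inv c))"

text \<open>The geodesic equation \<open>x'' = -\<Gamma>(x',x')\<close> in every chart, with one-sided derivatives at
  endpoints of the interval \<open>I\<close>. Constant curves are geodesics.\<close>

definition geodesic_on ::
    "('m::topological_space, 'e::real_normed_vector) rchart set \<Rightarrow> real set \<Rightarrow> (real \<Rightarrow> 'm) \<Rightarrow> bool" where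
  "geodesic_on A I \<gamma> \<longleftrightarrow> continuous_on I \<gamma> \<and>
     (\<forall>c\<in>A. \<exists>x'. \<forall>t\<in>I. \<gamma> t \<in> chart_dom c \<longrightarrow>
        ((chart_map c \<circ> \<gamma>) has_vector_derivative x' t) (at t within I) \<and>
        (x' has_vector_derivative - christoffel c (\<gamma> t) (x' t) (x' t)) (at t within I))"

definition geodesically_complete ::
    "('m::topological_space, 'e::real_normed_vector) rchart set \<Rightarrow> bool" where
  "geodesically_complete A \<longleftrightarrow>
     (\<forall>c\<in>A. \<forall>p\<in>chart_dom c. \<forall>v. \<exists>\<gamma>. geodesic_on A UNIV \<gamma> \<and> \<gamma> 0 = p \<and>
        ((chart_map c \<circ> \<gamma>) has_vector_derivative v) (at 0))"

definition geod_convex ::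
    "('m::topological_space, 'e::real_normed_vector) rchart set \<Rightarrow> 'm set \<Rightarrow> bool" where
  "geod_convex A D \<longleftrightarrow>
     (\<forall>\<gamma>. geodesic_on A {0..1} \<gamma> \<and> \<gamma> 0 \<in> D \<and> \<gamma> 1 \<in> D \<longrightarrow> \<gamma> ` {0..1} \<subseteq> D)"

definition convex_fun ::
    "('m::topological_space, 'e::real_normed_vector) rchart set \<Rightarrow> 'm set \<Rightarrow> ('m \<Rightarrow> real) \<Rightarrow> bool" where
  "convex_fun A D h \<longleftrightarrow> geod_convex A D \<and>
     (\<forall>\<gamma>. geodesic_on A {0..1} \<gamma> \<and> \<gamma> 0 \<in> D \<and> \<gamma> 1 \<in> D \<longrightarrow> convex_on {0..1} (h \<circ> \<gamma>))"

definition closed_convex_fun ::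
    "('m::topological_space, 'e::real_normed_vector) rchart set \<Rightarrow> 'm set \<Rightarrow> ('m \<Rightarrow> real) \<Rightarrow> bool" where
  "closed_convex_fun A D h \<longleftrightarrow> convex_fun A D h \<and> closed {(x, s). x \<in> D \<and> h x \<le> s}"

definition has_closed_convex_extension ::
    "('m::topological_space, 'e::real_normed_vector) rchart set \<Rightarrow> 'm set \<Rightarrow> ('m \<Rightarrow> real) \<Rightarrow> bool" where
  "has_closed_convex_extension A D h \<longleftrightarrow>
     (\<exists>D' h'. D \<subseteq> D' \<and> closed_convex_fun A D' h' \<and> (\<forall>x\<in>D. h' x = h x))"

definition self_concordant ::
    "('m::topological_space, 'e::real_normed_vector) rchart set \<Rightarrow> real \<Rightarrow> 'm set \<Rightarrow> ('m \<Rightarrow> real) \<Rightarrow> bool" where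
  "self_concordant A \<alpha> D h \<longleftrightarrow> \<alpha> > 0 \<and> open D \<and> smooth_fun A D h \<and> convex_fun A D h \<and>
     (\<forall>x\<in>D. \<forall>c\<in>A. x \<in> chart_dom c \<longrightarrow> (\<forall>u v w.
        \<bar>nabla3 c h x u v w\<bar> \<le>
          2 / sqrt \<alpha> * sqrt (hess c h x u u) * sqrt (hess c h x v v) * sqrt (hess c h x w w)))"

definition strongly_self_concordant ::
    "('m::topological_space, 'e::real_normed_vector) rchart set \<Rightarrow> real \<Rightarrow> 'm set \<Rightarrow> ('m \<Rightarrow> real) \<Rightarrow> bool" where
  "strongly_self_concordant A \<alpha> D h \<longleftrightarrow> self_concordant A \<alpha> D h \<and> closed_convex_fun A D h"

definition compatible ::
    "('m, 'e::real_normed_vector) rchart set \<Rightarrow> 'm set \<Rightarrow> real \<Rightarrow> real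
      \<Rightarrow> ('m \<Rightarrow> real) \<Rightarrow> ('m \<Rightarrow> real) \<Rightarrow> bool" where
  "compatible A D \<beta>1 \<beta>2 f F \<longleftrightarrow>
     (\<forall>p\<in>D. \<forall>c\<in>A. p \<in> chart_dom c \<longrightarrow> (\<forall>u v.
        \<bar>nabla3 c f p u v v\<bar> \<le>
          2 * \<beta>1 * sqrt (hess c F p u u) * hess c f p v v +
          2 * \<beta>2 * sqrt (hess c F p v v) * sqrt (hess c f p u u) * sqrt (hess c f p v v)))"

definition newton_decrement ::
    "('m, 'e::real_normed_vector) rchart set \<Rightarrow> ('m \<Rightarrow> real) \<Rightarrow> real \<Rightarrow> 'm \<Rightarrow> ennreal" where
  "newton_decrement A h \<alpha> x =
     Inf (ennreal ` {k. 0 \<le> k \<and> (\<forall>c\<in>A. x \<in> chart_dom c \<longrightarrow>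
        (\<forall>v. \<bar>cderiv c h x v\<bar> \<le> k * sqrt (\<alpha> * hess c h x v v)))})"

definition barrier ::
    "('m::topological_space, 'e::real_normed_vector) rchart set \<Rightarrow> real \<Rightarrow> 'm set \<Rightarrow> ('m \<Rightarrow> real) \<Rightarrow> bool" where
  "barrier A \<theta> D F \<longleftrightarrow> 0 \<le> \<theta> \<and> strongly_self_concordant A 1 D F \<and>
     (\<forall>x\<in>D. \<forall>c\<in>A. x \<in> chart_dom c \<longrightarrow> (\<forall>v. v \<noteq> 0 \<longrightarrow> hess c F x v v > 0)) \<and>
     (\<forall>x\<in>D. newton_decrement A F 1 x \<le> ennreal (sqrt \<theta>))"

definition open_epigraph :: "'m set \<Rightarrow> ('m \<Rightarrow> real) \<Rightarrow> ('m \<times> real) set" where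
  "open_epigraph D f = {(p, t). p \<in> D \<and> f p < t}"

end

theory Submission
  imports Defs
begin

text \<open>
  The barrier is the sum of \<open>- ln \<omega>\<close>, where \<open>\<omega> = t - f(p)\<close> is the slack, and of \<open>F\<close> pulled back from the
  base. Convexity is seen directly along geodesics: in the product they are pairs of a geodesic and
  an affine function, hence the slack is concave along them (\<open>log_barrier_convex_fun\<close>).

  For self-concordance put \<open>\<xi> = d\<omega>/\<omega>\<close>. As \<open>t\<close> has vanishing covariant derivatives of order two and
  three, the Leibniz rule gives, for tangent vectors \<open>x\<close> and \<open>y\<close> with base components \<open>u\<close> and \<open>v\<close>,
  \<open>(\<nabla>\<^sup>2G)(x,x) = \<xi>(x)\<^sup>2 + (\<nabla>\<^sup>2f)(u,u)/\<omega> + (\<nabla>\<^sup>2F)(u,u)\<close> and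
  \<open>(\<nabla>\<^sup>3G)(x,y,y) = (\<nabla>\<^sup>3f)(u,v,v)/\<omega> - (\<xi>(x) (\<nabla>\<^sup>2f)(v,v) + 2 \<xi>(y) (\<nabla>\<^sup>2f)(u,v))/\<omega> - 2 \<xi>(x) \<xi>(y)\<^sup>2 + (\<nabla>\<^sup>3F)(u,v,v)\<close>.
  Compatibility and self-concordance of \<open>F\<close> bound the second expression by one that is linear in the
  three square roots making up \<open>(\<nabla>\<^sup>2G)(x,x)\<close> and quadratic in those of \<open>(\<nabla>\<^sup>2G)(y,y)\<close>. The
  Cauchy-Schwarz inequality and the inequality of arithmetic and geometric means
  (\<open>log_barrier_inequality\<close>) then produce precisely the maximum in the definition of \<open>\<alpha>\<close>. On a curved manifold \<open>\<nabla>\<^sup>3G\<close> is symmetric in its last two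
  arguments only, but this suffices to pass from \<open>(x,y,y)\<close> to arbitrary arguments by polarisation
  (\<open>symmetric_form_bound\<close>).

  The bound on the Newton decrement is the Cauchy-Schwarz inequality for \<open>dG = dF - \<xi>\<close>, and
  closedness of the epigraph is an argument with sequences (\<open>log_barrier_closed_epigraph\<close>).

  The calculus behind these formulas is developed in a single chart
  (locale \<open>riemannian_chart\<close>). It needs the symmetry of second derivatives
  (\<open>frechet_derivative_mixed_eq\<close>) and the differentiability of the Christoffel map in the base point
  (\<open>christoffel_representation\<close>); that Hessians of convex functions are nonnegative is where
  geodesic completeness enters (\<open>convex_fun_hess_nonneg\<close>).
\<close>

section \<open>Calculus of smooth functions\<close>

lemma Ck_on_cong:
  assumes "open S" "\<And>x. x \<in> S \<Longrightarrow> f x = g x" "Ck_on k S f"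
  shows "Ck_on k S g"
  using assms(2,3)
proof (induction k arbitrary: f g)
  case 0
  then show ?case by (simp cong: continuous_on_cong)
next
  case (Suc k)
  have df: "f differentiable (at x)" if "x \<in> S" for x
    using Suc.prems(2) that by simp
  have d: "g differentiable (at x)" if "x \<in> S" for x
    using df[OF that] has_derivative_transform_within_open[where f=f and g=g, OF _ assms(1) that Suc.prems(1)]
    unfolding differentiable_def by blast
  have "Ck_on k S (\<lambda>x. frechet_derivative g (at x) v)" for v
  proof (rule Suc.IH)
    show "Ck_on k S (\<lambda>x. frechet_derivative f (at x) v)" using Suc.prems by simp
    show "frechet_derivative f (at x) v = frechet_derivative g (at x) v" if "x \<in> S" for x
      using frechet_derivative_transform_within_open[OF df[OF that] assms(1) that Suc.prems(1)]
      by simp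
  qed
  with d show ?case by simp
qed

lemma Ck_on_Suc_D: "Ck_on (Suc k) S f \<Longrightarrow> Ck_on k S f"
proof (induction k arbitrary: f)
  case 0
  then show ?case
    by (simp add: continuous_at_imp_continuous_on differentiable_imp_continuous_within)
next
  case (Suc k)
  then show ?case by simp
qed

lemma Ck_on_subset: "Ck_on k S f \<Longrightarrow> T \<subseteq> S \<Longrightarrow> Ck_on k T f"
  by (induction k arbitrary: f) (auto intro: continuous_on_subset)

text \<open>With an explicit derivative the closure proofs below reduce to the rules for derivatives
  and an induction on the order.\<close>

lemma Ck_on_Suc_I:
  assumes "open S" "\<And>x. x \<in> S \<Longrightarrow> (f has_derivative f' x) (at x)"
    and "\<And>v. Ck_on k S (\<lambda>x. f' x v)"
  shows "Ck_on (Suc k) S f"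
proof -
  have "frechet_derivative f (at x) = f' x" if "x \<in> S" for x
    using frechet_derivative_at[OF assms(2)[OF that]] by simp
  then have "Ck_on k S (\<lambda>x. frechet_derivative f (at x) v)" for v
    by (intro Ck_on_cong[OF assms(1) _ assms(3)]) simp
  moreover have "f differentiable (at x)" if "x \<in> S" for x
    using assms(2)[OF that] differentiable_def by blast
  ultimately show ?thesis by simp
qed

lemma Ck_on_has_derivative:
  "Ck_on (Suc k) S f \<Longrightarrow> x \<in> S \<Longrightarrow> (f has_derivative frechet_derivative f (at x)) (at x)"
  by (simp add: frechet_derivative_works)

lemma Ck_on_const: "open S \<Longrightarrow> Ck_on k S (\<lambda>x. a)"
proof (induction k arbitrary: a)
  case (Suc k)
  then show ?case by (intro Ck_on_Suc_I[where f'="\<lambda>_ _. 0"]) auto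
qed simp

lemma Ck_on_linear: "open S \<Longrightarrow> bounded_linear f \<Longrightarrow> Ck_on k S f"
proof (cases k)
  case (Suc l)
  assume "open S" "bounded_linear f"
  then show ?thesis unfolding Suc
    by (intro Ck_on_Suc_I[where f'="\<lambda>_. f"] bounded_linear_imp_has_derivative Ck_on_const)
qed (simp add: linear_continuous_on)

lemma Ck_on_add:
  "open S \<Longrightarrow> Ck_on k S f \<Longrightarrow> Ck_on k S g \<Longrightarrow> Ck_on k S (\<lambda>x. f x + g x)"
proof (induction k arbitrary: f g)
  case (Suc k)
  show ?case
    by (rule Ck_on_Suc_I[OF Suc.prems(1)
          has_derivative_add[OF Ck_on_has_derivative[OF Suc.prems(2)]
            Ck_on_has_derivative[OF Suc.prems(3)]]])
      (use Suc in auto)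
qed (simp add: continuous_on_add)

lemma Ck_on_mult:
  fixes f g :: "'a::real_normed_vector \<Rightarrow> real"
  shows "open S \<Longrightarrow> Ck_on k S f \<Longrightarrow> Ck_on k S g \<Longrightarrow> Ck_on k S (\<lambda>x. f x * g x)"
proof (induction k arbitrary: f g)
  case (Suc k)
  show ?case
  proof (rule Ck_on_Suc_I[OF Suc.prems(1)
          has_derivative_mult[OF Ck_on_has_derivative[OF Suc.prems(2)]
            Ck_on_has_derivative[OF Suc.prems(3)]]])
    fix v
    show "Ck_on k S (\<lambda>x. f x * frechet_derivative g (at x) v + frechet_derivative f (at x) v * g x)"
      using Suc.prems Ck_on_Suc_D[OF Suc.prems(2)] Ck_on_Suc_D[OF Suc.prems(3)]
      by (intro Ck_on_add Suc.IH) auto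
  qed
qed (simp add: continuous_on_mult)

lemma Ck_on_inverse:
  fixes f :: "'a::real_normed_vector \<Rightarrow> real"
  shows "open S \<Longrightarrow> (\<And>x. x \<in> S \<Longrightarrow> f x \<noteq> 0) \<Longrightarrow> Ck_on k S f \<Longrightarrow> Ck_on k S (\<lambda>x. inverse (f x))"
proof (induction k)
  case (Suc k)
  show ?case
  proof (rule Ck_on_Suc_I[OF Suc.prems(1)
          Deriv.has_derivative_inverse[OF Suc.prems(2) Ck_on_has_derivative[OF Suc.prems(3)]]])
    fix v
    have i: "Ck_on k S (\<lambda>x. inverse (f x))"
      using Suc.IH[OF Suc.prems(1,2)] Ck_on_Suc_D[OF Suc.prems(3)] by blast
    have "Ck_on k S (\<lambda>x. (-1) * (inverse (f x) * frechet_derivative f (at x) v * inverse (f x)))"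
      using Suc.prems by (intro Ck_on_mult i Ck_on_const) auto
    then show "Ck_on k S (\<lambda>x. - (inverse (f x) * frechet_derivative f (at x) v * inverse (f x)))"
      by simp
  qed auto
qed (simp add: continuous_on_inverse)

lemma Ck_on_ln:
  fixes f :: "'a::real_normed_vector \<Rightarrow> real"
  assumes "open S" "\<And>x. x \<in> S \<Longrightarrow> 0 < f x" "Ck_on k S f"
  shows "Ck_on k S (\<lambda>x. ln (f x))"
proof (cases k)
  case 0
  then show ?thesis using assms by (force intro!: continuous_intros)
next
  case (Suc l)
  note C = assms(3)[unfolded Suc]
  show ?thesis unfolding Suc
  proof (rule Ck_on_Suc_I[OF assms(1)
          has_derivative_ln[OF assms(2) Ck_on_has_derivative[OF C]]])
    fix v
    have "Ck_on l S (\<lambda>x. frechet_derivative f (at x) v * inverse (f x))"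
      using C assms Ck_on_Suc_D[OF C] by (intro Ck_on_mult Ck_on_inverse) (force)+
    then show "Ck_on l S (\<lambda>x. frechet_derivative f (at x) v * inverse (f x))" .
  qed auto
qed

lemma Ck_on_comp_linear:
  assumes "bounded_linear L" "open S" "open T" "L ` T \<subseteq> S"
  shows "Ck_on k S f \<Longrightarrow> Ck_on k T (\<lambda>z. f (L z))"
proof (induction k arbitrary: f)
  case 0
  then have "continuous_on S f" by simp
  then show ?case using continuous_on_compose2[OF _ linear_continuous_on[OF assms(1)] assms(4)]
    by simp
next
  case (Suc k)
  show ?case
  proof (rule Ck_on_Suc_I[OF assms(3)])
    fix z assume z: "z \<in> T"
    show "((\<lambda>z. f (L z)) has_derivative (\<lambda>v. frechet_derivative f (at (L z)) (L v))) (at z)"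
      using has_derivative_compose[OF bounded_linear_imp_has_derivative[OF assms(1)]
          Ck_on_has_derivative[OF Suc.prems]] z assms(4) by blast
  next
    show "Ck_on k T (\<lambda>z. frechet_derivative f (at (L z)) (L v))" for v
      using Suc.IH[of "\<lambda>x. frechet_derivative f (at x) (L v)"] Suc.prems by simp
  qed
qed

lemma smooth_on_differentiable: "smooth_on S f \<Longrightarrow> x \<in> S \<Longrightarrow> f differentiable (at x)"
  unfolding smooth_on_def by (drule spec[of _ "Suc 0"]) simp

lemma smooth_on_frechet_derivative:
  assumes "smooth_on S f"
  shows "smooth_on S (\<lambda>x. frechet_derivative f (at x) v)"
  unfolding smooth_on_def
proof
  fix k
  have "Ck_on (Suc k) S f" using assms unfolding smooth_on_def ..
  then show "Ck_on k S (\<lambda>x. frechet_derivative f (at x) v)" by simp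
qed

lemma smooth_on_continuous_on: "smooth_on S f \<Longrightarrow> continuous_on S f"
  unfolding smooth_on_def by (drule spec[of _ 0]) simp

lemma smooth_on_cong:
  "open S \<Longrightarrow> (\<And>x. x \<in> S \<Longrightarrow> f x = g x) \<Longrightarrow> smooth_on S f \<Longrightarrow> smooth_on S g"
  unfolding smooth_on_def by (blast intro: Ck_on_cong)

lemma smooth_on_subset: "smooth_on S f \<Longrightarrow> T \<subseteq> S \<Longrightarrow> smooth_on T f"
  unfolding smooth_on_def using Ck_on_subset by blast

lemma frechet_derivative_along_line:
  fixes h :: "'a::real_normed_vector \<Rightarrow> real"
  assumes "h differentiable (at (y + a *\<^sub>R u))"
  shows "DERIV (\<lambda>a. h (y + a *\<^sub>R u)) a :> frechet_derivative h (at (y + a *\<^sub>R u)) u"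
proof -
  let ?D = "frechet_derivative h (at (y + a *\<^sub>R u))"
  have D: "(h has_derivative ?D) (at (y + a *\<^sub>R u))"
    using assms frechet_derivative_works by blast
  have "((\<lambda>a. y + a *\<^sub>R u) has_derivative (\<lambda>s. s *\<^sub>R u)) (at a)"
    by (auto intro!: derivative_eq_intros)
  from has_derivative_compose[OF this D]
  have "((\<lambda>a. h (y + a *\<^sub>R u)) has_derivative (\<lambda>s. ?D (s *\<^sub>R u))) (at a)" .
  moreover have "?D (s *\<^sub>R u) = ?D u * s" for s
    using linear_frechet_derivative[OF assms] by (simp add: linear_cmul)
  ultimately show ?thesis
    by (simp add: has_field_derivative_def)
qed

text \<open>The mean value theorem is applied to \<open>a \<mapsto> h (x + a u + s v) - h (x + a u)\<close> and then, at the point found,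
  to the derivative of \<open>h\<close> in direction \<open>u\<close> along \<open>v\<close>.\<close>

lemma second_difference_mean_value:
  fixes h :: "'a::real_normed_vector \<Rightarrow> real"
  assumes "0 < s"
    and S: "\<And>a b. 0 \<le> a \<Longrightarrow> a \<le> s \<Longrightarrow> 0 \<le> b \<Longrightarrow> b \<le> s \<Longrightarrow> x + a *\<^sub>R u + b *\<^sub>R v \<in> S"
    and h: "\<And>y. y \<in> S \<Longrightarrow> h differentiable (at y)"
    and hu: "\<And>y. y \<in> S \<Longrightarrow> (\<lambda>x. frechet_derivative h (at x) u) differentiable (at y)"
  obtains a b where "0 \<le> a" "a \<le> s" "0 \<le> b" "b \<le> s"
    "h (x + s *\<^sub>R u + s *\<^sub>R v) - h (x + s *\<^sub>R u) - h (x + s *\<^sub>R v) + h x =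
     s * s * frechet_derivative (\<lambda>x. frechet_derivative h (at x) u) (at (x + a *\<^sub>R u + b *\<^sub>R v)) v"
proof -
  define \<phi> where "\<phi> = (\<lambda>a. h ((x + s *\<^sub>R v) + a *\<^sub>R u) - h (x + a *\<^sub>R u))"
  define \<phi>' where "\<phi>' = (\<lambda>a. frechet_derivative h (at ((x + s *\<^sub>R v) + a *\<^sub>R u)) u
     - frechet_derivative h (at (x + a *\<^sub>R u)) u)"
  have "\<exists>a>0. a < s \<and> \<phi> s - \<phi> 0 = (s - 0) * \<phi>' a"
  proof (rule MVT2[OF assms(1)])
    fix a assume a: "0 \<le> a" "a \<le> s"
    show "DERIV \<phi> a :> \<phi>' a" unfolding \<phi>_def \<phi>'_def
    proof (intro DERIV_diff frechet_derivative_along_line h)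
      show "x + s *\<^sub>R v + a *\<^sub>R u \<in> S" using S[of a s] a assms(1) by (simp add: ac_simps)
      show "x + a *\<^sub>R u \<in> S" using S[of a 0] a assms(1) by simp
    qed
  qed
  then obtain a where a: "0 < a" "a < s" and e1: "\<phi> s - \<phi> 0 = s * \<phi>' a" by auto
  define \<eta> where "\<eta> = (\<lambda>b. frechet_derivative h (at ((x + a *\<^sub>R u) + b *\<^sub>R v)) u)"
  define \<eta>' where "\<eta>' = (\<lambda>b. frechet_derivative (\<lambda>x. frechet_derivative h (at x) u)
      (at ((x + a *\<^sub>R u) + b *\<^sub>R v)) v)"
  have "\<exists>b>0. b < s \<and> \<eta> s - \<eta> 0 = (s - 0) * \<eta>' b"
  proof (rule MVT2[OF assms(1)])
    fix b assume b: "0 \<le> b" "b \<le> s"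
    show "DERIV \<eta> b :> \<eta>' b" unfolding \<eta>_def \<eta>'_def
      by (intro frechet_derivative_along_line[of "\<lambda>x. frechet_derivative h (at x) u"] hu S)
        (use a b in auto)
  qed
  then obtain b where b: "0 < b" "b < s" and e2: "\<eta> s - \<eta> 0 = s * \<eta>' b" by auto
  have "\<phi>' a = \<eta> s - \<eta> 0" unfolding \<phi>'_def \<eta>_def by (simp add: ac_simps)
  then have "\<phi> s - \<phi> 0 = s * s * \<eta>' b" using e1 e2 by simp
  then show ?thesis
    by (intro that[of a b]) (use a b in \<open>auto simp: \<phi>_def \<eta>'_def ac_simps\<close>)
qed

text \<open>The second difference is symmetric in \<open>u\<close> and \<open>v\<close>, and it is \<open>s\<^sup>2\<close> times a value of either mixed
  derivative at a point that tends to \<open>x\<close> with \<open>s\<close>. By continuity both mixed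
  derivatives at \<open>x\<close> are limits of the same quotient.\<close>

lemma frechet_derivative_mixed_eq:
  fixes h :: "'a::real_normed_vector \<Rightarrow> real"
  assumes S: "open S" "x \<in> S" and h: "smooth_on S h"
  shows "frechet_derivative (\<lambda>x. frechet_derivative h (at x) v) (at x) u =
         frechet_derivative (\<lambda>x. frechet_derivative h (at x) u) (at x) v" (is "?P x = ?Q x")
proof (rule ccontr)
  assume "?P x \<noteq> ?Q x"
  define e where "e = \<bar>?P x - ?Q x\<bar> / 2"
  have e: "0 < e" using \<open>?P x \<noteq> ?Q x\<close> unfolding e_def by simp
  have hv: "smooth_on S (\<lambda>x. frechet_derivative h (at x) w)" for w
    by (rule smooth_on_frechet_derivative[OF h])
  have "continuous_on S ?P" "continuous_on S ?Q"
    by (intro smooth_on_continuous_on smooth_on_frechet_derivative hv)+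
  then have "isCont ?P x" "isCont ?Q x" using S continuous_on_eq_continuous_at by blast+
  then obtain d1 d2 where d1: "0 < d1" "\<And>y. dist y x < d1 \<Longrightarrow> dist (?P y) (?P x) < e"
    and d2: "0 < d2" "\<And>y. dist y x < d2 \<Longrightarrow> dist (?Q y) (?Q x) < e"
    using e unfolding continuous_at_eps_delta by blast
  obtain d3 where d3: "0 < d3" "ball x d3 \<subseteq> S" using S open_contains_ball by blast
  define d where "d = min d1 (min d2 d3)"
  define m where "m = norm u + norm v + 1"
  define s where "s = d / 2 / m"
  have d: "0 < d" unfolding d_def using d1 d2 d3 by simp
  have n: "0 < m" unfolding m_def by (simp add: add_nonneg_pos)
  have s: "0 < s" using d n unfolding s_def by simp
  have close: "dist (x + a *\<^sub>R u + b *\<^sub>R v) x < d" if "0 \<le> a" "a \<le> s" "0 \<le> b" "b \<le> s" for a b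
  proof -
    have "dist (x + a *\<^sub>R u + b *\<^sub>R v) x = norm (a *\<^sub>R u + b *\<^sub>R v)" by (simp add: dist_norm add.assoc)
    also have "\<dots> \<le> a * norm u + b * norm v" using that norm_triangle_ineq[of "a *\<^sub>R u" "b *\<^sub>R v"] by simp
    also have "\<dots> \<le> s * norm u + s * norm v" using that by (intro add_mono mult_right_mono) auto
    also have "\<dots> \<le> s * m" unfolding m_def using s by (simp add: algebra_simps)
    also have "\<dots> = d / 2" unfolding s_def using n by simp
    finally show ?thesis using d by simp
  qed
  have inS: "x + a *\<^sub>R u + b *\<^sub>R v \<in> S" if "0 \<le> a" "a \<le> s" "0 \<le> b" "b \<le> s" for a b
    using close[OF that] d3 unfolding d_def by (auto simp: subset_iff dist_commute)
  obtain a b where ab: "0 \<le> a" "a \<le> s" "0 \<le> b" "b \<le> s" and q: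
    "h (x + s *\<^sub>R u + s *\<^sub>R v) - h (x + s *\<^sub>R u) - h (x + s *\<^sub>R v) + h x =
     s * s * ?Q (x + a *\<^sub>R u + b *\<^sub>R v)"
    by (rule second_difference_mean_value[where h=h and u=u and v=v, OF s inS])
      (use smooth_on_differentiable[OF h] smooth_on_differentiable[OF hv] in auto)
  obtain a' b' where ab': "0 \<le> a'" "a' \<le> s" "0 \<le> b'" "b' \<le> s" and p:
    "h (x + s *\<^sub>R v + s *\<^sub>R u) - h (x + s *\<^sub>R v) - h (x + s *\<^sub>R u) + h x =
     s * s * ?P (x + a' *\<^sub>R v + b' *\<^sub>R u)"
  proof (rule second_difference_mean_value[where h=h and u=v and v=u and x=x, OF s])
    show "x + a *\<^sub>R v + b *\<^sub>R u \<in> S" if "0 \<le> a" "a \<le> s" "0 \<le> b" "b \<le> s" for a b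
      using inS[of b a] that by (simp add: ac_simps)
  qed (use smooth_on_differentiable[OF h] smooth_on_differentiable[OF hv] in auto)
  have swap: "x + s *\<^sub>R v + s *\<^sub>R u = x + s *\<^sub>R u + s *\<^sub>R v" by (simp add: ac_simps)
  have "s * s * ?Q (x + a *\<^sub>R u + b *\<^sub>R v) = s * s * ?P (x + a' *\<^sub>R v + b' *\<^sub>R u)"
    using p q unfolding swap by linarith
  then have "?Q (x + a *\<^sub>R u + b *\<^sub>R v) = ?P (x + a' *\<^sub>R v + b' *\<^sub>R u)" using s by simp
  moreover have "dist (?Q (x + a *\<^sub>R u + b *\<^sub>R v)) (?Q x) < e"
    using d2(2) close[OF ab] unfolding d_def by simp
  moreover have "dist (?P (x + a' *\<^sub>R v + b' *\<^sub>R u)) (?P x) < e"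
    using d1(2) close[OF ab'(3,4,1,2)] unfolding d_def by (simp add: ac_simps)
  moreover have "dist (?P x) (?Q x) = 2 * e" unfolding e_def dist_real_def by simp
  ultimately show False
    using dist_triangle3[of "?P x" "?Q x" "?Q (x + a *\<^sub>R u + b *\<^sub>R v)"] by simp
qed

section \<open>Linear algebra in a finite-dimensional inner product space\<close>

text \<open>Orthogonalising a finite spanning set and discarding \<open>0\<close> gives a basis whose coordinate
  functionals are inner products: they are bounded, so curves can be differentiated
  coordinate by coordinate.\<close>

lemma finite_dim_orthogonal_expansion:
  fixes B :: "'e::real_inner set"
  assumes "finite B" "span B = UNIV"
  obtains C :: "'e set" where "finite C" "independent C" "\<And>w. w = (\<Sum>b\<in>C. (w \<bullet> b / (b \<bullet> b)) *\<^sub>R b)"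
proof -
  obtain C0 :: "'e set" where C0: "finite C0" "span C0 = UNIV" "pairwise orthogonal C0"
    using basis_orthogonal[OF assms(1)] assms(2) by auto
  define C where "C = C0 - {0}"
  have C: "finite C" "span C = UNIV" "pairwise orthogonal C" "0 \<notin> C"
    using C0 unfolding C_def by (auto simp: span_delete_0 intro: pairwise_subset)
  have ind: "independent C" using C by (intro pairwise_orthogonal_independent)
  have "w = (\<Sum>b\<in>C. (w \<bullet> b / (b \<bullet> b)) *\<^sub>R b)" for w
  proof -
    obtain r where r: "w = (\<Sum>b\<in>C. r b *\<^sub>R b)"
      using C(2) span_finite[OF C(1)] by auto
    have "w \<bullet> b = r b * (b \<bullet> b)" if "b \<in> C" for b
    proof -
      have "w \<bullet> b = (\<Sum>b'\<in>C. r b' * (b' \<bullet> b))" by (simp add: r inner_sum_left)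
      also have "\<dots> = (\<Sum>b'\<in>C. if b' = b then r b * (b \<bullet> b) else 0)"
        using C(3) that by (intro sum.cong) (auto simp: pairwise_def orthogonal_def)
      also have "\<dots> = r b * (b \<bullet> b)" using that C(1) by simp
      finally show ?thesis .
    qed
    then have "w \<bullet> b / (b \<bullet> b) = r b" if "b \<in> C" for b using that C(4) by auto
    then have "(\<Sum>b\<in>C. (w \<bullet> b / (b \<bullet> b)) *\<^sub>R b) = (\<Sum>b\<in>C. r b *\<^sub>R b)"
      by (intro sum.cong) auto
    then show ?thesis using r by simp
  qed
  with C(1) ind show ?thesis by (rule that)
qed

text \<open>Parametrised Riesz representation, by a Gram-Schmidt step: to pass from \<open>B\<close> to
  \<open>insert a B\<close>, subtract from \<open>a\<close> the solution for the right-hand side \<open>g a\<close> on \<open>B\<close>; the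
  difference \<open>n\<close> is \<open>g\<close>-orthogonal to \<open>B\<close> and \<open>g n a = g n n > 0\<close>, so a multiple of
  \<open>n\<close> corrects the solution for \<open>B\<close>. Only field operations are used, hence
  differentiability in the parameter is preserved.\<close>

lemma riesz_representation_differentiable:
  fixes g :: "'x::real_normed_vector \<Rightarrow> 'e::real_vector \<Rightarrow> 'e \<Rightarrow> real"
  assumes bil: "\<And>x. x \<in> S \<Longrightarrow> bilinear (g x)"
    and sym: "\<And>x u v. x \<in> S \<Longrightarrow> g x u v = g x v u"
    and pos: "\<And>x u. x \<in> S \<Longrightarrow> u \<noteq> 0 \<Longrightarrow> 0 < g x u u"
    and diff: "\<And>x u v. x \<in> S \<Longrightarrow> (\<lambda>x. g x u v) differentiable (at x)"
    and B: "finite B" "independent B"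
  shows "(\<And>x b. x \<in> S \<Longrightarrow> K b differentiable (at x)) \<Longrightarrow>
    \<exists>r. (\<forall>x\<in>S. \<forall>b. r b differentiable (at x)) \<and>
        (\<forall>x\<in>S. \<forall>b\<in>B. g x (\<Sum>b\<in>B. r b x *\<^sub>R b) b = K b x)"
  using B
proof (induction B arbitrary: K rule: finite_induct)
  case empty
  show ?case by (rule exI[of _ "\<lambda>_ _. 0"]) auto
next
  case (insert a B)
  have ind: "independent B" using insert.prems(2) independent_insert by (metis insert.hyps(2))
  have ns: "a \<notin> span B" using insert.prems(2) insert.hyps(2) independent_insert by metis
  obtain r where r: "\<And>x b. x \<in> S \<Longrightarrow> r b differentiable (at x)"
    and r_eq: "\<And>x b. x \<in> S \<Longrightarrow> b \<in> B \<Longrightarrow> g x (\<Sum>b\<in>B. r b x *\<^sub>R b) b = K b x"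
    using insert.IH[of K] insert.prems(1) ind by blast
  obtain s where s: "\<And>x b. x \<in> S \<Longrightarrow> s b differentiable (at x)"
    and s_eq: "\<And>x b. x \<in> S \<Longrightarrow> b \<in> B \<Longrightarrow> g x (\<Sum>b\<in>B. s b x *\<^sub>R b) b = g x a b"
    using insert.IH[of "\<lambda>b x. g x a b"] diff ind by blast
  have lin: "linear (\<lambda>u. g x u v)" "linear (g x v)" if "x \<in> S" for x v
    using bil[OF that] unfolding bilinear_def by auto
  define z where "z = (\<lambda>x. \<Sum>b\<in>B. r b x *\<^sub>R b)"
  define y where "y = (\<lambda>x. \<Sum>b\<in>B. s b x *\<^sub>R b)"
  have g_sum: "g x (\<Sum>b\<in>B. q b *\<^sub>R b) v = (\<Sum>b\<in>B. q b * g x b v)" if "x \<in> S" for x q v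
    by (simp add: linear_sum[OF lin(1)[OF that]] linear_cmul[OF lin(1)[OF that]])
  have g_diff: "g x (u - w) v = g x u v - g x w v" if "x \<in> S" for x u w v
    using linear_diff[OF lin(1)[OF that]] .
  define m where "m = (\<lambda>x. g x a a - (\<Sum>b\<in>B. s b x * g x b a))"
  have m_eq: "m x = g x (a - y x) a" if "x \<in> S" for x
    unfolding m_def y_def using that by (simp add: g_diff g_sum)
  have orth: "g x (a - y x) b = 0" if "x \<in> S" "b \<in> B" for x b
    using s_eq[OF that] that unfolding y_def by (simp add: g_diff)
  have m_pos: "0 < m x" if x: "x \<in> S" for x
  proof -
    have "y x \<in> span B" unfolding y_def by (intro span_sum span_scale span_base)
    then have nz: "a - y x \<noteq> 0" using ns by auto
    have "g x (a - y x) (y x) = (\<Sum>b\<in>B. s b x * g x (a - y x) b)"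
      unfolding y_def by (simp add: linear_sum[OF lin(2)[OF x]] linear_cmul[OF lin(2)[OF x]])
    also have "\<dots> = 0" using orth[OF x] by simp
    finally have "g x (a - y x) (a - y x) = m x"
      using linear_diff[OF lin(2)[OF x]] m_eq[OF x] by simp
    then show ?thesis using pos[OF x nz] by simp
  qed
  define c where "c = (\<lambda>x. (K a x - (\<Sum>b\<in>B. r b x * g x b a)) / m x)"
  define q where "q = (\<lambda>b x. if b = a then c x else r b x - c x * s b x)"
  have c_diff: "c differentiable (at x)" if x: "x \<in> S" for x
    unfolding c_def
  proof (intro differentiable_divide differentiable_diff differentiable_sum ballI
        differentiable_mult)
    show "m differentiable (at x)" unfolding m_def
      using x insert.hyps(1)
      by (intro differentiable_diff differentiable_sum differentiable_mult ballI s diff) auto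
  qed (use x insert r diff m_pos in force)+
  have q_diff: "q b differentiable (at x)" if "x \<in> S" for x b
    unfolding q_def using c_diff[OF that] r[OF that] s[OF that]
    by (cases "b = a") (auto intro!: differentiable_diff differentiable_mult)
  have q_sum: "(\<Sum>b\<in>insert a B. q b x *\<^sub>R b) = z x + c x *\<^sub>R (a - y x)" for x
  proof -
    have "(\<Sum>b\<in>B. q b x *\<^sub>R b) = (\<Sum>b\<in>B. (r b x - c x * s b x) *\<^sub>R b)"
      using insert.hyps(2) by (intro sum.cong) (auto simp: q_def)
    also have "\<dots> = z x - c x *\<^sub>R y x"
      unfolding z_def y_def by (simp add: scaleR_left_diff_distrib sum_subtractf scaleR_sum_right)
    finally show ?thesis using insert.hyps by (simp add: q_def algebra_simps)
  qed
  have "g x (\<Sum>b\<in>insert a B. q b x *\<^sub>R b) b = K b x" if x: "x \<in> S" and b: "b \<in> insert a B" for x b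
  proof -
    have e: "g x (\<Sum>b\<in>insert a B. q b x *\<^sub>R b) b = g x (z x) b + c x * g x (a - y x) b"
      unfolding q_sum by (simp add: linear_add[OF lin(1)[OF x]] linear_cmul[OF lin(1)[OF x]])
    show ?thesis
    proof (cases "b \<in> B")
      case True
      then show ?thesis using e orth[OF x True] r_eq[OF x True] unfolding z_def by simp
    next
      case False
      then have "b = a" using b by simp
      have "g x (z x) a = (\<Sum>b\<in>B. r b x * g x b a)" unfolding z_def by (rule g_sum[OF x])
      then show ?thesis using e m_eq[OF x] m_pos[OF x] unfolding \<open>b = a\<close> c_def by (simp add: field_simps)
    qed
  qed
  with q_diff show ?case by (intro exI[of _ q]) blast
qed

section \<open>Tensor calculus in a chart\<close>

locale riemannian_chart =
  fixes c :: "('m::topological_space, 'e::real_inner) rchart"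
  assumes is_chart: "is_chart c"
    and finite_dim: "\<exists>B :: 'e set. finite B \<and> span B = UNIV"
begin

text \<open>\<open>U\<close> is open and inside the chart so that the values of \<open>h\<close> on \<open>U\<close> determine the derivatives there:
  \<^const>\<open>chart_inv\<close> is arbitrary outside the range of the chart.\<close>

definition csmooth :: "'m set \<Rightarrow> ('m \<Rightarrow> real) \<Rightarrow> bool" where
  "csmooth U h \<longleftrightarrow> open U \<and> U \<subseteq> chart_dom c \<and> smooth_on (chart_map c ` U) (h \<circ> chart_inv c)"

definition cdiff :: "('m \<Rightarrow> real) \<Rightarrow> 'm \<Rightarrow> bool" where
  "cdiff h p \<longleftrightarrow> (h \<circ> chart_inv c) differentiable (at (chart_map c p))"

lemma open_dom: "open (chart_dom c)" and open_range: "open (chart_map c ` chart_dom c)"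
  and homeo: "homeomorphism (chart_dom c) (chart_map c ` chart_dom c) (chart_map c) (chart_inv c)"
  using is_chart unfolding is_chart_def by auto

lemma chart_inv_map [simp]: "p \<in> chart_dom c \<Longrightarrow> chart_inv c (chart_map c p) = p"
  using homeo by (rule homeomorphism_apply1)

lemma open_chart_image:
  assumes "open U" "U \<subseteq> chart_dom c"
  shows "open (chart_map c ` U)"
proof -
  have "chart_map c ` U = chart_map c ` chart_dom c \<inter> chart_inv c -` U"
    using assms(2) by (force simp: subset_iff)
  then show ?thesis
    using continuous_open_preimage[OF homeomorphism_cont2[OF homeo] open_range assms(1)] by simp
qed

lemma cderiv_eq: "cderiv c h p = frechet_derivative (h \<circ> chart_inv c) (at (chart_map c p))"
  unfolding cderiv_def by simp

lemma cdiff_has_derivative: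
  "cdiff h p \<Longrightarrow> ((h \<circ> chart_inv c) has_derivative cderiv c h p) (at (chart_map c p))"
  unfolding cdiff_def cderiv_eq frechet_derivative_works .

lemma has_derivative_cderiv:
  assumes "((h \<circ> chart_inv c) has_derivative h') (at (chart_map c p))"
  shows "cdiff h p" "cderiv c h p = h'"
  using assms frechet_derivative_at[OF assms] unfolding cdiff_def cderiv_eq differentiable_def
  by auto

lemma linear_cderiv: "cdiff h p \<Longrightarrow> linear (cderiv c h p)"
  using cdiff_has_derivative has_derivative_linear by blast

lemma cdiff_cong:
  assumes "open U" "U \<subseteq> chart_dom c" "p \<in> U" "\<And>q. q \<in> U \<Longrightarrow> h q = k q" "cdiff h p"
  shows "cdiff k p" "cderiv c k p = cderiv c h p"
proof -
  have "((k \<circ> chart_inv c) has_derivative cderiv c h p) (at (chart_map c p))"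
  proof (rule has_derivative_transform_within_open[OF cdiff_has_derivative[OF assms(5)]
        open_chart_image[OF assms(1,2)]])
    show "(h \<circ> chart_inv c) x = (k \<circ> chart_inv c) x" if "x \<in> chart_map c ` U" for x
      using that assms(2,4) by (auto simp: subset_iff)
  qed (use assms(3) in simp)
  from has_derivative_cderiv[OF this] show "cdiff k p" "cderiv c k p = cderiv c h p" by auto
qed

lemma cdiff_const: "cdiff (\<lambda>q. a) p" "cderiv c (\<lambda>q. a) p = (\<lambda>v. 0)"
  using has_derivative_cderiv[of "\<lambda>q. a", unfolded o_def, OF has_derivative_const] by auto

lemma cdiff_add:
  assumes "cdiff h p" "cdiff k p"
  shows "cdiff (\<lambda>q. h q + k q) p"
    "cderiv c (\<lambda>q. h q + k q) p = (\<lambda>v. cderiv c h p v + cderiv c k p v)"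
  using has_derivative_cderiv[of "\<lambda>q. h q + k q"]
    has_derivative_add[OF assms[THEN cdiff_has_derivative]] by (auto simp: o_def)

lemma cdiff_cmult:
  assumes "cdiff h p"
  shows "cdiff (\<lambda>q. a * h q) p" "cderiv c (\<lambda>q. a * h q) p = (\<lambda>v. a * cderiv c h p v)"
  using has_derivative_cderiv[of "\<lambda>q. a * h q"]
    has_derivative_mult_right[OF assms[THEN cdiff_has_derivative], of a] by (auto simp: o_def)

lemma cdiff_diff:
  assumes "cdiff h p" "cdiff k p"
  shows "cdiff (\<lambda>q. h q - k q) p"
    "cderiv c (\<lambda>q. h q - k q) p = (\<lambda>v. cderiv c h p v - cderiv c k p v)"
  using has_derivative_cderiv[of "\<lambda>q. h q - k q"]
    has_derivative_diff[OF assms[THEN cdiff_has_derivative]] by (auto simp: o_def)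

lemma cdiff_mult:
  assumes "p \<in> chart_dom c" "cdiff h p" "cdiff k p"
  shows "cdiff (\<lambda>q. h q * k q) p"
    "cderiv c (\<lambda>q. h q * k q) p = (\<lambda>v. h p * cderiv c k p v + cderiv c h p v * k p)"
  using has_derivative_cderiv[of "\<lambda>q. h q * k q"] assms(1)
    has_derivative_mult[OF assms(2,3)[THEN cdiff_has_derivative]] by (auto simp: o_def)

lemma cdiff_chain:
  assumes "p \<in> chart_dom c" "cdiff h p" "(k has_real_derivative k') (at (h p))"
  shows "cdiff (\<lambda>q. k (h q)) p" "cderiv c (\<lambda>q. k (h q)) p = (\<lambda>v. k' * cderiv c h p v)"
proof -
  have "(k has_derivative (*) k') (at ((h \<circ> chart_inv c) (chart_map c p)))"
    using assms(1,3) by (simp add: has_field_derivative_def)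
  from has_derivative_compose[OF cdiff_has_derivative[OF assms(2)] this]
  have "(((\<lambda>q. k (h q)) \<circ> chart_inv c) has_derivative (\<lambda>v. k' * cderiv c h p v)) (at (chart_map c p))"
    by (simp add: o_def)
  from has_derivative_cderiv[OF this]
  show "cdiff (\<lambda>q. k (h q)) p" "cderiv c (\<lambda>q. k (h q)) p = (\<lambda>v. k' * cderiv c h p v)" by auto
qed

lemma cdiff_sum:
  assumes "\<And>b. b \<in> B \<Longrightarrow> cdiff (h b) p"
  shows "cdiff (\<lambda>q. \<Sum>b\<in>B. h b q) p"
  using assms
  by (induction B rule: infinite_finite_induct) (auto intro: cdiff_const cdiff_add)

lemma csmooth_open: "csmooth U h \<Longrightarrow> open U" and csmooth_dom: "csmooth U h \<Longrightarrow> U \<subseteq> chart_dom c"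
  unfolding csmooth_def by auto

lemma csmooth_cdiff: "csmooth U h \<Longrightarrow> p \<in> U \<Longrightarrow> cdiff h p"
  unfolding csmooth_def cdiff_def by (auto intro: smooth_on_differentiable)

lemma csmooth_subset: "csmooth U h \<Longrightarrow> open V \<Longrightarrow> V \<subseteq> U \<Longrightarrow> csmooth V h"
  unfolding csmooth_def by (meson image_mono order_trans smooth_on_subset)

lemma csmooth_cderiv:
  assumes "csmooth U h"
  shows "csmooth U (\<lambda>q. cderiv c h q v)"
proof -
  have U: "open U" "U \<subseteq> chart_dom c" "smooth_on (chart_map c ` U) (h \<circ> chart_inv c)"
    using assms unfolding csmooth_def by auto
  have "smooth_on (chart_map c ` U) ((\<lambda>q. cderiv c h q v) \<circ> chart_inv c)"
  proof (rule smooth_on_cong[OF open_chart_image[OF U(1,2)] _ smooth_on_frechet_derivative[OF U(3)]])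
    fix x assume "x \<in> chart_map c ` U"
    then show "frechet_derivative (h \<circ> chart_inv c) (at x) v = ((\<lambda>q. cderiv c h q v) \<circ> chart_inv c) x"
      using U(2) by (auto simp: cderiv_eq subset_iff)
  qed
  then show ?thesis using U unfolding csmooth_def by auto
qed

lemma csmooth_add: "csmooth U h \<Longrightarrow> csmooth U k \<Longrightarrow> csmooth U (\<lambda>q. h q + k q)"
  using open_chart_image[of U] unfolding csmooth_def smooth_on_def o_def by (auto intro: Ck_on_add)

lemma csmooth_cmult: "csmooth U h \<Longrightarrow> csmooth U (\<lambda>q. a * h q)"
  using open_chart_image[of U] unfolding csmooth_def smooth_on_def o_def
  by (auto intro!: Ck_on_mult Ck_on_const)

lemma csmooth_neg_ln:
  assumes h: "csmooth U h" and pos: "\<forall>p\<in>U. 0 < h p"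
  shows "csmooth U (\<lambda>q. - ln (h q))"
proof -
  have U: "open U" "U \<subseteq> chart_dom c" using h unfolding csmooth_def by auto
  have "Ck_on k (chart_map c ` U) (\<lambda>x. (-1) * ln (h (chart_inv c x)))" for k
  proof (intro Ck_on_mult Ck_on_const Ck_on_ln open_chart_image U)
    show "0 < h (chart_inv c x)" if "x \<in> chart_map c ` U" for x
      using that pos U(2) by (auto simp: subset_iff)
    show "Ck_on k (chart_map c ` U) (\<lambda>x. h (chart_inv c x))"
      using h unfolding csmooth_def smooth_on_def o_def by blast
  qed
  then show ?thesis using U unfolding csmooth_def smooth_on_def o_def by simp
qed

lemma csmooth_continuous_on:
  assumes h: "csmooth U h"
  shows "continuous_on U h"
proof -
  have U: "U \<subseteq> chart_dom c" "smooth_on (chart_map c ` U) (h \<circ> chart_inv c)"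
    using h unfolding csmooth_def by auto
  have "continuous_on U ((h \<circ> chart_inv c) \<circ> chart_map c)"
    by (rule continuous_on_compose[OF continuous_on_subset[OF homeomorphism_cont1[OF homeo] U(1)]
          smooth_on_continuous_on[OF U(2)]])
  then show ?thesis by (rule continuous_on_eq) (use U(1) in auto)
qed

lemma cderiv_commute:
  assumes "csmooth U h" "p \<in> U"
  shows "cderiv c (\<lambda>q. cderiv c h q v) p u = cderiv c (\<lambda>q. cderiv c h q u) p v"
proof -
  let ?h = "h \<circ> chart_inv c"
  have U: "open U" "U \<subseteq> chart_dom c" "smooth_on (chart_map c ` U) ?h"
    using assms unfolding csmooth_def by auto
  have "cderiv c (\<lambda>q. cderiv c h q v) p u =
    frechet_derivative (\<lambda>x. frechet_derivative ?h (at x) v) (at (chart_map c p)) u" for u v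
  proof -
    have "frechet_derivative (\<lambda>x. frechet_derivative ?h (at x) v) (at (chart_map c p)) =
      frechet_derivative ((\<lambda>q. cderiv c h q v) \<circ> chart_inv c) (at (chart_map c p))"
    proof (rule frechet_derivative_transform_within_open[OF _ open_chart_image[OF U(1,2)]])
      show "(\<lambda>x. frechet_derivative ?h (at x) v) differentiable at (chart_map c p)"
        using smooth_on_differentiable[OF smooth_on_frechet_derivative[OF U(3)]] assms(2) by blast
      show "frechet_derivative ?h (at x) v = ((\<lambda>q. cderiv c h q v) \<circ> chart_inv c) x"
        if "x \<in> chart_map c ` U" for x
        using that U(2) by (auto simp: cderiv_eq subset_iff)
    qed (use assms(2) in simp)
    then show ?thesis by (simp add: cderiv_eq)
  qed
  then show ?thesis
    using frechet_derivative_mixed_eq[OF open_chart_image[OF U(1,2)] _ U(3), of "chart_map c p"]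
      assms(2) by simp
qed

subsection \<open>The Christoffel map\<close>

abbreviation g :: "'m \<Rightarrow> 'e \<Rightarrow> 'e \<Rightarrow> real" where "g \<equiv> chart_metric c"

lemma g_bilinear: "p \<in> chart_dom c \<Longrightarrow> bilinear (g p)"
  and g_sym: "p \<in> chart_dom c \<Longrightarrow> g p u v = g p v u"
  and g_pos: "p \<in> chart_dom c \<Longrightarrow> u \<noteq> 0 \<Longrightarrow> 0 < g p u u"
  using is_chart unfolding is_chart_def by auto

lemma csmooth_g: "csmooth (chart_dom c) (\<lambda>q. g q u v)"
  using is_chart unfolding csmooth_def is_chart_def by (auto simp: o_def)

lemmas g_linear = g_bilinear[unfolded bilinear_def, THEN conjunct1, rule_format]
  g_bilinear[unfolded bilinear_def, THEN conjunct2, rule_format]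

text \<open>The right-hand side of the Koszul formula, which is linear in \<open>w\<close> and therefore represented by a
  unique vector.\<close>

definition koszul :: "'m \<Rightarrow> 'e \<Rightarrow> 'e \<Rightarrow> 'e \<Rightarrow> real" where
  "koszul p u v w = (cderiv c (\<lambda>q. g q v w) p u + cderiv c (\<lambda>q. g q u w) p v
     - cderiv c (\<lambda>q. g q u v) p w) / 2"

lemma cderiv_g_linear:
  assumes p: "p \<in> chart_dom c"
  shows "linear (\<lambda>w. cderiv c (\<lambda>q. g q v w) p u)" "linear (\<lambda>v. cderiv c (\<lambda>q. g q v w) p u)"
    "linear (\<lambda>u. cderiv c (\<lambda>q. g q v w) p u)"
proof -
  note d = csmooth_cdiff[OF csmooth_g p]
  show *: "linear (\<lambda>w. cderiv c (\<lambda>q. g q v w) p u)" for v u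
  proof (rule linearI)
    fix a b :: 'e and s :: real
    have "cderiv c (\<lambda>q. g q v (a + b)) p = cderiv c (\<lambda>q. g q v a + g q v b) p"
      by (rule cdiff_cong(2)[OF open_dom order_refl p])
        (auto simp: linear_add[OF g_linear(1)] intro: d cdiff_add)
    then show "cderiv c (\<lambda>q. g q v (a + b)) p u
      = cderiv c (\<lambda>q. g q v a) p u + cderiv c (\<lambda>q. g q v b) p u"
      by (simp add: cdiff_add d)
    have "cderiv c (\<lambda>q. g q v (s *\<^sub>R a)) p = cderiv c (\<lambda>q. s * g q v a) p"
      by (rule cdiff_cong(2)[OF open_dom order_refl p])
        (auto simp: linear_cmul[OF g_linear(1)] intro: d cdiff_cmult)
    then show "cderiv c (\<lambda>q. g q v (s *\<^sub>R a)) p u = s *\<^sub>R cderiv c (\<lambda>q. g q v a) p u"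
      by (simp add: cdiff_cmult d)
  qed
  have "cderiv c (\<lambda>q. g q v w) p = cderiv c (\<lambda>q. g q w v) p" for v
    by (rule cdiff_cong(2)[OF open_dom order_refl p g_sym d])
  then have "(\<lambda>v. cderiv c (\<lambda>q. g q v w) p u) = (\<lambda>v. cderiv c (\<lambda>q. g q w v) p u)" by simp
  then show "linear (\<lambda>v. cderiv c (\<lambda>q. g q v w) p u)" by (simp only: *)
  show "linear (\<lambda>u. cderiv c (\<lambda>q. g q v w) p u)" by (rule linear_cderiv[OF d])
qed

lemma koszul_linear:
  assumes "p \<in> chart_dom c"
  shows "linear (koszul p u v)" "linear (\<lambda>v. koszul p u v w)"
proof -
  have e: "koszul p u v w = (1/2) *\<^sub>R (cderiv c (\<lambda>q. g q v w) p u + cderiv c (\<lambda>q. g q u w) p v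
     - cderiv c (\<lambda>q. g q u v) p w)" for u v w unfolding koszul_def by simp
  show "linear (koszul p u v)" "linear (\<lambda>v. koszul p u v w)"
    unfolding e by (intro linear_compose_scale_right linear_compose_add linear_compose_sub
        cderiv_g_linear[OF assms])+
qed

lemma koszul_sym: "p \<in> chart_dom c \<Longrightarrow> koszul p u v w = koszul p v u w"
proof -
  assume p: "p \<in> chart_dom c"
  have "cderiv c (\<lambda>q. g q v u) p = cderiv c (\<lambda>q. g q u v) p"
    by (rule cdiff_cong(2)[OF open_dom order_refl p])
      (auto simp: g_sym intro: csmooth_cdiff[OF csmooth_g p])
  then show ?thesis unfolding koszul_def by simp
qed

text \<open>Solving the Koszul equations in coordinates also shows that the Christoffel map is
  differentiable in the base point, without which third derivatives could not be computed.\<close>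

lemma christoffel_representation:
  obtains B r where "finite B" "\<And>p b. p \<in> chart_dom c \<Longrightarrow> cdiff (r b) p"
    "\<And>p w. p \<in> chart_dom c \<Longrightarrow> g p (\<Sum>b\<in>B. r b p *\<^sub>R b) w = koszul p u v w"
proof -
  let ?S = "chart_map c ` chart_dom c"
  obtain B :: "'e set" where B: "finite B" "independent B"
    and exp: "\<And>w. w = (\<Sum>b\<in>B. (w \<bullet> b / (b \<bullet> b)) *\<^sub>R b)"
    using finite_dim finite_dim_orthogonal_expansion by metis
  have koszul_diff: "cdiff (\<lambda>p. koszul p u v b) p" if p: "p \<in> chart_dom c" for b p
  proof -
    have d: "cdiff (\<lambda>p. cderiv c (\<lambda>q. g q u v) p w) p" for u v w
      by (rule csmooth_cdiff[OF csmooth_cderiv[OF csmooth_g] p])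
    have "cdiff (\<lambda>p. (1/2) * (cderiv c (\<lambda>q. g q v b) p u + cderiv c (\<lambda>q. g q u b) p v
        - cderiv c (\<lambda>q. g q u v) p b)) p"
      by (intro cdiff_cmult cdiff_diff cdiff_add d)
    then show ?thesis unfolding koszul_def by simp
  qed
  have "\<exists>r. (\<forall>x\<in>?S. \<forall>b. r b differentiable (at x)) \<and>
      (\<forall>x\<in>?S. \<forall>b\<in>B. g (chart_inv c x) (\<Sum>b\<in>B. r b x *\<^sub>R b) b = koszul (chart_inv c x) u v b)"
  proof (rule riesz_representation_differentiable[OF _ _ _ _ B])
    fix x b assume "x \<in> ?S"
    then show "(\<lambda>x. koszul (chart_inv c x) u v b) differentiable at x"
      using koszul_diff unfolding cdiff_def o_def by auto
  next
    fix x u v assume "x \<in> ?S"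
    then show "(\<lambda>x. g (chart_inv c x) u v) differentiable at x"
      using csmooth_cdiff[OF csmooth_g] unfolding cdiff_def o_def by auto
  qed (auto simp: g_bilinear g_pos intro: g_sym)
  then obtain r where r: "\<And>x b. x \<in> ?S \<Longrightarrow> r b differentiable (at x)"
    and r_eq: "\<And>x b. x \<in> ?S \<Longrightarrow> b \<in> B \<Longrightarrow>
      g (chart_inv c x) (\<Sum>b\<in>B. r b x *\<^sub>R b) b = koszul (chart_inv c x) u v b" by blast
  show ?thesis
  proof (rule that[of B "\<lambda>b p. r b (chart_map c p)"])
    fix p b assume p: "p \<in> chart_dom c"
    have "(((\<lambda>p. r b (chart_map c p)) \<circ> chart_inv c) has_derivative
        frechet_derivative (r b) (at (chart_map c p))) (at (chart_map c p))"
    proof (rule has_derivative_transform_within_open[OF _ open_range])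
      show "(r b has_derivative frechet_derivative (r b) (at (chart_map c p))) (at (chart_map c p))"
        using r p frechet_derivative_works by blast
    qed (use p in auto)
    then show "cdiff (\<lambda>p. r b (chart_map c p)) p" by (rule has_derivative_cderiv)
  next
    fix p w assume p: "p \<in> chart_dom c"
    let ?z = "\<Sum>b\<in>B. r b (chart_map c p) *\<^sub>R b"
    have "g p ?z w = (\<Sum>b\<in>B. (w \<bullet> b / (b \<bullet> b)) * g p ?z b)"
      by (subst exp[of w]) (simp add: linear_sum[OF g_linear(1)[OF p]] linear_cmul[OF g_linear(1)[OF p]])
    also have "\<dots> = (\<Sum>b\<in>B. (w \<bullet> b / (b \<bullet> b)) * koszul p u v b)"
      using r_eq[of "chart_map c p"] p by simp
    also have "\<dots> = koszul p u v (\<Sum>b\<in>B. (w \<bullet> b / (b \<bullet> b)) *\<^sub>R b)"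
      by (simp add: linear_sum[OF koszul_linear(1)[OF p]] linear_cmul[OF koszul_linear(1)[OF p]])
    finally show "g p ?z w = koszul p u v w" using exp[of w] by simp
  qed (rule B(1))
qed

lemma christoffel_unique:
  assumes p: "p \<in> chart_dom c" and z: "\<And>w. g p z w = koszul p u v w"
  shows "christoffel c p u v = z"
  unfolding christoffel_def koszul_def[symmetric]
proof (rule the_equality)
  fix y assume y: "\<forall>w. g p y w = koszul p u v w"
  have "g p (y - z) (y - z) = 0"
    using y z by (simp add: linear_diff[OF g_linear(2)[OF p]])
  then show "y = z" using g_pos[OF p, of "y - z"] by fastforce
qed (use z in simp)

lemma christoffel_koszul:
  assumes "p \<in> chart_dom c"
  shows "g p (christoffel c p u v) w = koszul p u v w"
  using christoffel_representation[of u v] christoffel_unique[OF assms] assms by metis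

lemma christoffel_sym: "p \<in> chart_dom c \<Longrightarrow> christoffel c p u v = christoffel c p v u"
  by (rule christoffel_unique) (auto simp: christoffel_koszul koszul_sym)

lemma christoffel_linear:
  assumes p: "p \<in> chart_dom c"
  shows "linear (christoffel c p u)" "linear (\<lambda>u. christoffel c p u v)"
proof -
  show *: "linear (christoffel c p u)" for u
    by (intro linearI christoffel_unique[OF p])
      (simp_all add: linear_add[OF g_linear(2)[OF p]] linear_cmul[OF g_linear(2)[OF p]]
        linear_add[OF koszul_linear(2)[OF p]] linear_cmul[OF koszul_linear(2)[OF p]]
        christoffel_koszul[OF p])
  show "linear (\<lambda>u. christoffel c p u v)"
    using *[of v] by (simp add: christoffel_sym[OF p, of _ v])
qed

subsection \<open>Second and third covariant derivatives\<close>

lemma cdiff_hess: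
  assumes h: "csmooth U h" and p: "p \<in> U"
  shows "cdiff (\<lambda>q. hess c h q u v) p"
proof -
  have U: "open U" "U \<subseteq> chart_dom c" using h unfolding csmooth_def by auto
  obtain B r where B: "finite B" and r: "\<And>p b. p \<in> chart_dom c \<Longrightarrow> cdiff (r b) p"
    and eq: "\<And>p w. p \<in> chart_dom c \<Longrightarrow> g p (\<Sum>b\<in>B. r b p *\<^sub>R b) w = koszul p u v w"
    using christoffel_representation[of u v] by metis
  have "cdiff (\<lambda>q. cderiv c (\<lambda>q. cderiv c h q v) q u - (\<Sum>b\<in>B. r b q * cderiv c h q b)) p"
    using p U r csmooth_cdiff[OF csmooth_cderiv[OF h] p]
      csmooth_cdiff[OF csmooth_cderiv[OF csmooth_cderiv[OF h]] p]
    by (intro cdiff_diff cdiff_sum cdiff_mult) auto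
  then show ?thesis
  proof (rule cdiff_cong(1)[OF U p, rotated])
    fix q assume q: "q \<in> U"
    then have "christoffel c q u v = (\<Sum>b\<in>B. r b q *\<^sub>R b)"
      using U by (intro christoffel_unique eq) auto
    then show "cderiv c (\<lambda>q. cderiv c h q v) q u - (\<Sum>b\<in>B. r b q * cderiv c h q b) = hess c h q u v"
      unfolding hess_def using linear_cderiv[OF csmooth_cdiff[OF h q]]
      by (simp add: linear_sum linear_cmul)
  qed
qed

lemma hess_sym: "csmooth U h \<Longrightarrow> p \<in> U \<Longrightarrow> hess c h p u v = hess c h p v u"
  unfolding hess_def using cderiv_commute christoffel_sym csmooth_dom by (metis subsetD)

lemma hess_linear:
  assumes h: "csmooth U h" and p: "p \<in> U"
  shows "linear (hess c h p u)" "linear (\<lambda>u. hess c h p u v)"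
proof -
  have pd: "p \<in> chart_dom c" using csmooth_dom[OF h] p by blast
  show "linear (\<lambda>u. hess c h p u v)" for v
    unfolding hess_def
    using linear_compose[OF christoffel_linear(2)[OF pd] linear_cderiv[OF csmooth_cdiff[OF h p]]]
    by (intro linear_compose_sub linear_cderiv[OF csmooth_cdiff[OF csmooth_cderiv[OF h] p]])
      (simp_all add: o_def)
  from this[of u] show "linear (hess c h p u)" by (simp add: hess_sym[OF h p, of _ u])
qed

text \<open>Only the last two arguments commute. Exchanging the first with one of them costs a curvature term,
  and so the third derivative must not be treated as a symmetric trilinear form.\<close>

lemma nabla3_sym:
  assumes h: "csmooth U h" and p: "p \<in> U"
  shows "nabla3 c h p u v w = nabla3 c h p u w v"
proof -
  have "cderiv c (\<lambda>q. hess c h q w v) p = cderiv c (\<lambda>q. hess c h q v w) p"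
    by (rule cdiff_cong(2)[OF csmooth_open[OF h] csmooth_dom[OF h] p hess_sym[OF h] cdiff_hess[OF h p]])
  then show ?thesis unfolding nabla3_def
    by (simp add: hess_sym[OF h p, of v] hess_sym[OF h p, of w])
qed

lemma nabla3_linear:
  assumes h: "csmooth U h" and p: "p \<in> U"
  shows "linear (nabla3 c h p u v)"
proof -
  have pd: "p \<in> chart_dom c" using csmooth_dom[OF h] p by blast
  have "linear (\<lambda>w. cderiv c (\<lambda>q. hess c h q v w) p u)"
  proof (rule linearI)
    fix a b :: 'e and s :: real
    have "cderiv c (\<lambda>q. hess c h q v (a + b)) p = cderiv c (\<lambda>q. hess c h q v a + hess c h q v b) p"
      by (rule cdiff_cong(2)[OF csmooth_open[OF h] csmooth_dom[OF h] p])
        (auto simp: linear_add[OF hess_linear(1)[OF h]] intro: cdiff_hess[OF h p] cdiff_add)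
    then show "cderiv c (\<lambda>q. hess c h q v (a + b)) p u
      = cderiv c (\<lambda>q. hess c h q v a) p u + cderiv c (\<lambda>q. hess c h q v b) p u"
      by (simp add: cdiff_add cdiff_hess[OF h p])
    have "cderiv c (\<lambda>q. hess c h q v (s *\<^sub>R a)) p = cderiv c (\<lambda>q. s * hess c h q v a) p"
      by (rule cdiff_cong(2)[OF csmooth_open[OF h] csmooth_dom[OF h] p])
        (auto simp: linear_cmul[OF hess_linear(1)[OF h]] intro: cdiff_hess[OF h p] cdiff_cmult)
    then show "cderiv c (\<lambda>q. hess c h q v (s *\<^sub>R a)) p u = s *\<^sub>R cderiv c (\<lambda>q. hess c h q v a) p u"
      by (simp add: cdiff_cmult cdiff_hess[OF h p])
  qed
  moreover have "linear (\<lambda>w. hess c h p v (christoffel c p u w))"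
    using linear_compose[OF christoffel_linear(1)[OF pd] hess_linear(1)[OF h p]] by (simp add: o_def)
  ultimately show ?thesis
    unfolding nabla3_def by (intro linear_compose_sub hess_linear(1)[OF h p])
qed

lemma hess_add:
  assumes h: "csmooth U h" and k: "csmooth U k" and p: "p \<in> U"
  shows "hess c (\<lambda>q. h q + k q) p u v = hess c h p u v + hess c k p u v"
proof -
  have "cderiv c (\<lambda>q. cderiv c (\<lambda>q. h q + k q) q v) p = cderiv c (\<lambda>q. cderiv c h q v + cderiv c k q v) p"
    by (rule cdiff_cong(2)[OF csmooth_open[OF h] csmooth_dom[OF h] p])
      (auto simp: cdiff_add csmooth_cdiff[OF h] csmooth_cdiff[OF k]
        intro!: cdiff_add(1) csmooth_cdiff[OF csmooth_cderiv] h k p)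
  then show ?thesis unfolding hess_def
    by (simp add: cdiff_add csmooth_cdiff[OF csmooth_cderiv[OF h] p]
        csmooth_cdiff[OF csmooth_cderiv[OF k] p] csmooth_cdiff[OF h p] csmooth_cdiff[OF k p])
qed

lemma hess_cmult:
  assumes h: "csmooth U h" and p: "p \<in> U"
  shows "hess c (\<lambda>q. a * h q) p u v = a * hess c h p u v"
proof -
  have "cderiv c (\<lambda>q. cderiv c (\<lambda>q. a * h q) q v) p = cderiv c (\<lambda>q. a * cderiv c h q v) p"
    by (rule cdiff_cong(2)[OF csmooth_open[OF h] csmooth_dom[OF h] p])
      (auto simp: cdiff_cmult csmooth_cdiff[OF h]
        intro!: cdiff_cmult(1) csmooth_cdiff[OF csmooth_cderiv] h p)
  then show ?thesis unfolding hess_def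
    by (simp add: cdiff_cmult csmooth_cdiff[OF csmooth_cderiv[OF h] p] csmooth_cdiff[OF h p]
        algebra_simps)
qed

lemma nabla3_add:
  assumes h: "csmooth U h" and k: "csmooth U k" and p: "p \<in> U"
  shows "nabla3 c (\<lambda>q. h q + k q) p u v w = nabla3 c h p u v w + nabla3 c k p u v w"
proof -
  have "cderiv c (\<lambda>q. hess c (\<lambda>q. h q + k q) q v w) p
      = cderiv c (\<lambda>q. hess c h q v w + hess c k q v w) p"
    by (rule cdiff_cong(2)[OF csmooth_open[OF h] csmooth_dom[OF h] p])
      (auto simp: hess_add[OF h k] intro!: cdiff_add(1) cdiff_hess h k p)
  then show ?thesis unfolding nabla3_def
    by (simp add: hess_add[OF h k p] cdiff_add cdiff_hess[OF h p] cdiff_hess[OF k p])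
qed

lemma nabla3_cmult:
  assumes h: "csmooth U h" and p: "p \<in> U"
  shows "nabla3 c (\<lambda>q. a * h q) p u v w = a * nabla3 c h p u v w"
proof -
  have "cderiv c (\<lambda>q. hess c (\<lambda>q. a * h q) q v w) p = cderiv c (\<lambda>q. a * hess c h q v w) p"
    by (rule cdiff_cong(2)[OF csmooth_open[OF h] csmooth_dom[OF h] p])
      (auto simp: hess_cmult[OF h] intro!: cdiff_cmult(1) cdiff_hess h p)
  then show ?thesis unfolding nabla3_def
    by (simp add: hess_cmult[OF h p] cdiff_cmult cdiff_hess[OF h p] algebra_simps)
qed

subsection \<open>Covariant derivatives of a negative logarithm\<close>

context
  fixes U and \<omega> :: "'m \<Rightarrow> real"
  assumes \<omega>: "csmooth U \<omega>" and pos: "\<forall>p\<in>U. 0 < \<omega> p"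
begin

lemma neg_ln_cderiv:
  assumes p: "p \<in> U"
  shows "cderiv c (\<lambda>q. - ln (\<omega> q)) p v = - (cderiv c \<omega> p v / \<omega> p)" "cdiff (\<lambda>q. - ln (\<omega> q)) p"
proof -
  have pd: "p \<in> chart_dom c" using csmooth_dom[OF \<omega>] p by blast
  have D: "((\<lambda>x. - ln x) has_real_derivative - (1 / \<omega> p)) (at (\<omega> p))"
    using bspec[OF pos p] by (auto intro!: derivative_eq_intros)
  from cdiff_chain[OF pd csmooth_cdiff[OF \<omega> p] D]
  show "cderiv c (\<lambda>q. - ln (\<omega> q)) p v = - (cderiv c \<omega> p v / \<omega> p)" "cdiff (\<lambda>q. - ln (\<omega> q)) p"
    by auto
qed

lemma cdiff_divide_power:
  assumes p: "p \<in> U" and h: "cdiff h p"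
  shows "cdiff (\<lambda>q. h q / \<omega> q ^ n) p"
    "cderiv c (\<lambda>q. h q / \<omega> q ^ n) p u =
      cderiv c h p u / \<omega> p ^ n - real n * h p * cderiv c \<omega> p u / \<omega> p ^ Suc n"
proof -
  have pd: "p \<in> chart_dom c" using csmooth_dom[OF \<omega>] p by blast
  have D: "((\<lambda>x. 1 / x ^ n) has_real_derivative - (real n / \<omega> p ^ Suc n)) (at (\<omega> p))"
  proof (cases n)
    case (Suc m)
    have "- (real n * \<omega> p ^ (n - Suc 0) * inverse ((\<omega> p ^ n) ^ Suc (Suc 0)))
        = - (real n / \<omega> p ^ Suc n)"
      using bspec[OF pos p] unfolding Suc by (simp add: field_simps)
    then show ?thesis
      using DERIV_inverse_fun[OF DERIV_pow[of n "\<omega> p" UNIV]] bspec[OF pos p]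
      by (simp add: inverse_eq_divide del: power_Suc)
  qed auto
  note i = cdiff_chain[OF pd csmooth_cdiff[OF \<omega> p] D]
  show "cdiff (\<lambda>q. h q / \<omega> q ^ n) p"
    "cderiv c (\<lambda>q. h q / \<omega> q ^ n) p u =
      cderiv c h p u / \<omega> p ^ n - real n * h p * cderiv c \<omega> p u / \<omega> p ^ Suc n"
    using cdiff_mult[OF pd h i(1)] by (simp_all add: i(2)[unfolded divide_inverse mult_1_left] divide_inverse algebra_simps)
qed

lemmas cdiff_divide = cdiff_divide_power[where n = 1, simplified]

lemma neg_ln_hess:
  assumes p: "p \<in> U"
  shows "hess c (\<lambda>q. - ln (\<omega> q)) p u v =
    cderiv c \<omega> p u * cderiv c \<omega> p v / (\<omega> p)\<^sup>2 - hess c \<omega> p u v / \<omega> p"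
proof -
  have pd: "p \<in> chart_dom c" using csmooth_dom[OF \<omega>] p by blast
  note d = cdiff_divide[OF p csmooth_cdiff[OF csmooth_cderiv[OF \<omega>] p]]
  have "cderiv c (\<lambda>q. cderiv c (\<lambda>q. - ln (\<omega> q)) q v) p
      = cderiv c (\<lambda>q. (-1) * (cderiv c \<omega> q v / \<omega> q)) p"
    by (rule cdiff_cong(2)[OF csmooth_open[OF \<omega>] csmooth_dom[OF \<omega>] p _ cdiff_cmult(1)[OF d(1)]])
      (simp add: neg_ln_cderiv)
  then have "cderiv c (\<lambda>q. cderiv c (\<lambda>q. - ln (\<omega> q)) q v) p u =
      cderiv c \<omega> p u * cderiv c \<omega> p v / (\<omega> p)\<^sup>2 - cderiv c (\<lambda>q. cderiv c \<omega> q v) p u / \<omega> p"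
    by (simp only: cdiff_cmult(2)[OF d(1)]) (simp add: d(2) power2_eq_square mult.commute)
  then show ?thesis
    unfolding hess_def using bspec[OF pos p] by (simp add: neg_ln_cderiv[OF p] diff_divide_distrib)
qed

text \<open>Differentiating \<open>d\<omega>(v)\<close> along \<open>u\<close> yields \<open>(\<nabla>\<^sup>2\<omega>)(u,v) + d\<omega>(\<nabla>\<^sub>u v)\<close>, and the second summand
  cancels against the Christoffel terms in the definition of \<open>\<nabla>\<^sup>3\<close>.\<close>

lemma neg_ln_nabla3:
  assumes p: "p \<in> U"
  shows "nabla3 c (\<lambda>q. - ln (\<omega> q)) p u v w =
    - (nabla3 c \<omega> p u v w / \<omega> p)
    + (cderiv c \<omega> p u * hess c \<omega> p v w + cderiv c \<omega> p v * hess c \<omega> p u w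
       + cderiv c \<omega> p w * hess c \<omega> p u v) / (\<omega> p)\<^sup>2
    - 2 * cderiv c \<omega> p u * cderiv c \<omega> p v * cderiv c \<omega> p w / (\<omega> p) ^ 3"
proof -
  have pd: "p \<in> chart_dom c" using csmooth_dom[OF \<omega>] p by blast
  have o: "0 < \<omega> p" by (rule bspec[OF pos p])
  note d\<omega> = csmooth_cdiff[OF csmooth_cderiv[OF \<omega>] p]
  note d1 = cdiff_mult[OF pd d\<omega> d\<omega>, of v w]
  note d2 = cdiff_divide_power[OF p d1(1), of 2]
  note d3 = cdiff_divide[OF p cdiff_hess[OF \<omega> p, of v w]]
  have "cderiv c (\<lambda>q. hess c (\<lambda>q. - ln (\<omega> q)) q v w) p
      = cderiv c (\<lambda>q. cderiv c \<omega> q v * cderiv c \<omega> q w / (\<omega> q)\<^sup>2 - hess c \<omega> q v w / \<omega> q) p"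
    by (rule cdiff_cong(2)[OF csmooth_open[OF \<omega>] csmooth_dom[OF \<omega>] p _ cdiff_diff(1)[OF d2(1) d3(1)]])
      (simp add: neg_ln_hess)
  then have "cderiv c (\<lambda>q. hess c (\<lambda>q. - ln (\<omega> q)) q v w) p u =
     (cderiv c (\<lambda>q. cderiv c \<omega> q v) p u * cderiv c \<omega> p w
      + cderiv c (\<lambda>q. cderiv c \<omega> q w) p u * cderiv c \<omega> p v) / (\<omega> p)\<^sup>2
     - 2 * cderiv c \<omega> p u * cderiv c \<omega> p v * cderiv c \<omega> p w / (\<omega> p) ^ 3
     - cderiv c (\<lambda>q. hess c \<omega> q v w) p u / \<omega> p + hess c \<omega> p v w * cderiv c \<omega> p u / (\<omega> p)\<^sup>2"
    by (simp only: cdiff_diff(2)[OF d2(1) d3(1)] d1(2) d2(2) d3(2))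
      (simp add: power2_eq_square power3_eq_cube algebra_simps)
  moreover have "cderiv c (\<lambda>q. cderiv c \<omega> q b) p a = hess c \<omega> p a b + cderiv c \<omega> p (christoffel c p a b)"
    for a b unfolding hess_def by simp
  moreover have "hess c \<omega> p v (christoffel c p u w) = hess c \<omega> p (christoffel c p u w) v"
    by (rule hess_sym[OF \<omega> p])
  ultimately show ?thesis
    unfolding nabla3_def neg_ln_hess[OF p] using o
    by (simp add: add_divide_distrib diff_divide_distrib algebra_simps)
qed

end

end

section \<open>The product with the real line\<close>

definition line_chart :: "(real, real) rchart" where
  "line_chart = \<lparr>chart_dom = UNIV, chart_map = id, chart_metric = (\<lambda>_ u v. u * v)\<rparr>"

abbreviation cyl :: "('m, 'e) rchart \<Rightarrow> ('m \<times> real, 'e \<times> real) rchart" where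
  "cyl c \<equiv> prod_rchart c line_chart"

lemma prod_real_line: "prod_manifold A real_line = cyl ` A"
  unfolding prod_manifold_def real_line_def line_chart_def by auto

lemma cyl_dom: "chart_dom (cyl c) = chart_dom c \<times> UNIV"
  and cyl_map: "chart_map (cyl c) p = (chart_map c (fst p), snd p)"
  and cyl_metric: "chart_metric (cyl c) p u v
    = chart_metric c (fst p) (fst u) (fst v) + snd u * snd v"
  unfolding prod_rchart_def line_chart_def by (auto simp: map_prod_def case_prod_beta)

lemma cyl_map_image: "chart_map (cyl c) ` (U \<times> T) = (chart_map c ` U) \<times> T"
  by (force simp: cyl_map image_iff)

context riemannian_chart
begin

lemma chart_map_inj: "inj_on (chart_map c) (chart_dom c)"
  by (rule inj_on_inverseI) (rule chart_inv_map)

text \<open>Only on the range of the chart: elsewhere neither inverse is specified.\<close>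

lemma cyl_inv:
  assumes "x \<in> chart_map c ` chart_dom c"
  shows "chart_inv (cyl c) (x, t) = (chart_inv c x, t)"
proof -
  obtain p where p: "p \<in> chart_dom c" "x = chart_map c p" using assms by blast
  have inj: "inj_on (chart_map (cyl c)) (chart_dom (cyl c))"
    using chart_map_inj by (auto simp: inj_on_def cyl_map cyl_dom)
  have "chart_inv (cyl c) (chart_map (cyl c) (p, t)) = (p, t)"
    unfolding chart_inv_def by (rule inv_into_f_f[OF inj]) (use p in \<open>simp add: cyl_dom\<close>)
  then show ?thesis using p by (simp add: cyl_map)
qed

lemma cyl_smooth_fst:
  assumes "smooth_on S h" "open S" "open T" "fst ` T \<subseteq> S"
  shows "smooth_on T (\<lambda>z. h (fst z))"
  using assms Ck_on_comp_linear[OF bounded_linear_fst] unfolding smooth_on_def by blast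

lemma cyl_is_chart: "is_chart (cyl c)"
  unfolding is_chart_def
proof (intro conjI ballI allI impI)
  let ?S = "chart_map c ` chart_dom c"
  show "open (chart_dom (cyl c))" using open_dom by (simp add: cyl_dom open_Times)
  have im: "chart_map (cyl c) ` chart_dom (cyl c) = ?S \<times> UNIV"
    unfolding cyl_dom cyl_map_image ..
  show o: "open (chart_map (cyl c) ` chart_dom (cyl c))"
    unfolding im using open_range by (simp add: open_Times)
  show "homeomorphism (chart_dom (cyl c)) (chart_map (cyl c) ` chart_dom (cyl c))
     (chart_map (cyl c)) (chart_inv (cyl c))"
  proof (rule homeomorphismI)
    have "continuous_on (chart_dom c \<times> (UNIV :: real set)) (\<lambda>p. (chart_map c (fst p), snd p))"
      by (intro continuous_intros continuous_on_compose2[OF homeomorphism_cont1[OF homeo]]) auto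
    then show "continuous_on (chart_dom (cyl c)) (chart_map (cyl c))"
      unfolding cyl_dom by (rule continuous_on_cong[THEN iffD1, rotated -1]) (auto simp: cyl_map)
    have "continuous_on (?S \<times> (UNIV :: real set)) (\<lambda>x. (chart_inv c (fst x), snd x))"
      by (intro continuous_intros continuous_on_compose2[OF homeomorphism_cont2[OF homeo]]) auto
    then show "continuous_on (chart_map (cyl c) ` chart_dom (cyl c)) (chart_inv (cyl c))"
      unfolding im by (rule continuous_on_cong[THEN iffD1, rotated -1]) (auto simp: cyl_inv)
    show "chart_inv (cyl c) ` chart_map (cyl c) ` chart_dom (cyl c) \<subseteq> chart_dom (cyl c)"
      unfolding im by (auto simp: cyl_inv cyl_dom)
  qed (auto simp: cyl_dom cyl_map cyl_inv)
  show "bilinear (chart_metric (cyl c) p)" if "p \<in> chart_dom (cyl c)" for p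
  proof -
    have p: "fst p \<in> chart_dom c" using that by (auto simp: cyl_dom)
    show ?thesis unfolding bilinear_def
      by (auto intro!: linearI simp: cyl_metric linear_add[OF g_linear(1)[OF p]]
          linear_add[OF g_linear(2)[OF p]] linear_cmul[OF g_linear(1)[OF p]]
          linear_cmul[OF g_linear(2)[OF p]] algebra_simps)
  qed
  show "chart_metric (cyl c) p u v = chart_metric (cyl c) p v u" if "p \<in> chart_dom (cyl c)" for p u v
    using that g_sym[of "fst p"] by (auto simp: cyl_dom cyl_metric)
  show "0 < chart_metric (cyl c) p u u" if p: "p \<in> chart_dom (cyl c)" and u: "u \<noteq> 0" for p u
  proof (cases "fst u = 0")
    case True
    then have "snd u \<noteq> 0" using u by (simp add: prod_eq_iff)
    moreover have "g (fst p) 0 0 = 0"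
      using linear_0[OF g_linear(1)] p by (auto simp: cyl_dom)
    ultimately show ?thesis using True by (auto simp: cyl_metric zero_less_mult_iff)
  next
    case False
    have "0 < g (fst p) (fst u) (fst u)" using g_pos p False by (auto simp: cyl_dom)
    then show ?thesis by (simp add: cyl_metric add_pos_nonneg)
  qed
  show "smooth_on (chart_map (cyl c) ` chart_dom (cyl c))
     (\<lambda>x. chart_metric (cyl c) (chart_inv (cyl c) x) u v)" for u v
  proof (rule smooth_on_cong[OF o])
    have "smooth_on ?S (\<lambda>x. g (chart_inv c x) (fst u) (fst v))"
      using csmooth_g unfolding csmooth_def by (simp add: o_def)
    then have "smooth_on (?S \<times> (UNIV :: real set)) (\<lambda>z. g (chart_inv c (fst z)) (fst u) (fst v))"
      by (rule cyl_smooth_fst) (use open_range in \<open>auto simp: open_Times\<close>)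
    then show "smooth_on (chart_map (cyl c) ` chart_dom (cyl c))
        (\<lambda>z. g (chart_inv c (fst z)) (fst u) (fst v) + snd u * snd v)"
      using o unfolding smooth_on_def im by (auto intro: Ck_on_add Ck_on_const)
    show "g (chart_inv c (fst z)) (fst u) (fst v) + snd u * snd v =
        chart_metric (cyl c) (chart_inv (cyl c) z) u v"
      if "z \<in> chart_map (cyl c) ` chart_dom (cyl c)" for z
      using that unfolding im by (auto simp: cyl_metric cyl_inv)
  qed
qed

lemma cyl_chart: "riemannian_chart (cyl c)"
proof
  show "is_chart (cyl c)" by (rule cyl_is_chart)
  obtain B :: "'e set" where B: "finite B" "span B = UNIV" using finite_dim by blast
  have "(UNIV :: ('e \<times> real) set) = span (insert (0, 1) ((\<lambda>b. (b, 0)) ` B))"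
  proof (rule UNIV_eq_I)
    fix z :: "'e \<times> real"
    have lin: "linear (\<lambda>b::'e. (b, 0::real))" by (auto intro!: linearI)
    have "(fst z, 0) \<in> (\<lambda>b. (b, 0::real)) ` span B" using B by blast
    then have "(fst z, 0) \<in> span ((\<lambda>b. (b, 0::real)) ` B)"
      using linear_span_image[OF lin, of B] by simp
    then have 1: "(fst z, 0::real) \<in> span (insert (0, 1) ((\<lambda>b. (b, 0)) ` B))"
      by (rule subsetD[OF span_mono[OF subset_insertI]])
    have 2: "snd z *\<^sub>R (0, 1) \<in> span (insert (0::'e, 1::real) ((\<lambda>b. (b, 0)) ` B))"
      by (intro span_scale span_base) simp
    have "z = (fst z, 0) + snd z *\<^sub>R (0, 1)" by (simp add: prod_eq_iff)
    then show "z \<in> span (insert (0, 1) ((\<lambda>b. (b, 0)) ` B))" using span_add[OF 1 2] by simp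
  qed
  then show "\<exists>B :: ('e \<times> real) set. finite B \<and> span B = UNIV"
    using B(1) by (intro exI[of _ "insert (0, 1) ((\<lambda>b. (b, 0)) ` B)"]) auto
qed

interpretation cyl: riemannian_chart "cyl c"
  by (rule cyl_chart)

lemma cyl_cdiff_fst:
  assumes p: "fst p \<in> chart_dom c" and h: "cdiff h (fst p)"
  shows "cyl.cdiff (\<lambda>q. h (fst q)) p"
    "cderiv (cyl c) (\<lambda>q. h (fst q)) p = (\<lambda>v. cderiv c h (fst p) (fst v))"
proof -
  have "(((\<lambda>q. h (fst q)) \<circ> chart_inv (cyl c)) has_derivative (\<lambda>v. cderiv c h (fst p) (fst v)))
      (at (chart_map (cyl c) p))"
  proof (rule has_derivative_transform_within_open)
    show "((\<lambda>z. (h \<circ> chart_inv c) (fst z)) has_derivative (\<lambda>v. cderiv c h (fst p) (fst v)))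
      (at (chart_map (cyl c) p))"
      by (rule has_derivative_compose[OF has_derivative_fst[OF has_derivative_ident]])
        (use cdiff_has_derivative[OF h] in \<open>simp add: cyl_map o_def\<close>)
    show "open (chart_map c ` chart_dom c \<times> (UNIV :: real set))"
      using open_range by (simp add: open_Times)
  qed (use p in \<open>auto simp: cyl_map cyl_inv\<close>)
  from cyl.has_derivative_cderiv[OF this]
  show "cyl.cdiff (\<lambda>q. h (fst q)) p"
    "cderiv (cyl c) (\<lambda>q. h (fst q)) p = (\<lambda>v. cderiv c h (fst p) (fst v))" by auto
qed

text \<open>The metric of the line factor is constant, so it drops out of the Koszul formula.\<close>

lemma cyl_christoffel:
  assumes "fst p \<in> chart_dom c"
  shows "christoffel (cyl c) p u v = (christoffel c (fst p) (fst u) (fst v), 0)"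
proof (rule cyl.christoffel_unique)
  show p: "p \<in> chart_dom (cyl c)" using assms by (cases p) (simp add: cyl_dom)
  have e: "cderiv (cyl c) (\<lambda>q. chart_metric (cyl c) q a b) p w
      = cderiv c (\<lambda>q. g q (fst a) (fst b)) (fst p) (fst w)" for a b w
    using cyl_cdiff_fst[OF assms csmooth_cdiff[OF csmooth_g assms], of "fst a" "fst b"]
      cyl.cdiff_const[of "snd a * snd b" p]
    by (simp add: cyl_metric cyl.cdiff_add)
  show "chart_metric (cyl c) p (christoffel c (fst p) (fst u) (fst v), 0) w = cyl.koszul p u v w"
    for w
    unfolding cyl.koszul_def e
    using assms by (simp add: cyl_metric christoffel_koszul koszul_def)
qed

lemma cyl_csmooth_fst:
  assumes h: "csmooth U h"
  shows "cyl.csmooth (U \<times> UNIV) (\<lambda>q. h (fst q))"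
proof -
  have U: "open U" "U \<subseteq> chart_dom c" "smooth_on (chart_map c ` U) (h \<circ> chart_inv c)"
    using h unfolding csmooth_def by auto
  let ?T = "chart_map c ` U \<times> (UNIV :: real set)"
  have oT: "open ?T" using open_chart_image[OF U(1,2)] by (simp add: open_Times)
  have "smooth_on ?T (\<lambda>z. (h \<circ> chart_inv c) (fst z))"
    by (rule cyl_smooth_fst[OF U(3) open_chart_image[OF U(1,2)] oT]) auto
  then have "smooth_on ?T ((\<lambda>q. h (fst q)) \<circ> chart_inv (cyl c))"
    by (rule smooth_on_cong[OF oT, rotated]) (use U(2) in \<open>auto simp: cyl_inv\<close>)
  then show ?thesis
    unfolding cyl.csmooth_def cyl_map_image cyl_dom using U(1,2) by (auto simp: open_Times)
qed

lemma cyl_csmooth_snd: "cyl.csmooth (chart_dom (cyl c)) snd"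
proof -
  have o: "open (chart_map (cyl c) ` chart_dom (cyl c))" by (rule cyl.open_range)
  have "smooth_on (chart_map (cyl c) ` chart_dom (cyl c)) (snd :: 'e \<times> real \<Rightarrow> real)"
    unfolding smooth_on_def using Ck_on_linear[OF o bounded_linear_snd] by blast
  then have "smooth_on (chart_map (cyl c) ` chart_dom (cyl c)) (snd \<circ> chart_inv (cyl c))"
    by (rule smooth_on_cong[OF o, rotated]) (auto simp: cyl_map cyl_dom cyl_inv)
  then show ?thesis unfolding cyl.csmooth_def using cyl.open_dom by auto
qed

lemma cyl_hess_fst:
  assumes h: "csmooth U h" and p: "fst p \<in> U"
  shows "hess (cyl c) (\<lambda>q. h (fst q)) p u v = hess c h (fst p) (fst u) (fst v)"
proof -
  have U: "open U" "U \<subseteq> chart_dom c" using h unfolding csmooth_def by auto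
  have pd: "fst p \<in> chart_dom c" using p U by blast
  note d = cyl_cdiff_fst[OF pd csmooth_cdiff[OF csmooth_cderiv[OF h] p], of "fst v"]
  have "cderiv (cyl c) (\<lambda>q. cderiv (cyl c) (\<lambda>q. h (fst q)) q v) p
      = cderiv (cyl c) (\<lambda>q. cderiv c h (fst q) (fst v)) p"
  proof (rule cyl.cdiff_cong(2)[OF _ _ _ _ d(1)])
    show "open (U \<times> (UNIV :: real set))" "U \<times> UNIV \<subseteq> chart_dom (cyl c)" "p \<in> U \<times> UNIV"
      using U p by (auto simp: open_Times cyl_dom mem_Times_iff)
    show "cderiv c h (fst q) (fst v) = cderiv (cyl c) (\<lambda>q. h (fst q)) q v" if "q \<in> U \<times> UNIV" for q
      using that U csmooth_cdiff[OF h] by (auto simp: cyl_cdiff_fst subset_iff)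
  qed
  then show ?thesis
    unfolding hess_def d(2) by (simp add: cyl_christoffel[OF pd] cyl_cdiff_fst[OF pd csmooth_cdiff[OF h p]] d(2))
qed

lemma cyl_nabla3_fst:
  assumes h: "csmooth U h" and p: "fst p \<in> U"
  shows "nabla3 (cyl c) (\<lambda>q. h (fst q)) p u v w = nabla3 c h (fst p) (fst u) (fst v) (fst w)"
proof -
  have U: "open U" "U \<subseteq> chart_dom c" using h unfolding csmooth_def by auto
  have pd: "fst p \<in> chart_dom c" using p U by blast
  note d = cyl_cdiff_fst[OF pd cdiff_hess[OF h p], of "fst v" "fst w"]
  have "cderiv (cyl c) (\<lambda>q. hess (cyl c) (\<lambda>q. h (fst q)) q v w) p
      = cderiv (cyl c) (\<lambda>q. hess c h (fst q) (fst v) (fst w)) p"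
  proof (rule cyl.cdiff_cong(2)[OF _ _ _ _ d(1)])
    show "open (U \<times> (UNIV :: real set))" "U \<times> UNIV \<subseteq> chart_dom (cyl c)" "p \<in> U \<times> UNIV"
      using U p by (auto simp: open_Times cyl_dom mem_Times_iff)
    show "hess c h (fst q) (fst v) (fst w) = hess (cyl c) (\<lambda>q. h (fst q)) q v w"
      if "q \<in> U \<times> UNIV" for q
      using that by (auto simp: cyl_hess_fst[OF h])
  qed
  then show ?thesis
    unfolding nabla3_def by (simp add: cyl_christoffel[OF pd] cyl_hess_fst[OF h p] d(2))
qed

lemma cyl_snd:
  assumes p: "fst p \<in> chart_dom c"
  shows "cderiv (cyl c) snd p v = snd v" "hess (cyl c) snd p u v = 0" "nabla3 (cyl c) snd p u v w = 0"
proof -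
  have 1: "cderiv (cyl c) snd p = snd" if p: "p \<in> chart_dom (cyl c)" for p
  proof (rule cyl.has_derivative_cderiv(2))
    show "(snd \<circ> chart_inv (cyl c) has_derivative snd) (at (chart_map (cyl c) p))"
    proof (rule has_derivative_transform_within_open)
      show "(snd has_derivative snd) (at (chart_map (cyl c) p))"
        by (rule bounded_linear_imp_has_derivative[OF bounded_linear_snd])
      show "open (chart_map (cyl c) ` chart_dom (cyl c))" by (rule cyl.open_range)
    qed (use p in \<open>auto simp: cyl_dom cyl_map cyl_inv\<close>)
  qed
  have 2: "hess (cyl c) snd p u v = 0" if p: "p \<in> chart_dom (cyl c)" for p u v
  proof -
    have "cderiv (cyl c) (\<lambda>q. cderiv (cyl c) snd q v) p = cderiv (cyl c) (\<lambda>q. snd v) p"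
      by (rule cyl.cdiff_cong(2)[OF cyl.open_dom order_refl p _ cyl.cdiff_const(1)]) (simp add: 1)
    then show ?thesis
      using p by (auto simp: hess_def cyl.cdiff_const 1 cyl_dom cyl_christoffel)
  qed
  have p': "p \<in> chart_dom (cyl c)" using p by (cases p) (simp add: cyl_dom)
  have "cderiv (cyl c) (\<lambda>q. hess (cyl c) snd q v w) p = cderiv (cyl c) (\<lambda>q. 0) p"
    by (rule cyl.cdiff_cong(2)[OF cyl.open_dom order_refl p' _ cyl.cdiff_const(1)]) (simp add: 2)
  then show "cderiv (cyl c) snd p v = snd v" "hess (cyl c) snd p u v = 0"
    "nabla3 (cyl c) snd p u v w = 0"
    using p' by (simp_all add: 1 2 nabla3_def cyl.cdiff_const)
qed

end

section \<open>Geodesics and convexity\<close>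

lemma riemannian_manifold_chart:
  "riemannian_manifold A \<Longrightarrow> c \<in> A \<Longrightarrow> riemannian_chart c"
  unfolding riemannian_manifold_def by unfold_locales auto

lemma riemannian_manifold_cover:
  assumes "riemannian_manifold A"
  obtains c where "c \<in> A" "p \<in> chart_dom c"
  using assms unfolding riemannian_manifold_def by blast

lemma smooth_fun_csmooth:
  assumes "riemannian_manifold A" "c \<in> A" "open D" "smooth_fun A D h"
  shows "riemannian_chart.csmooth c (chart_dom c \<inter> D) h"
proof -
  interpret riemannian_chart c by (rule riemannian_manifold_chart[OF assms(1,2)])
  show ?thesis
    unfolding csmooth_def using open_dom assms unfolding smooth_fun_def by auto
qed

lemma smooth_fun_continuous_on:
  assumes "riemannian_manifold A" "open D" "smooth_fun A D h"
  shows "continuous_on D h"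
  unfolding continuous_on_eq_continuous_at[OF assms(2)]
proof
  fix p assume p: "p \<in> D"
  obtain c where c: "c \<in> A" "p \<in> chart_dom c" using riemannian_manifold_cover[OF assms(1)] .
  interpret riemannian_chart c by (rule riemannian_manifold_chart[OF assms(1) c(1)])
  let ?U = "chart_dom c \<inter> D"
  have U: "open ?U" using open_dom assms(2) by blast
  have "continuous_on (chart_map c ` ?U) (h \<circ> chart_inv c)"
    using assms(3) c(1) unfolding smooth_fun_def by (blast intro: smooth_on_continuous_on)
  then have "continuous_on ?U ((h \<circ> chart_inv c) \<circ> chart_map c)"
    by (rule continuous_on_compose[OF continuous_on_subset[OF homeomorphism_cont1[OF homeo]], rotated]) blast
  then have "continuous_on ?U h" by (rule continuous_on_eq) auto
  then show "isCont h p" using U p c(2) continuous_on_eq_continuous_at by blast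
qed

text \<open>The speed is multiplied by \<open>b\<close> and the acceleration by \<open>b\<^sup>2\<close>, in agreement with the
  bilinearity of the Christoffel map.\<close>

lemma geodesic_on_affine:
  assumes A: "riemannian_manifold A" and \<gamma>: "geodesic_on A UNIV \<gamma>"
  shows "geodesic_on A I (\<lambda>s. \<gamma> (a + b * s))"
  unfolding geodesic_on_def
proof (intro conjI ballI)
  show "continuous_on I (\<lambda>s. \<gamma> (a + b * s))"
  proof (rule continuous_on_compose2[where g = \<gamma>, OF _ _ subset_UNIV])
    show "continuous_on UNIV \<gamma>" using \<gamma> unfolding geodesic_on_def by blast
    show "continuous_on I (\<lambda>s. a + b * s)" by (intro continuous_intros)
  qed
  fix c assume c: "c \<in> A"
  interpret riemannian_chart c by (rule riemannian_manifold_chart[OF A c])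
  obtain x' where x': "\<And>t. \<gamma> t \<in> chart_dom c \<Longrightarrow> ((chart_map c \<circ> \<gamma>) has_vector_derivative x' t) (at t)"
    "\<And>t. \<gamma> t \<in> chart_dom c \<Longrightarrow>
        (x' has_vector_derivative - christoffel c (\<gamma> t) (x' t) (x' t)) (at t)"
    using \<gamma> c unfolding geodesic_on_def by blast
  have D: "((\<lambda>s. a + b * s) has_vector_derivative b) (at t)" for t
    by (auto intro!: derivative_eq_intros simp: has_vector_derivative_def)
  show "\<exists>y'. \<forall>t\<in>I. \<gamma> (a + b * t) \<in> chart_dom c \<longrightarrow>
      ((chart_map c \<circ> (\<lambda>s. \<gamma> (a + b * s))) has_vector_derivative y' t) (at t within I) \<and>
      (y' has_vector_derivative - christoffel c (\<gamma> (a + b * t)) (y' t) (y' t)) (at t within I)"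
  proof (intro exI[of _ "\<lambda>s. b *\<^sub>R x' (a + b * s)"] ballI impI conjI)
    fix t assume t: "\<gamma> (a + b * t) \<in> chart_dom c"
    show "((chart_map c \<circ> (\<lambda>s. \<gamma> (a + b * s))) has_vector_derivative b *\<^sub>R x' (a + b * t)) (at t within I)"
      using vector_diff_chain_at[OF D x'(1)[OF t]]
      unfolding o_def by (rule has_vector_derivative_at_within)
    have "((\<lambda>s. b *\<^sub>R x' (a + b * s)) has_vector_derivative
        b *\<^sub>R b *\<^sub>R - christoffel c (\<gamma> (a + b * t)) (x' (a + b * t)) (x' (a + b * t))) (at t)"
      using vector_diff_chain_at[OF D x'(2)[OF t]]
      by (intro bounded_linear.has_vector_derivative[OF bounded_linear_scaleR_right])
        (simp add: o_def)
    moreover have "b *\<^sub>R b *\<^sub>R - christoffel c (\<gamma> (a + b * t)) (x' (a + b * t)) (x' (a + b * t))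
        = - christoffel c (\<gamma> (a + b * t)) (b *\<^sub>R x' (a + b * t)) (b *\<^sub>R x' (a + b * t))"
      by (simp add: linear_cmul[OF christoffel_linear(1)[OF t]] linear_cmul[OF christoffel_linear(2)[OF t]])
    ultimately have "((\<lambda>s. b *\<^sub>R x' (a + b * s)) has_vector_derivative
        - christoffel c (\<gamma> (a + b * t)) (b *\<^sub>R x' (a + b * t)) (b *\<^sub>R x' (a + b * t))) (at t)"
      by simp
    then show "((\<lambda>s. b *\<^sub>R x' (a + b * s)) has_vector_derivative
        - christoffel c (\<gamma> (a + b * t)) (b *\<^sub>R x' (a + b * t)) (b *\<^sub>R x' (a + b * t))) (at t within I)"
      by (rule has_vector_derivative_at_within)
  qed
qed

text \<open>If \<open>L < 0\<close> then \<open>k' t < k' (- t)\<close> for small \<open>t > 0\<close>, hence \<open>k t + k (- t)\<close> decreases at first.\<close>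

lemma second_derivative_nonneg:
  fixes k :: "real \<Rightarrow> real"
  assumes "0 < \<delta>" and k: "\<And>t. \<bar>t\<bar> < \<delta> \<Longrightarrow> DERIV k t :> k' t" and k': "DERIV k' 0 :> L"
    and mid: "\<And>t. 0 < t \<Longrightarrow> t < \<delta> \<Longrightarrow> 2 * k 0 \<le> k t + k (- t)"
  shows "0 \<le> L"
proof (rule ccontr)
  assume "\<not> 0 \<le> L"
  then obtain d1 d2 where d1: "0 < d1" "\<And>h. 0 < h \<Longrightarrow> h < d1 \<Longrightarrow> k' h < k' 0"
    and d2: "0 < d2" "\<And>h. 0 < h \<Longrightarrow> h < d2 \<Longrightarrow> k' 0 < k' (- h)"
    using DERIV_neg_dec_right[OF k'] DERIV_neg_dec_left[OF k'] by (auto simp: not_le)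
  define t where "t = min \<delta> (min d1 d2) / 2"
  have t: "0 < t" "t < \<delta>" "t < d1" "t < d2" using assms(1) d1(1) d2(1) unfolding t_def by auto
  have "\<exists>z>0. z < t \<and> (k t + k (- t)) - (k 0 + k (- 0)) = (t - 0) * (k' z - k' (- z))"
  proof (rule MVT2[OF t(1)])
    fix s assume s: "0 \<le> s" "s \<le> t"
    have "DERIV k s :> k' s" "DERIV k (- s) :> k' (- s)" using k s t by auto
    then show "DERIV (\<lambda>t. k t + k (- t)) s :> k' s - k' (- s)"
      by (auto intro!: derivative_eq_intros DERIV_chain2[of k])
  qed
  then obtain z where z: "0 < z" "z < t" "k t + k (- t) - 2 * k 0 = t * (k' z - k' (- z))" by auto
  have "k' z < k' (- z)" using d1(2)[of z] d2(2)[of z] z t by simp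
  then have "t * (k' z - k' (- z)) < 0" using t by (simp add: mult_pos_neg)
  then show False using mid[OF t(1,2)] z(3) by simp
qed

context riemannian_chart
begin

lemma DERIV_along_curve:
  assumes h: "cdiff h (\<gamma> t)" and x: "((chart_map c \<circ> \<gamma>) has_vector_derivative x) (at t)"
    and U: "open U" "t \<in> U" "\<And>s. s \<in> U \<Longrightarrow> \<gamma> s \<in> chart_dom c"
  shows "DERIV (\<lambda>s. h (\<gamma> s)) t :> cderiv c h (\<gamma> t) x"
proof -
  have g: "((chart_map c \<circ> \<gamma>) has_derivative (\<lambda>s. s *\<^sub>R x)) (at t)"
    using x unfolding has_vector_derivative_def .
  have "((h \<circ> chart_inv c) has_derivative cderiv c h (\<gamma> t)) (at ((chart_map c \<circ> \<gamma>) t))"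
    using cdiff_has_derivative[OF h] by simp
  from has_derivative_compose[OF g this]
  have "((\<lambda>s. h (\<gamma> s)) has_derivative (\<lambda>s. cderiv c h (\<gamma> t) (s *\<^sub>R x))) (at t)"
    by (rule has_derivative_transform_within_open[OF _ U(1,2)]) (simp add: U(3))
  moreover have "(\<lambda>s. cderiv c h (\<gamma> t) (s *\<^sub>R x)) = (*) (cderiv c h (\<gamma> t) x)"
    by (simp add: fun_eq_iff linear_cmul[OF linear_cderiv[OF h]])
  ultimately show ?thesis by (simp add: has_field_derivative_def)
qed

text \<open>In coordinates the second derivative of \<open>h \<circ> \<gamma>\<close> is \<open>D\<^sup>2h(x',x') + Dh(x'')\<close>, and the geodesic
  equation turns the last term into \<open>- Dh(\<Gamma>(x',x'))\<close>.\<close>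

lemma second_DERIV_along_geodesic:
  assumes h: "csmooth U h" and I: "open I" "t \<in> I" "\<And>s. s \<in> I \<Longrightarrow> \<gamma> s \<in> U"
    and x: "\<And>s. s \<in> I \<Longrightarrow> ((chart_map c \<circ> \<gamma>) has_vector_derivative x' s) (at s)"
    and x': "(x' has_vector_derivative - christoffel c (\<gamma> t) (x' t) (x' t)) (at t)"
  shows "DERIV (\<lambda>s. cderiv c h (\<gamma> s) (x' s)) t :> hess c h (\<gamma> t) (x' t) (x' t)"
proof -
  define z where "z = christoffel c (\<gamma> t) (x' t) (x' t)"
  have dom: "\<gamma> s \<in> chart_dom c" if "s \<in> I" for s using I(3)[OF that] csmooth_dom[OF h] by blast
  obtain B :: "'e set" where B: "finite B"
    and exp: "\<And>w. w = (\<Sum>b\<in>B. (w \<bullet> b / (b \<bullet> b)) *\<^sub>R b)"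
    using finite_dim finite_dim_orthogonal_expansion by metis
  have expand: "L w = (\<Sum>b\<in>B. w \<bullet> b / (b \<bullet> b) * L b)" if "linear L" for L :: "'e \<Rightarrow> real" and w
    by (subst exp[of w]) (simp add: linear_sum[OF that] linear_cmul[OF that])
  have summand: "DERIV (\<lambda>s. x' s \<bullet> b / (b \<bullet> b) * cderiv c h (\<gamma> s) b) t :>
      x' t \<bullet> b / (b \<bullet> b) * cderiv c (\<lambda>q. cderiv c h q b) (\<gamma> t) (x' t)
        + (- z) \<bullet> b / (b \<bullet> b) * cderiv c h (\<gamma> t) b" for b
  proof -
    have "DERIV (\<lambda>s. cderiv c h (\<gamma> s) b) t :> cderiv c (\<lambda>q. cderiv c h q b) (\<gamma> t) (x' t)"
      by (rule DERIV_along_curve[OF csmooth_cdiff[OF csmooth_cderiv[OF h] I(3)[OF I(2)]]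
            x[OF I(2)] I(1,2) dom])
    moreover have "DERIV (\<lambda>s. x' s \<bullet> b) t :> (- z) \<bullet> b"
      using bounded_linear.has_vector_derivative[OF bounded_linear_inner_left x', of b]
      by (simp add: has_real_derivative_iff_has_vector_derivative z_def)
    ultimately show ?thesis
      by (auto intro!: derivative_eq_intros simp: algebra_simps divide_inverse)
  qed
  have "DERIV (\<lambda>s. \<Sum>b\<in>B. x' s \<bullet> b / (b \<bullet> b) * cderiv c h (\<gamma> s) b) t :>
      (\<Sum>b\<in>B. x' t \<bullet> b / (b \<bullet> b) * cderiv c (\<lambda>q. cderiv c h q b) (\<gamma> t) (x' t)
        + (- z) \<bullet> b / (b \<bullet> b) * cderiv c h (\<gamma> t) b)"
    by (intro DERIV_sum summand)
  moreover have "(\<Sum>b\<in>B. x' t \<bullet> b / (b \<bullet> b) * cderiv c (\<lambda>q. cderiv c h q b) (\<gamma> t) (x' t)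
        + (- z) \<bullet> b / (b \<bullet> b) * cderiv c h (\<gamma> t) b) = hess c h (\<gamma> t) (x' t) (x' t)"
  proof -
    note p = I(3)[OF I(2)]
    have "(\<Sum>b\<in>B. x' t \<bullet> b / (b \<bullet> b) * cderiv c (\<lambda>q. cderiv c h q b) (\<gamma> t) (x' t))
        = (\<Sum>b\<in>B. x' t \<bullet> b / (b \<bullet> b) * cderiv c (\<lambda>q. cderiv c h q (x' t)) (\<gamma> t) b)"
      by (intro sum.cong refl arg_cong[where f="(*) _"] cderiv_commute[OF h p])
    also have "\<dots> = cderiv c (\<lambda>q. cderiv c h q (x' t)) (\<gamma> t) (x' t)"
      by (rule expand[OF linear_cderiv[OF csmooth_cdiff[OF csmooth_cderiv[OF h] p]], symmetric])
    finally have "(\<Sum>b\<in>B. x' t \<bullet> b / (b \<bullet> b) * cderiv c (\<lambda>q. cderiv c h q b) (\<gamma> t) (x' t))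
        = cderiv c (\<lambda>q. cderiv c h q (x' t)) (\<gamma> t) (x' t)" .
    moreover have "(\<Sum>b\<in>B. (- z) \<bullet> b / (b \<bullet> b) * cderiv c h (\<gamma> t) b) = - cderiv c h (\<gamma> t) z"
      using expand[OF linear_cderiv[OF csmooth_cdiff[OF h p]], of "- z"]
      by (simp add: linear_neg[OF linear_cderiv[OF csmooth_cdiff[OF h p]]])
    ultimately show ?thesis unfolding sum.distrib hess_def z_def[symmetric] by (simp only: diff_conv_add_uminus)
  qed
  ultimately have "DERIV (\<lambda>s. \<Sum>b\<in>B. x' s \<bullet> b / (b \<bullet> b) * cderiv c h (\<gamma> s) b) t :>
      hess c h (\<gamma> t) (x' t) (x' t)" by simp
  then show ?thesis
    unfolding has_field_derivative_def
    by (rule has_derivative_transform_within_open[OF _ I(1,2)])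
      (rule expand[OF linear_cderiv[OF csmooth_cdiff[OF h I(3)]], symmetric])
qed

end

text \<open>Completeness provides a geodesic through \<open>p\<close> with any prescribed velocity, along which the second
  derivative of \<open>h\<close> at \<open>p\<close> is the Hessian. A short symmetric piece of it, rescaled to the unit
  interval, stays in \<open>D\<close>, and convexity there is the midpoint inequality needed.\<close>

lemma convex_fun_hess_nonneg:
  assumes A: "riemannian_manifold A" "geodesically_complete A"
    and D: "open D" and h: "smooth_fun A D h" "convex_fun A D h"
    and p: "p \<in> D" and c: "c \<in> A" "p \<in> chart_dom c"
  shows "0 \<le> hess c h p v v"
proof -
  interpret riemannian_chart c by (rule riemannian_manifold_chart[OF A(1) c(1)])
  let ?U = "chart_dom c \<inter> D"
  have sm: "csmooth ?U h" by (rule smooth_fun_csmooth[OF A(1) c(1) D h(1)])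
  obtain \<gamma> where \<gamma>: "geodesic_on A UNIV \<gamma>" "\<gamma> 0 = p"
    and v: "((chart_map c \<circ> \<gamma>) has_vector_derivative v) (at 0)"
    using A(2) c unfolding geodesically_complete_def by blast
  obtain x' where x': "\<And>t. \<gamma> t \<in> chart_dom c \<Longrightarrow> ((chart_map c \<circ> \<gamma>) has_vector_derivative x' t) (at t)"
    "\<And>t. \<gamma> t \<in> chart_dom c \<Longrightarrow>
        (x' has_vector_derivative - christoffel c (\<gamma> t) (x' t) (x' t)) (at t)"
    using \<gamma>(1) c(1) unfolding geodesic_on_def by blast
  have x0: "x' 0 = v" using vector_derivative_unique_at[OF x'(1) v] \<gamma>(2) c(2) by simp
  have "open (\<gamma> -` ?U)"
    using \<gamma>(1) open_dom D unfolding geodesic_on_def by (intro open_vimage) auto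
  moreover have "0 \<in> \<gamma> -` ?U" using \<gamma>(2) p c(2) by simp
  ultimately obtain \<delta> where \<delta>: "0 < \<delta>" "ball 0 \<delta> \<subseteq> \<gamma> -` ?U" using open_contains_ball by blast
  have in_U: "\<gamma> t \<in> ?U" if "t \<in> ball 0 \<delta>" for t using that \<delta>(2) by blast
  show ?thesis
  proof (rule second_derivative_nonneg[OF \<delta>(1), of "\<lambda>t. h (\<gamma> t)" "\<lambda>t. cderiv c h (\<gamma> t) (x' t)"])
    show "DERIV (\<lambda>t. h (\<gamma> t)) t :> cderiv c h (\<gamma> t) (x' t)" if "\<bar>t\<bar> < \<delta>" for t
    proof -
      have t: "t \<in> ball 0 \<delta>" using that by simp
      show ?thesis
        by (rule DERIV_along_curve[OF csmooth_cdiff[OF sm in_U[OF t]] x'(1) open_ball t])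
          (use in_U t in blast)+
    qed
    show "DERIV (\<lambda>t. cderiv c h (\<gamma> t) (x' t)) 0 :> hess c h p v v"
    proof -
      have 0: "(0::real) \<in> ball 0 \<delta>" using \<delta>(1) by simp
      have "DERIV (\<lambda>t. cderiv c h (\<gamma> t) (x' t)) 0 :> hess c h (\<gamma> 0) (x' 0) (x' 0)"
        by (rule second_DERIV_along_geodesic[OF sm open_ball 0 in_U x'(1) x'(2)]) (use in_U 0 in blast)+
      then show ?thesis using \<gamma>(2) x0 by simp
    qed
    show "2 * h (\<gamma> 0) \<le> h (\<gamma> t) + h (\<gamma> (- t))" if t: "0 < t" "t < \<delta>" for t
    proof -
      have "geodesic_on A {0..1} (\<lambda>s. \<gamma> (- t + (2 * t) * s))" by (rule geodesic_on_affine[OF A(1) \<gamma>(1)])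
      moreover have "\<gamma> t \<in> D" "\<gamma> (- t) \<in> D" using in_U[of t] in_U[of "- t"] t by auto
      ultimately have "convex_on {0..1} (h \<circ> (\<lambda>s. \<gamma> (- t + (2 * t) * s)))"
        using h(2) unfolding convex_fun_def by (auto simp: algebra_simps)
      from convex_onD[OF this, of "1/2" 0 1] show ?thesis by simp
    qed
  qed
qed

lemma cyl_geodesic_fst:
  assumes A: "riemannian_manifold A" and \<gamma>: "geodesic_on (cyl ` A) I \<gamma>"
  shows "geodesic_on A I (\<lambda>t. fst (\<gamma> t))"
  unfolding geodesic_on_def
proof (intro conjI ballI)
  show "continuous_on I (\<lambda>t. fst (\<gamma> t))"
    using \<gamma> unfolding geodesic_on_def by (intro continuous_on_fst) auto
  fix c assume c: "c \<in> A"
  interpret riemannian_chart c by (rule riemannian_manifold_chart[OF A c])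
  obtain x' where x': "\<forall>t\<in>I. \<gamma> t \<in> chart_dom (cyl c) \<longrightarrow>
        ((chart_map (cyl c) \<circ> \<gamma>) has_vector_derivative x' t) (at t within I) \<and>
        (x' has_vector_derivative - christoffel (cyl c) (\<gamma> t) (x' t) (x' t)) (at t within I)"
    using \<gamma> c unfolding geodesic_on_def by blast
  show "\<exists>x'. \<forall>t\<in>I. fst (\<gamma> t) \<in> chart_dom c \<longrightarrow>
        ((chart_map c \<circ> (\<lambda>t. fst (\<gamma> t))) has_vector_derivative x' t) (at t within I) \<and>
        (x' has_vector_derivative - christoffel c (fst (\<gamma> t)) (x' t) (x' t)) (at t within I)"
  proof (intro exI[of _ "\<lambda>t. fst (x' t)"] ballI impI)
    fix t assume t: "t \<in> I" "fst (\<gamma> t) \<in> chart_dom c"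
    then have "\<gamma> t \<in> chart_dom (cyl c)" by (cases "\<gamma> t") (simp add: cyl_dom)
    with t x' have d: "((chart_map (cyl c) \<circ> \<gamma>) has_vector_derivative x' t) (at t within I)"
      "(x' has_vector_derivative - christoffel (cyl c) (\<gamma> t) (x' t) (x' t)) (at t within I)" by auto
    from d[THEN bounded_linear.has_vector_derivative[OF bounded_linear_fst]]
    show "((chart_map c \<circ> (\<lambda>t. fst (\<gamma> t))) has_vector_derivative fst (x' t)) (at t within I) \<and>
      ((\<lambda>t. fst (x' t)) has_vector_derivative
        - christoffel c (fst (\<gamma> t)) (fst (x' t)) (fst (x' t))) (at t within I)"
      by (simp add: o_def cyl_map cyl_christoffel[OF t(2)])
  qed
qed

text \<open>Each product chart describes the line component by its true derivative, so the velocities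
  supplied chart by chart agree and fit together to one function, with derivative \<open>0\<close>.\<close>

lemma cyl_geodesic_snd:
  assumes A: "riemannian_manifold A" and \<gamma>: "geodesic_on (cyl ` A) {0..1} \<gamma>"
  obtains a b where "\<And>t. t \<in> {0..1} \<Longrightarrow> snd (\<gamma> t) = a + b * t"
proof -
  let ?I = "{0..1::real}"
  define k' where "k' t = vector_derivative (\<lambda>t. snd (\<gamma> t)) (at t within ?I)" for t
  have both: "((\<lambda>t. snd (\<gamma> t)) has_vector_derivative k' t) (at t within ?I) \<and>
      (k' has_vector_derivative 0) (at t within ?I)" if t: "t \<in> ?I" for t
  proof -
    obtain c where c: "c \<in> A" "fst (\<gamma> t) \<in> chart_dom c" using riemannian_manifold_cover[OF A] .
    interpret riemannian_chart c by (rule riemannian_manifold_chart[OF A c(1)])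
    obtain x' where x': "\<forall>t\<in>?I. \<gamma> t \<in> chart_dom (cyl c) \<longrightarrow>
        ((chart_map (cyl c) \<circ> \<gamma>) has_vector_derivative x' t) (at t within ?I) \<and>
        (x' has_vector_derivative - christoffel (cyl c) (\<gamma> t) (x' t) (x' t)) (at t within ?I)"
      using \<gamma> c unfolding geodesic_on_def by blast
    have d1: "((\<lambda>t. snd (\<gamma> t)) has_vector_derivative snd (x' s)) (at s within ?I)"
      and d2: "((\<lambda>t. snd (x' t)) has_vector_derivative 0) (at s within ?I)"
      if s: "s \<in> ?I" "fst (\<gamma> s) \<in> chart_dom c" for s
    proof -
      have "\<gamma> s \<in> chart_dom (cyl c)" using s by (cases "\<gamma> s") (simp add: cyl_dom)
      with s x' have d: "((chart_map (cyl c) \<circ> \<gamma>) has_vector_derivative x' s) (at s within ?I)"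
        "(x' has_vector_derivative - christoffel (cyl c) (\<gamma> s) (x' s) (x' s)) (at s within ?I)" by auto
      from d[THEN bounded_linear.has_vector_derivative[OF bounded_linear_snd]]
      show "((\<lambda>t. snd (\<gamma> t)) has_vector_derivative snd (x' s)) (at s within ?I)"
        "((\<lambda>t. snd (x' t)) has_vector_derivative 0) (at s within ?I)"
        by (simp_all add: o_def cyl_map cyl_christoffel[OF s(2)])
    qed
    have k'_eq: "k' s = snd (x' s)" if s: "s \<in> ?I" "fst (\<gamma> s) \<in> chart_dom c" for s
      unfolding k'_def by (rule vector_derivative_within_closed_interval[OF _ s(1) d1[OF s]]) simp
    have "continuous_on ?I (\<lambda>t. fst (\<gamma> t))"
      using \<gamma> unfolding geodesic_on_def by (intro continuous_on_fst) auto
    then obtain W where W: "open W" "W \<inter> ?I = (\<lambda>t. fst (\<gamma> t)) -` chart_dom c \<inter> ?I"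
      using open_dom unfolding continuous_on_open_invariant by blast
    have "t \<in> W" using W(2) t c(2) by blast
    then obtain e where e: "0 < e" "ball t e \<subseteq> W" using W(1) open_contains_ball by blast
    have "(k' has_vector_derivative 0) (at t within ?I)"
    proof (rule has_vector_derivative_transform_within[OF d2[OF t c(2)] e(1) t])
      fix s assume s: "s \<in> ?I" "dist s t < e"
      then have "s \<in> W" using e(2) by (auto simp: subset_iff dist_commute)
      then have "fst (\<gamma> s) \<in> chart_dom c" using W(2) s(1) by auto
      then show "snd (x' s) = k' s" using k'_eq[OF s(1)] by simp
    qed
    then show ?thesis using d1[OF t c(2)] k'_eq[OF t c(2)] by simp
  qed
  obtain b where b: "\<And>t. t \<in> ?I \<Longrightarrow> k' t = b"
    using has_vector_derivative_zero_constant[of ?I k'] both by auto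
  have "((\<lambda>t. snd (\<gamma> t) - b * t) has_vector_derivative 0) (at t within ?I)" if t: "t \<in> ?I" for t
  proof -
    have "((\<lambda>t. b * t) has_vector_derivative b) (at t within ?I)"
      by (auto intro!: derivative_eq_intros simp: has_vector_derivative_def)
    from has_vector_derivative_diff[OF conjunct1[OF both[OF t]] this] show ?thesis
      using b[OF t] by simp
  qed
  then obtain a where "\<And>t. t \<in> ?I \<Longrightarrow> snd (\<gamma> t) - b * t = a"
    using has_vector_derivative_zero_constant[of ?I "\<lambda>t. snd (\<gamma> t) - b * t"] by auto
  then have "snd (\<gamma> t) = a + b * t" if "t \<in> ?I" for t using that by (simp add: algebra_simps)
  then show ?thesis by (rule that)
qed

definition log_barrier :: "('m \<Rightarrow> real) \<Rightarrow> ('m \<Rightarrow> real) \<Rightarrow> 'm \<times> real \<Rightarrow> real" where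
  "log_barrier f F = (\<lambda>z. - ln (snd z - f (fst z)) + F (fst z))"

text \<open>Along a geodesic of the product \<open>t\<close> is affine, so the slack \<open>t - f\<close> is concave; it is positive at
  both ends and therefore throughout, and \<open>- ln\<close> is convex and decreasing.\<close>

lemma log_barrier_convex_fun:
  assumes A: "riemannian_manifold A" and f: "convex_fun A D f" and F: "convex_fun A D F"
  shows "convex_fun (cyl ` A) (open_epigraph D f) (log_barrier f F)"
proof -
  have main: "\<gamma> ` {0..1} \<subseteq> open_epigraph D f \<and>
      convex_on {0..1} ((\<lambda>z. - ln (snd z - f (fst z)) + F (fst z)) \<circ> \<gamma>)"
    if \<gamma>: "geodesic_on (cyl ` A) {0..1} \<gamma>" and e0: "\<gamma> 0 \<in> open_epigraph D f"
      and e1: "\<gamma> 1 \<in> open_epigraph D f" for \<gamma>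
  proof -
    have g: "geodesic_on A {0..1} (\<lambda>t. fst (\<gamma> t))" by (rule cyl_geodesic_fst[OF A \<gamma>])
    have ends: "fst (\<gamma> 0) \<in> D" "fst (\<gamma> 1) \<in> D" "f (fst (\<gamma> 0)) < snd (\<gamma> 0)" "f (fst (\<gamma> 1)) < snd (\<gamma> 1)"
      using e0 e1 unfolding open_epigraph_def by auto
    have inD: "fst (\<gamma> t) \<in> D" if "t \<in> {0..1}" for t
      using f g ends that unfolding convex_fun_def geod_convex_def by blast
    have cf: "convex_on {0..1} (\<lambda>t. f (fst (\<gamma> t)))" and cF: "convex_on {0..1} (\<lambda>t. F (fst (\<gamma> t)))"
      using f F g ends unfolding convex_fun_def by (auto simp: o_def)
    obtain a b where ab: "\<And>t. t \<in> {0..1} \<Longrightarrow> snd (\<gamma> t) = a + b * t"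
      using cyl_geodesic_snd[OF A \<gamma>] by blast
    define w where "w t = snd (\<gamma> t) - f (fst (\<gamma> t))" for t
    have conc: "(1 - s) * w x + s * w y \<le> w ((1 - s) * x + s * y)"
      if "0 \<le> s" "s \<le> 1" "x \<in> {0..1}" "y \<in> {0..1}" for s x y
    proof -
      have "(1 - s) * x + s * y \<in> {0..1}"
        using convexD_alt[of "{0..1::real}" x y s] that by simp
      then show ?thesis
        unfolding w_def using convex_onD[OF cf that] that by (simp add: ab algebra_simps)
    qed
    have wpos: "0 < w t" if t: "t \<in> {0..1}" for t
    proof -
      have "0 < (1 - t) * w 0 + t * w 1"
        using ends t by (cases "t = 0") (auto simp: w_def intro!: add_nonneg_pos mult_pos_pos)
      then show ?thesis using conc[of t 0 1] t by simp
    qed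
    have "convex_on {0..1} (\<lambda>t. - ln (w t))"
    proof (rule convex_onI)
      fix s x y :: real assume s: "0 < s" "s < 1" and xy: "x \<in> {0..1}" "y \<in> {0..1}"
      have "(1 - s) * ln (w x) + s * ln (w y) \<le> ln ((1 - s) * w x + s * w y)"
        using convex_onD[of "{0<..}" "\<lambda>x. - ln x" s "w x" "w y"] ln_concave s wpos[OF xy(1)] wpos[OF xy(2)]
        by (simp add: concave_on_def)
      also have "\<dots> \<le> ln (w ((1 - s) * x + s * y))"
      proof (rule ln_mono)
        show "0 < (1 - s) * w x + s * w y"
          using s wpos[OF xy(1)] wpos[OF xy(2)] by (intro add_pos_pos mult_pos_pos) auto
        show "(1 - s) * w x + s * w y \<le> w ((1 - s) * x + s * y)"
          using conc[of s x y] s xy by simp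
      qed
      finally show "- ln (w ((1 - s) *\<^sub>R x + s *\<^sub>R y)) \<le> (1 - s) * - ln (w x) + s * - ln (w y)"
        by simp
    qed simp
    then have "convex_on {0..1} (\<lambda>t. - ln (w t) + F (fst (\<gamma> t)))"
      using cF by (rule convex_on_add)
    moreover have "\<gamma> t \<in> open_epigraph D f" if "t \<in> {0..1}" for t
      using inD[OF that] wpos[OF that] unfolding open_epigraph_def w_def by (auto simp: case_prod_beta)
    ultimately show ?thesis unfolding w_def by (auto simp: o_def)
  qed
  then show ?thesis unfolding convex_fun_def geod_convex_def log_barrier_def by blast
qed

section \<open>Bilinear forms and the key inequality\<close>

text \<open>The assumed bound is least at \<open>s = sqrt b / sqrt a\<close>; if \<open>a\<close> or \<open>b\<close> vanishes, \<open>s\<close> tends to \<open>\<infinity>\<close> or \<open>0\<close>.\<close>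

lemma le_two_sqrt_mult:
  fixes a b x :: real
  assumes "0 \<le> a" "0 \<le> b" and le: "\<And>s. 0 < s \<Longrightarrow> x \<le> s * a + b / s"
  shows "x \<le> 2 * (sqrt a * sqrt b)"
proof (rule field_le_epsilon)
  fix e :: real assume e: "0 < e"
  show "x \<le> 2 * (sqrt a * sqrt b) + e"
  proof (cases "a = 0 \<or> b = 0")
    case False
    then have ab: "0 < a" "0 < b" using assms(1,2) by auto
    define s where "s = sqrt b / sqrt a"
    have "s * a = sqrt a * sqrt b" "b / s = sqrt a * sqrt b"
      unfolding s_def using ab by (simp_all add: field_simps)
    then show ?thesis using le[of s] ab e unfolding s_def by simp
  next
    case True
    then show ?thesis
    proof
      assume "a = 0"
      have "b / ((b + 1) / e) \<le> e" using e assms(2) by (simp add: field_simps)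
      then show ?thesis using le[of "(b + 1) / e"] \<open>a = 0\<close> e assms(2) by simp
    next
      assume "b = 0"
      have "e / (a + 1) * a \<le> e" using e assms(1) by (simp add: field_simps)
      then show ?thesis using le[of "e / (a + 1)"] \<open>b = 0\<close> e assms(1) by simp
    qed
  qed
qed

text \<open>Polarisation of \<open>s v\<close> and \<open>w\<close> bounds \<open>2 \<bar>B v w\<bar>\<close> by \<open>C (s Q v v + Q w w / s)\<close>, and \<open>s\<close> is free. For
  \<open>B = Q\<close> this is the Cauchy-Schwarz inequality.\<close>

lemma symmetric_form_bound:
  fixes B Q :: "'e::real_vector \<Rightarrow> 'e \<Rightarrow> real"
  assumes B: "\<And>v. linear (B v)" "\<And>v w. B v w = B w v"
    and Q: "\<And>v. linear (Q v)" "\<And>v w. Q v w = Q w v" "\<And>v. 0 \<le> Q v v"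
    and C: "0 \<le> C" and le: "\<And>v. \<bar>B v v\<bar> \<le> C * Q v v"
  shows "\<bar>B v w\<bar> \<le> C * sqrt (Q v v) * sqrt (Q w w)"
proof -
  have l: "L (s *\<^sub>R v + w) (s *\<^sub>R v + w) = s * s * L v v + 2 * s * L v w + L w w"
    "L (s *\<^sub>R v - w) (s *\<^sub>R v - w) = s * s * L v v - 2 * s * L v w + L w w"
    if L: "\<And>v. linear (L v)" "\<And>v w. L v w = L w v" for L :: "'e \<Rightarrow> 'e \<Rightarrow> real" and s
  proof -
    have e: "L (s *\<^sub>R v + w) v = s * L v v + L v w" "L (s *\<^sub>R v + w) w = s * L v w + L w w"
      "L (s *\<^sub>R v - w) v = s * L v v - L v w" "L (s *\<^sub>R v - w) w = s * L v w - L w w"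
      by (simp_all add: L(2)[of "s *\<^sub>R v + w"] L(2)[of "s *\<^sub>R v - w"] linear_add[OF L(1)]
          linear_diff[OF L(1)] linear_cmul[OF L(1)] L(2)[of w v])
    show "L (s *\<^sub>R v + w) (s *\<^sub>R v + w) = s * s * L v v + 2 * s * L v w + L w w"
      "L (s *\<^sub>R v - w) (s *\<^sub>R v - w) = s * s * L v v - 2 * s * L v w + L w w"
      unfolding linear_add[OF L(1)] linear_diff[OF L(1)] linear_cmul[OF L(1)] e
      by (simp_all add: algebra_simps)
  qed
  have "2 * \<bar>B v w\<bar> \<le> 2 * (sqrt (C * Q v v) * sqrt (C * Q w w))"
  proof (rule le_two_sqrt_mult)
    fix s :: real assume s: "0 < s"
    have "4 * s * B v w = B (s *\<^sub>R v + w) (s *\<^sub>R v + w) - B (s *\<^sub>R v - w) (s *\<^sub>R v - w)"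
      by (simp add: l[OF B])
    then have "\<bar>4 * s * B v w\<bar> \<le> C * Q (s *\<^sub>R v + w) (s *\<^sub>R v + w) + C * Q (s *\<^sub>R v - w) (s *\<^sub>R v - w)"
      using le[of "s *\<^sub>R v + w"] le[of "s *\<^sub>R v - w"] by linarith
    also have "\<dots> = 2 * (s * s * (C * Q v v) + C * Q w w)" unfolding l[OF Q(1,2)] by (simp add: algebra_simps)
    finally have "s * (2 * \<bar>B v w\<bar>) \<le> s * s * (C * Q v v) + C * Q w w"
      using s by (simp add: abs_mult)
    then have "2 * \<bar>B v w\<bar> \<le> (s * s * (C * Q v v) + C * Q w w) / s"
      using s by (simp add: pos_le_divide_eq mult.commute)
    then show "2 * \<bar>B v w\<bar> \<le> s * (C * Q v v) + C * Q w w / s"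
      using s by (simp add: add_divide_distrib)
  qed (use C Q(3) in simp_all)
  also have "sqrt (C * Q v v) * sqrt (C * Q w w) = C * sqrt (Q v v) * sqrt (Q w w)"
    using C by (simp add: real_sqrt_mult)
  finally show ?thesis by simp
qed

lemma cauchy_schwarz_3:
  fixes a b d x y z :: real
  shows "a * x + b * y + d * z \<le> sqrt (a\<^sup>2 + b\<^sup>2 + d\<^sup>2) * sqrt (x\<^sup>2 + y\<^sup>2 + z\<^sup>2)"
proof -
  have "(a * x + b * y + d * z)\<^sup>2 + ((a * y - b * x)\<^sup>2 + (a * z - d * x)\<^sup>2 + (b * z - d * y)\<^sup>2)
      = (a\<^sup>2 + b\<^sup>2 + d\<^sup>2) * (x\<^sup>2 + y\<^sup>2 + z\<^sup>2)"
    by (simp add: power2_eq_square algebra_simps)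
  moreover have "0 \<le> (a * y - b * x)\<^sup>2 + (a * z - d * x)\<^sup>2 + (b * z - d * y)\<^sup>2" by simp
  ultimately have "(a * x + b * y + d * z)\<^sup>2 \<le> (a\<^sup>2 + b\<^sup>2 + d\<^sup>2) * (x\<^sup>2 + y\<^sup>2 + z\<^sup>2)" by linarith
  then show ?thesis unfolding real_sqrt_mult[symmetric] by (rule real_le_rsqrt)
qed

text \<open>With \<open>x\<^sub>1, x\<^sub>2, x\<^sub>3\<close> the parts of a tangent vector measured by \<open>d(t - f)\<close>, \<open>\<nabla>\<^sup>2f\<close> and \<open>\<nabla>\<^sup>2F\<close>, and \<open>y\<close>
  those of another one, the left-hand side dominates the third derivative of the barrier. It is
  linear in \<open>x\<close>, so the Cauchy-Schwarz inequality reduces the claim to the comparison of two quartic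
  forms in \<open>y\<close>. After division by \<open>4\<close>, the only term there that is not a multiple of a product of
  two squares is \<open>2 \<beta>\<^sub>2 y\<^sub>1 y\<^sub>2\<^sup>2 y\<^sub>3\<close>, which is at most
  \<open>3/4 y\<^sub>2\<^sup>4 + 4/3 \<beta>\<^sub>2\<^sup>2 y\<^sub>1\<^sup>2 y\<^sub>3\<^sup>2\<close>. The three lower bounds on \<open>C\<^sup>2\<close> are then what the squares
  \<open>y\<^sub>i\<^sup>4\<close>, the product \<open>y\<^sub>2\<^sup>2 y\<^sub>3\<^sup>2\<close> and the product \<open>y\<^sub>1\<^sup>2 y\<^sub>3\<^sup>2\<close> require.\<close>

lemma log_barrier_inequality:
  fixes x1 x2 x3 y1 y2 y3 \<beta>1 \<beta>2 C :: real
  assumes C: "0 \<le> C" "1 + \<beta>1\<^sup>2 \<le> C\<^sup>2" "\<beta>1 + 1/2 * \<beta>2\<^sup>2 \<le> C\<^sup>2" "2/3 * \<beta>2\<^sup>2 \<le> C\<^sup>2"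
  shows "2 * x1 * y1\<^sup>2 + x1 * y2\<^sup>2 + 2 * y1 * x2 * y2 + 2 * \<beta>1 * x3 * y2\<^sup>2 + 2 * \<beta>2 * y3 * x2 * y2
      + 2 * x3 * y3\<^sup>2
    \<le> 2 * C * sqrt (x1\<^sup>2 + x2\<^sup>2 + x3\<^sup>2) * (y1\<^sup>2 + y2\<^sup>2 + y3\<^sup>2)" (is "?L \<le> _")
proof -
  let ?a1 = "2 * y1\<^sup>2 + y2\<^sup>2" and ?a2 = "2 * y1 * y2 + 2 * \<beta>2 * y3 * y2"
  let ?a3 = "2 * \<beta>1 * y2\<^sup>2 + 2 * y3\<^sup>2"
  define R where "R = y1\<^sup>2 + y2\<^sup>2 + y3\<^sup>2"
  \<comment> \<open>Each coefficient of the decomposition is one of the assumed bounds or manifestly nonnegative.\<close>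
  have "4 * C\<^sup>2 * R\<^sup>2 - (?a1\<^sup>2 + ?a2\<^sup>2 + ?a3\<^sup>2) =
      4 * (C\<^sup>2 - (1 + \<beta>1\<^sup>2)) * ((y1\<^sup>2)\<^sup>2 + (y2\<^sup>2)\<^sup>2 + (y3\<^sup>2)\<^sup>2 + 2 * (y1\<^sup>2 * y2\<^sup>2))
      + 4 * \<beta>1\<^sup>2 * ((y1\<^sup>2)\<^sup>2 + (y3\<^sup>2)\<^sup>2 + 2 * (y1\<^sup>2 * y2\<^sup>2))
      + 8 * (C\<^sup>2 - (\<beta>1 + 1/2 * \<beta>2\<^sup>2)) * (y2\<^sup>2 * y3\<^sup>2)
      + 8 * (C\<^sup>2 - 2/3 * \<beta>2\<^sup>2) * (y1\<^sup>2 * y3\<^sup>2)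
      + 3 * (y2\<^sup>2 - 4/3 * \<beta>2 * y1 * y3)\<^sup>2"
    unfolding R_def by (simp add: power2_eq_square algebra_simps)
  moreover have "0 \<le> \<dots>"
    using C by (intro add_nonneg_nonneg mult_nonneg_nonneg) auto
  ultimately have "?a1\<^sup>2 + ?a2\<^sup>2 + ?a3\<^sup>2 \<le> (2 * C * R)\<^sup>2" by (simp add: power_mult_distrib)
  moreover have "0 \<le> 2 * C * R" unfolding R_def using C(1) by simp
  ultimately have a: "sqrt (?a1\<^sup>2 + ?a2\<^sup>2 + ?a3\<^sup>2) \<le> 2 * C * R" by (rule real_le_lsqrt[rotated])
  have "?L = ?a1 * x1 + ?a2 * x2 + ?a3 * x3" by (simp add: algebra_simps)
  also have "\<dots> \<le> sqrt (?a1\<^sup>2 + ?a2\<^sup>2 + ?a3\<^sup>2) * sqrt (x1\<^sup>2 + x2\<^sup>2 + x3\<^sup>2)" by (rule cauchy_schwarz_3)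
  also have "\<dots> \<le> (2 * C * R) * sqrt (x1\<^sup>2 + x2\<^sup>2 + x3\<^sup>2)" by (rule mult_right_mono[OF a]) simp
  also have "\<dots> = 2 * C * sqrt (x1\<^sup>2 + x2\<^sup>2 + x3\<^sup>2) * R" by (simp only: ac_simps)
  finally show ?thesis unfolding R_def .
qed

section \<open>The logarithmic barrier of the epigraph in a chart\<close>

context riemannian_chart
begin

interpretation cyl: riemannian_chart "cyl c"
  by (rule cyl_chart)

context
  fixes U f F
  assumes f: "csmooth U f" and F: "csmooth U F"
begin

lemma slack_csmooth: "cyl.csmooth (open_epigraph U f) (\<lambda>z. snd z + (-1) * f (fst z))"
  and epigraph_dom: "open_epigraph U f \<subseteq> U \<times> UNIV" "open (open_epigraph U f)"
proof -
  have U: "open U" "U \<subseteq> chart_dom c" using f unfolding csmooth_def by auto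
  have UU: "open (U \<times> (UNIV :: real set))" using U by (simp add: open_Times)
  have "cyl.csmooth (U \<times> UNIV) snd"
    by (rule cyl.csmooth_subset[OF cyl_csmooth_snd UU]) (use U in \<open>auto simp: cyl_dom\<close>)
  then have s: "cyl.csmooth (U \<times> UNIV) (\<lambda>z. snd z + (-1) * f (fst z))"
    by (rule cyl.csmooth_add[OF _ cyl.csmooth_cmult[OF cyl_csmooth_fst[OF f]]])
  have e: "open_epigraph U f = (U \<times> UNIV) \<inter> (\<lambda>z. snd z + (-1) * f (fst z)) -` {0<..}"
    unfolding open_epigraph_def by auto
  show o: "open (open_epigraph U f)"
    unfolding e by (rule continuous_open_preimage[OF cyl.csmooth_continuous_on[OF s] UU]) simp
  show sub: "open_epigraph U f \<subseteq> U \<times> UNIV" unfolding e by blast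
  show "cyl.csmooth (open_epigraph U f) (\<lambda>z. snd z + (-1) * f (fst z))"
    by (rule cyl.csmooth_subset[OF s o sub])
qed

lemma slack_pos: "\<forall>z\<in>open_epigraph U f. 0 < snd z + (-1) * f (fst z)"
  unfolding open_epigraph_def by auto

lemma log_barrier_eq: "log_barrier f F = (\<lambda>z. - ln (snd z + (-1) * f (fst z)) + F (fst z))"
  unfolding log_barrier_def by simp

lemmas neg_ln_slack = cyl.csmooth_neg_ln[OF slack_csmooth slack_pos]

lemma F_fst_csmooth: "cyl.csmooth (open_epigraph U f) (\<lambda>z. F (fst z))"
  by (rule cyl.csmooth_subset[OF cyl_csmooth_fst[OF F] epigraph_dom(2,1)])

lemma log_barrier_csmooth: "cyl.csmooth (open_epigraph U f) (log_barrier f F)"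
  unfolding log_barrier_eq by (rule cyl.csmooth_add[OF neg_ln_slack F_fst_csmooth])

context
  fixes z and w :: real and \<xi> :: "'e \<times> real \<Rightarrow> real"
  assumes z: "z \<in> open_epigraph U f"
  defines "w \<equiv> snd z - f (fst z)"
    and "\<xi> \<equiv> \<lambda>x. (snd x - cderiv c f (fst z) (fst x)) / (snd z - f (fst z))"
begin

lemma base_in_U: "fst z \<in> U" "fst z \<in> chart_dom c"
proof -
  have "z \<in> U \<times> UNIV" using z epigraph_dom(1) by blast
  then show "fst z \<in> U" "fst z \<in> chart_dom c" using csmooth_dom[OF f] by auto
qed

lemma w_pos: "0 < w" using bspec[OF slack_pos z] unfolding w_def by simp

lemma f_fst_csmooth: "cyl.csmooth (open_epigraph U f) (\<lambda>z. (-1) * f (fst z))"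
  by (rule cyl.csmooth_cmult[OF cyl.csmooth_subset[OF cyl_csmooth_fst[OF f] epigraph_dom(2,1)]])

lemma snd_csmooth: "cyl.csmooth (open_epigraph U f) snd"
  by (rule cyl.csmooth_subset[OF cyl_csmooth_snd epigraph_dom(2)])
    (use epigraph_dom(1) csmooth_dom[OF f] in \<open>auto simp: cyl_dom\<close>)

text \<open>The slack \<open>t - f\<close> differs from \<open>- f\<close> by the coordinate \<open>t\<close>, whose covariant derivatives of order two
  and three vanish. Its differential is written as \<open>w \<xi>\<close>, so that \<open>\<xi> = d (ln w)\<close> and \<open>w\<close>
  occurs in the derivatives of the barrier only as a divisor of those of \<open>f\<close>.\<close>

lemma slack_derivs:
  "cderiv (cyl c) (\<lambda>z. snd z + (-1) * f (fst z)) z x = w * \<xi> x"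
  "hess (cyl c) (\<lambda>z. snd z + (-1) * f (fst z)) z x y = - hess c f (fst z) (fst x) (fst y)"
  "nabla3 (cyl c) (\<lambda>z. snd z + (-1) * f (fst z)) z x y y' = - nabla3 c f (fst z) (fst x) (fst y) (fst y')"
proof -
  note ff = cyl_csmooth_fst[OF f] and df = cyl_cdiff_fst[OF base_in_U(2) csmooth_cdiff[OF f base_in_U(1)]]
  have zU: "z \<in> U \<times> UNIV" using z epigraph_dom(1) by blast
  have "cderiv (cyl c) (\<lambda>z. snd z + (-1) * f (fst z)) z x = snd x - cderiv c f (fst z) (fst x)"
    using cyl.cdiff_add(2)[OF cyl.csmooth_cdiff[OF snd_csmooth z] cyl.csmooth_cdiff[OF f_fst_csmooth z]]
    by (simp add: cyl_snd(1)[OF base_in_U(2)] cyl.cdiff_cmult(2)[OF df(1), of "-1", simplified] df(2))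
  then show "cderiv (cyl c) (\<lambda>z. snd z + (-1) * f (fst z)) z x = w * \<xi> x"
    using w_pos unfolding w_def \<xi>_def by simp
  show "hess (cyl c) (\<lambda>z. snd z + (-1) * f (fst z)) z x y = - hess c f (fst z) (fst x) (fst y)"
    unfolding cyl.hess_add[OF snd_csmooth f_fst_csmooth z] cyl.hess_cmult[OF ff zU]
    by (simp add: cyl_snd(2)[OF base_in_U(2)] cyl_hess_fst[OF f base_in_U(1)])
  show "nabla3 (cyl c) (\<lambda>z. snd z + (-1) * f (fst z)) z x y y'
      = - nabla3 c f (fst z) (fst x) (fst y) (fst y')"
    unfolding cyl.nabla3_add[OF snd_csmooth f_fst_csmooth z] cyl.nabla3_cmult[OF ff zU]
    by (simp add: cyl_snd(3)[OF base_in_U(2)] cyl_nabla3_fst[OF f base_in_U(1)])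
qed

lemma log_barrier_cderiv:
  "cderiv (cyl c) (log_barrier f F) z x = cderiv c F (fst z) (fst x) - \<xi> x"
proof -
  have "cderiv (cyl c) (log_barrier f F) z x
      = cderiv (cyl c) (\<lambda>z. - ln (snd z + (-1) * f (fst z))) z x + cderiv (cyl c) (\<lambda>z. F (fst z)) z x"
    unfolding log_barrier_eq
    by (simp add: cyl.cdiff_add(2)[OF cyl.csmooth_cdiff[OF neg_ln_slack z]
          cyl.csmooth_cdiff[OF F_fst_csmooth z], simplified])
  then show ?thesis
    unfolding cyl.neg_ln_cderiv(1)[OF slack_csmooth slack_pos z] slack_derivs
      cyl_cdiff_fst(2)[OF base_in_U(2) csmooth_cdiff[OF F base_in_U(1)]]
    using w_pos by (simp add: w_def)
qed

lemma log_barrier_hess: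
  "hess (cyl c) (log_barrier f F) z x y =
    \<xi> x * \<xi> y + hess c f (fst z) (fst x) (fst y) / w + hess c F (fst z) (fst x) (fst y)"
proof -
  have "snd z + (-1) * f (fst z) = w" unfolding w_def by simp
  then show ?thesis
    unfolding log_barrier_eq cyl.hess_add[OF neg_ln_slack F_fst_csmooth z]
      cyl.neg_ln_hess[OF slack_csmooth slack_pos z] slack_derivs cyl_hess_fst[OF F base_in_U(1)]
    using w_pos by (simp add: power2_eq_square)
qed

lemma log_barrier_nabla3:
  "nabla3 (cyl c) (log_barrier f F) z x y y' =
    nabla3 c f (fst z) (fst x) (fst y) (fst y') / w
    - (\<xi> x * hess c f (fst z) (fst y) (fst y') + \<xi> y * hess c f (fst z) (fst x) (fst y')
       + \<xi> y' * hess c f (fst z) (fst x) (fst y)) / w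
    - 2 * \<xi> x * \<xi> y * \<xi> y' + nabla3 c F (fst z) (fst x) (fst y) (fst y')"
proof -
  have w: "snd z + (-1) * f (fst z) = w" unfolding w_def by simp
  show ?thesis
    unfolding log_barrier_eq cyl.nabla3_add[OF neg_ln_slack F_fst_csmooth z]
      cyl.neg_ln_nabla3[OF slack_csmooth slack_pos z] slack_derivs cyl_nabla3_fst[OF F base_in_U(1)] w
    using w_pos by (simp add: power2_eq_square power3_eq_cube field_simps)
qed

context
  assumes f_nonneg: "\<And>v. 0 \<le> hess c f (fst z) v v" and F_nonneg: "\<And>v. 0 \<le> hess c F (fst z) v v"
begin

text \<open>A sum of three squares: these are the quantities \<open>x\<^sub>i\<^sup>2\<close> that enter the inequality for the third
  derivative.\<close>

lemma log_barrier_hess_diag: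
  "hess (cyl c) (log_barrier f F) z x x = \<bar>\<xi> x\<bar>\<^sup>2
    + (sqrt (hess c f (fst z) (fst x) (fst x) / w))\<^sup>2 + (sqrt (hess c F (fst z) (fst x) (fst x)))\<^sup>2"
  unfolding log_barrier_hess using f_nonneg F_nonneg w_pos by (simp add: power2_eq_square[of "\<xi> x"])

lemma log_barrier_hess_nonneg: "0 \<le> hess (cyl c) (log_barrier f F) z x x"
  unfolding log_barrier_hess_diag by simp

lemma log_barrier_hess_pos:
  assumes F_pos: "\<And>v. v \<noteq> 0 \<Longrightarrow> 0 < hess c F (fst z) v v" and x: "x \<noteq> 0"
  shows "0 < hess (cyl c) (log_barrier f F) z x x"
proof (cases "fst x = 0")
  case True
  then have "snd x \<noteq> 0" using x by (simp add: prod_eq_iff)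
  moreover have "cderiv c f (fst z) 0 = 0"
    by (rule linear_0[OF linear_cderiv[OF csmooth_cdiff[OF f base_in_U(1)]]])
  ultimately have "\<xi> x \<noteq> 0" using True w_pos unfolding \<xi>_def w_def by simp
  then have "0 < \<bar>\<xi> x\<bar>\<^sup>2" by simp
  then show ?thesis unfolding log_barrier_hess_diag by (intro add_pos_nonneg) simp_all
next
  case False
  then have "0 < (sqrt (hess c F (fst z) (fst x) (fst x)))\<^sup>2" using F_pos[OF False] by simp
  then show ?thesis unfolding log_barrier_hess_diag by (intro add_nonneg_pos add_nonneg_nonneg) simp_all
qed

text \<open>The Cauchy-Schwarz inequality for the vectors \<open>(1, 0, k)\<close> and the three roots in the Hessian.\<close>

lemma log_barrier_cderiv_bound:
  assumes k: "\<And>v. \<bar>cderiv c F (fst z) v\<bar> \<le> k * sqrt (1 * hess c F (fst z) v v)"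
  shows "\<bar>cderiv (cyl c) (log_barrier f F) z x\<bar>
    \<le> sqrt (1 + k\<^sup>2) * sqrt (1 * hess (cyl c) (log_barrier f F) z x x)"
proof -
  have "\<bar>cderiv (cyl c) (log_barrier f F) z x\<bar> \<le> \<bar>cderiv c F (fst z) (fst x)\<bar> + \<bar>\<xi> x\<bar>"
    unfolding log_barrier_cderiv by simp
  also have "\<dots> \<le> 1 * \<bar>\<xi> x\<bar> + 0 * sqrt (hess c f (fst z) (fst x) (fst x) / w)
      + k * sqrt (hess c F (fst z) (fst x) (fst x))"
    using k[of "fst x"] by simp
  also have "\<dots> \<le> sqrt (1\<^sup>2 + 0\<^sup>2 + k\<^sup>2) * sqrt (hess (cyl c) (log_barrier f F) z x x)"
    unfolding log_barrier_hess_diag by (rule cauchy_schwarz_3)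
  finally show ?thesis by simp
qed

text \<open>The compatibility of \<open>f\<close> with \<open>F\<close> controls only \<open>(\<nabla>\<^sup>3f)(u,v,v)\<close>; the mixed term
  \<open>(\<nabla>\<^sup>2f)(u,v)\<close> is estimated by the Cauchy-Schwarz inequality for \<open>\<nabla>\<^sup>2f\<close>, where convexity of
  \<open>f\<close> enters.\<close>

lemma log_barrier_nabla3_diag_bound:
  assumes C: "0 \<le> C" "1 + \<beta>1\<^sup>2 \<le> C\<^sup>2" "\<beta>1 + 1/2 * \<beta>2\<^sup>2 \<le> C\<^sup>2" "2/3 * \<beta>2\<^sup>2 \<le> C\<^sup>2"
    and f3: "\<And>u v. \<bar>nabla3 c f (fst z) u v v\<bar> \<le>
          2 * \<beta>1 * sqrt (hess c F (fst z) u u) * hess c f (fst z) v v +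
          2 * \<beta>2 * sqrt (hess c F (fst z) v v) * sqrt (hess c f (fst z) u u) * sqrt (hess c f (fst z) v v)"
    and F3: "\<And>u v. \<bar>nabla3 c F (fst z) u v v\<bar> \<le>
          2 * sqrt (hess c F (fst z) u u) * hess c F (fst z) v v"
  shows "\<bar>nabla3 (cyl c) (log_barrier f F) z x y y\<bar> \<le>
    2 * C * sqrt (hess (cyl c) (log_barrier f F) z x x) * hess (cyl c) (log_barrier f F) z y y"
proof -
  let ?f = "hess c f (fst z)" and ?F = "hess c F (fst z)"
  let ?u = "fst x" and ?v = "fst y"
  \<comment> \<open>Named as in the inequality to be applied, where \<open>x1\<close> and \<open>y1\<close> will be \<open>\<bar>\<xi> x\<bar>\<close> and \<open>\<bar>\<xi> y\<bar>\<close>.\<close>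
  define x2 x3 y2 y3 where d: "x2 = sqrt (?f ?u ?u / w)" "x3 = sqrt (?F ?u ?u)"
    "y2 = sqrt (?f ?v ?v / w)" "y3 = sqrt (?F ?v ?v)"
  have y2: "y2\<^sup>2 = ?f ?v ?v / w" and y3: "y3\<^sup>2 = ?F ?v ?v"
    unfolding d using f_nonneg F_nonneg w_pos by simp_all
  have x2y2: "sqrt (?f ?u ?u) * sqrt (?f ?v ?v) / w = x2 * y2"
    unfolding d using w_pos by (simp add: real_sqrt_divide)
  have cs: "\<bar>?f ?u ?v\<bar> / w \<le> x2 * y2"
    unfolding x2y2[symmetric]
    using symmetric_form_bound[where B="?f" and Q="?f" and C=1 and v="?u" and w="?v"]
      hess_linear(1)[OF f base_in_U(1)] hess_sym[OF f base_in_U(1)] f_nonneg w_pos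
    by (intro divide_right_mono) auto
  have t1: "\<bar>nabla3 c f (fst z) ?u ?v ?v\<bar> / w \<le> 2 * \<beta>1 * x3 * y2\<^sup>2 + 2 * \<beta>2 * y3 * x2 * y2"
  proof -
    have "\<bar>nabla3 c f (fst z) ?u ?v ?v\<bar> / w \<le> (2 * \<beta>1 * x3 * ?f ?v ?v +
          2 * \<beta>2 * y3 * sqrt (?f ?u ?u) * sqrt (?f ?v ?v)) / w"
      using f3[of ?u ?v] w_pos unfolding d by (intro divide_right_mono) auto
    also have "\<dots> = 2 * \<beta>1 * x3 * y2\<^sup>2 + 2 * \<beta>2 * y3 * (sqrt (?f ?u ?u) * sqrt (?f ?v ?v) / w)"
      unfolding y2 by (simp add: add_divide_distrib)
    finally show ?thesis unfolding x2y2 by (simp add: ac_simps)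
  qed
  have t2: "\<bar>nabla3 c F (fst z) ?u ?v ?v\<bar> \<le> 2 * x3 * y3\<^sup>2"
    using F3[of ?u ?v] unfolding y3 unfolding d by simp
  have t3: "\<bar>\<xi> y * ?f ?u ?v / w\<bar> \<le> \<bar>\<xi> y\<bar> * (x2 * y2)"
    using mult_left_mono[OF cs, of "\<bar>\<xi> y\<bar>"] w_pos by (simp add: abs_mult)
  have t4: "\<bar>\<xi> x * ?f ?v ?v / w\<bar> = \<bar>\<xi> x\<bar> * y2\<^sup>2"
    unfolding y2 using w_pos f_nonneg by (simp add: abs_mult)
  have t5: "\<bar>2 * \<xi> x * \<xi> y * \<xi> y\<bar> = 2 * \<bar>\<xi> x\<bar> * \<bar>\<xi> y\<bar>\<^sup>2"
    by (simp add: abs_mult power2_eq_square)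
  have "nabla3 (cyl c) (log_barrier f F) z x y y = nabla3 c f (fst z) ?u ?v ?v / w
    - \<xi> x * ?f ?v ?v / w - 2 * (\<xi> y * ?f ?u ?v / w)
    - 2 * \<xi> x * \<xi> y * \<xi> y + nabla3 c F (fst z) ?u ?v ?v"
    unfolding log_barrier_nabla3 by (simp add: add_divide_distrib)
  also have "\<bar>\<dots>\<bar> \<le> \<bar>nabla3 c f (fst z) ?u ?v ?v\<bar> / w
    + \<bar>\<xi> x * ?f ?v ?v / w\<bar> + 2 * \<bar>\<xi> y * ?f ?u ?v / w\<bar>
    + \<bar>2 * \<xi> x * \<xi> y * \<xi> y\<bar> + \<bar>nabla3 c F (fst z) ?u ?v ?v\<bar>"
  proof -
    have tri: "\<bar>a - b - 2 * d - e + g\<bar> \<le> \<bar>a\<bar> + \<bar>b\<bar> + 2 * \<bar>d\<bar> + \<bar>e\<bar> + \<bar>g\<bar>" for a b d e g :: real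
      by linarith
    have "\<bar>nabla3 c f (fst z) ?u ?v ?v\<bar> / w = \<bar>nabla3 c f (fst z) ?u ?v ?v / w\<bar>"
      using w_pos by simp
    then show ?thesis using tri by presburger
  qed
  also have "\<dots> \<le> 2 * \<bar>\<xi> x\<bar> * \<bar>\<xi> y\<bar>\<^sup>2 + \<bar>\<xi> x\<bar> * y2\<^sup>2 + 2 * \<bar>\<xi> y\<bar> * x2 * y2 + 2 * \<beta>1 * x3 * y2\<^sup>2
      + 2 * \<beta>2 * y3 * x2 * y2 + 2 * x3 * y3\<^sup>2"
    using t1 t2 t3 unfolding t4 t5 by (simp add: mult.assoc)
  also have "\<dots> \<le> 2 * C * sqrt (\<bar>\<xi> x\<bar>\<^sup>2 + x2\<^sup>2 + x3\<^sup>2) * (\<bar>\<xi> y\<bar>\<^sup>2 + y2\<^sup>2 + y3\<^sup>2)"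
    by (rule log_barrier_inequality[OF C])
  finally show ?thesis unfolding log_barrier_hess_diag d .
qed

text \<open>For a fixed first argument the third derivative is a symmetric form in the other two, so the
  diagonal bound extends to all arguments.\<close>

lemma log_barrier_nabla3_bound:
  assumes C: "0 \<le> C" "1 + \<beta>1\<^sup>2 \<le> C\<^sup>2" "\<beta>1 + 1/2 * \<beta>2\<^sup>2 \<le> C\<^sup>2" "2/3 * \<beta>2\<^sup>2 \<le> C\<^sup>2"
    and f3: "\<And>u v. \<bar>nabla3 c f (fst z) u v v\<bar> \<le>
          2 * \<beta>1 * sqrt (hess c F (fst z) u u) * hess c f (fst z) v v +
          2 * \<beta>2 * sqrt (hess c F (fst z) v v) * sqrt (hess c f (fst z) u u) * sqrt (hess c f (fst z) v v)"
    and F3: "\<And>u v. \<bar>nabla3 c F (fst z) u v v\<bar> \<le>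
          2 * sqrt (hess c F (fst z) u u) * hess c F (fst z) v v"
  defines "Q \<equiv> hess (cyl c) (log_barrier f F) z"
  shows "\<bar>nabla3 (cyl c) (log_barrier f F) z x y y'\<bar> \<le>
    2 * C * sqrt (Q x x) * sqrt (Q y y) * sqrt (Q y' y')"
  unfolding Q_def
proof (rule symmetric_form_bound[where B = "nabla3 (cyl c) (log_barrier f F) z x"
      and Q = "hess (cyl c) (log_barrier f F) z"])
  show "\<bar>nabla3 (cyl c) (log_barrier f F) z x v v\<bar>
      \<le> 2 * C * sqrt (hess (cyl c) (log_barrier f F) z x x) * hess (cyl c) (log_barrier f F) z v v" for v
    by (rule log_barrier_nabla3_diag_bound[OF C f3 F3])
  show "0 \<le> 2 * C * sqrt (hess (cyl c) (log_barrier f F) z x x)"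
    using C(1) log_barrier_hess_nonneg by simp
qed (rule cyl.nabla3_linear[OF log_barrier_csmooth z] cyl.nabla3_sym[OF log_barrier_csmooth z]
    cyl.hess_linear(1)[OF log_barrier_csmooth z] cyl.hess_sym[OF log_barrier_csmooth z]
    log_barrier_hess_nonneg)+

end

end

end

end

section \<open>The Newton decrement\<close>

lemma newton_decrement_le:
  assumes "0 \<le> k" "\<And>c v. c \<in> A \<Longrightarrow> x \<in> chart_dom c \<Longrightarrow>
      \<bar>cderiv c h x v\<bar> \<le> k * sqrt (\<alpha> * hess c h x v v)"
  shows "newton_decrement A h \<alpha> x \<le> ennreal k"
  unfolding newton_decrement_def using assms by (intro Inf_lower imageI) auto

text \<open>The admissible constants form a closed set, hence an infimum that is finite is admissible itself.\<close>

lemma newton_decrement_attained: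
  assumes "newton_decrement A h \<alpha> x \<noteq> top"
  obtains k where "0 \<le> k" "newton_decrement A h \<alpha> x = ennreal k"
    "\<And>c v. c \<in> A \<Longrightarrow> x \<in> chart_dom c \<Longrightarrow>
      \<bar>cderiv c h x v\<bar> \<le> k * sqrt (\<alpha> * hess c h x v v)"
proof -
  define S where "S = {k. 0 \<le> k \<and> (\<forall>c\<in>A. x \<in> chart_dom c \<longrightarrow>
        (\<forall>v. \<bar>cderiv c h x v\<bar> \<le> k * sqrt (\<alpha> * hess c h x v v)))}"
  have nd: "newton_decrement A h \<alpha> x = Inf (ennreal ` S)" unfolding newton_decrement_def S_def ..
  have ne: "S \<noteq> {}" using assms unfolding nd by auto
  have bdd: "bdd_below S" unfolding S_def by (rule bdd_belowI[of _ 0]) simp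
  have S_eq: "S = {0..} \<inter> (\<Inter>c\<in>{c\<in>A. x \<in> chart_dom c}. \<Inter>v.
      {k. \<bar>cderiv c h x v\<bar> \<le> k * sqrt (\<alpha> * hess c h x v v)})"
    unfolding S_def by auto
  have "closed S"
    unfolding S_eq
    by (intro closed_Int closed_INT ballI closed_Collect_le continuous_intros closed_atLeast)
  then have k: "Inf S \<in> S" using closed_contains_Inf[OF ne bdd] by blast
  have "Inf (ennreal ` S) = ennreal (Inf S)"
  proof (rule antisym)
    show "Inf (ennreal ` S) \<le> ennreal (Inf S)" using k by (intro Inf_lower imageI)
    show "ennreal (Inf S) \<le> Inf (ennreal ` S)"
      using cInf_lower[OF _ bdd] by (intro Inf_greatest) (auto intro!: ennreal_leI)
  qed
  then show ?thesis using that[of "Inf S"] k nd unfolding S_def by auto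
qed

lemma newton_decrement_rescale:
  assumes \<alpha>: "0 < \<alpha>"
  shows "newton_decrement A h \<alpha> x = newton_decrement A h 1 x / ennreal (sqrt \<alpha>)"
proof (rule antisym)
  show "newton_decrement A h \<alpha> x \<le> newton_decrement A h 1 x / ennreal (sqrt \<alpha>)"
  proof (cases "newton_decrement A h 1 x = top")
    case True
    then show ?thesis by (simp add: ennreal_top_divide)
  next
    case False
    obtain k where k: "0 \<le> k" "newton_decrement A h 1 x = ennreal k"
      "\<And>c v. c \<in> A \<Longrightarrow> x \<in> chart_dom c \<Longrightarrow> \<bar>cderiv c h x v\<bar> \<le> k * sqrt (1 * hess c h x v v)"
      using newton_decrement_attained[OF False] by blast
    have "newton_decrement A h \<alpha> x \<le> ennreal (k / sqrt \<alpha>)"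
      using k \<alpha> by (intro newton_decrement_le) (simp_all add: real_sqrt_mult)
    then show ?thesis using k \<alpha> by (simp add: divide_ennreal)
  qed
  show "newton_decrement A h 1 x / ennreal (sqrt \<alpha>) \<le> newton_decrement A h \<alpha> x"
  proof (cases "newton_decrement A h \<alpha> x = top")
    case False
    obtain k where k: "0 \<le> k" "newton_decrement A h \<alpha> x = ennreal k"
      "\<And>c v. c \<in> A \<Longrightarrow> x \<in> chart_dom c \<Longrightarrow> \<bar>cderiv c h x v\<bar> \<le> k * sqrt (\<alpha> * hess c h x v v)"
      using newton_decrement_attained[OF False] by blast
    have "newton_decrement A h 1 x \<le> ennreal (k * sqrt \<alpha>)"
      using k \<alpha> by (intro newton_decrement_le) (simp_all add: real_sqrt_mult mult.assoc)
    then have "newton_decrement A h 1 x / ennreal (sqrt \<alpha>) \<le> ennreal (k * sqrt \<alpha>) / ennreal (sqrt \<alpha>)"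
      by (rule divide_right_mono_ennreal)
    then show ?thesis using k \<alpha> by (simp add: divide_ennreal)
  qed simp
qed

lemma ennreal_divide_power2:
  assumes "0 < s"
  shows "(x / ennreal s)\<^sup>2 = x\<^sup>2 / ennreal (s\<^sup>2)"
proof (cases x)
  case (real r)
  then show ?thesis using assms by (simp add: divide_ennreal ennreal_power power_divide)
next
  case top
  then show ?thesis using assms by (simp add: ennreal_top_divide power2_eq_square ennreal_top_mult)
qed

section \<open>Closedness of the epigraph of the logarithmic barrier\<close>

text \<open>A limit of points of the epigraph could escape in two ways. It could leave \<open>D\<close>: the closed
  extension of \<open>f\<close> bounds \<open>f\<close> from below along the sequence, so the slack is bounded above by some
  \<open>K\<close>, \<open>F\<close> is bounded by \<open>s + ln K\<close> in the limit, and closedness of the epigraph of \<open>F\<close> keeps the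
  limit in \<open>D\<close>. Or the slack could tend to \<open>0\<close>: then \<open>- ln\<close> of it tends to \<open>\<infinity>\<close> while \<open>F\<close>, now
  continuous at the limit, stays bounded.\<close>

lemma log_barrier_closed_epigraph:
  fixes D :: "'m::first_countable_topology set"
  assumes D: "open D" and f: "continuous_on D f" and F: "continuous_on D F"
    and F_closed: "closed {(x, s). x \<in> D \<and> F x \<le> s}"
    and ext: "D \<subseteq> D'" "\<And>x. x \<in> D \<Longrightarrow> f' x = f x"
    and f'_closed: "closed {(x, s). x \<in> D' \<and> f' x \<le> s}"
  shows "closed {(z, s). z \<in> open_epigraph D f \<and> log_barrier f F z \<le> s}"
  unfolding closed_sequential_limits
proof (intro allI impI, elim conjE)
  fix X and l :: "('m \<times> real) \<times> real"
  assume X: "\<forall>n. X n \<in> {(z, s). z \<in> open_epigraph D f \<and> log_barrier f F z \<le> s}" and lim: "X \<longlonglongrightarrow> l"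
  define P T S where d: "P n = fst (fst (X n))" "T n = snd (fst (X n))" "S n = snd (X n)" for n
  obtain p t s where l: "l = ((p, t), s)" by (metis surj_pair)
  have P: "P \<longlonglongrightarrow> p" and T: "T \<longlonglongrightarrow> t" and S: "S \<longlonglongrightarrow> s"
    using tendsto_fst[OF tendsto_fst[OF lim]] tendsto_snd[OF tendsto_fst[OF lim]] tendsto_snd[OF lim]
    unfolding d[abs_def] l by simp_all
  define w where "w n = T n - f (P n)" for n
  have PD: "P n \<in> D" and w_pos: "0 < w n" and le: "- ln (w n) + F (P n) \<le> S n" for n
    using X[rule_format, of n]
    unfolding d w_def open_epigraph_def log_barrier_def by (auto simp: case_prod_beta)
  have pt: "p \<in> D'" "f' p \<le> t"
  proof -
    have "(p, t) \<in> {(x, s). x \<in> D' \<and> f' x \<le> s}"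
    proof (rule closed_sequentially[OF f'_closed _ tendsto_Pair[OF P T]])
      show "(P n, T n) \<in> {(x, s). x \<in> D' \<and> f' x \<le> s}" for n
        using PD[of n] w_pos[of n] ext unfolding w_def by auto
    qed
    then show "p \<in> D'" "f' p \<le> t" by auto
  qed
  define K where "K = t - f' p + 2"
  have K: "0 < K" using pt(2) unfolding K_def by simp
  \<comment> \<open>The point \<open>(p, f' p - 1)\<close> lies below the closed epigraph of \<open>f'\<close>, hence so do nearby points.\<close>
  have "eventually (\<lambda>n. (P n, f' p - 1) \<in> - {(x, s). x \<in> D' \<and> f' x \<le> s}) sequentially"
    by (rule topological_tendstoD[OF tendsto_Pair[OF P tendsto_const]])
      (use f'_closed in auto)
  moreover have "eventually (\<lambda>n. T n < t + 1) sequentially"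
    by (rule order_tendstoD(2)[OF T]) simp
  ultimately have w_le: "eventually (\<lambda>n. w n \<le> K) sequentially"
  proof eventually_elim
    case (elim n)
    then have "f' p - 1 < f (P n)" using PD[of n] ext by auto
    then show ?case using elim(2) unfolding w_def K_def by linarith
  qed
  have p: "p \<in> D"
  proof -
    have "eventually (\<lambda>n. (P n, S n + ln K) \<in> {(x, s). x \<in> D \<and> F x \<le> s}) sequentially"
      using w_le
    proof eventually_elim
      case (elim n)
      then have "ln (w n) \<le> ln K" using w_pos[of n] by simp
      then show ?case using PD[of n] le[of n] by auto
    qed
    then have "(p, s + ln K) \<in> {(x, s). x \<in> D \<and> F x \<le> s}"
      by (rule Lim_in_closed_set[OF F_closed _ sequentially_bot
            tendsto_Pair[OF P tendsto_add[OF S tendsto_const]]])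
    then show ?thesis by auto
  qed
  have fP: "(\<lambda>n. f (P n)) \<longlonglongrightarrow> f p" and FP: "(\<lambda>n. F (P n)) \<longlonglongrightarrow> F p"
    using continuous_on_tendsto_compose[OF f P p] continuous_on_tendsto_compose[OF F P p] PD by auto
  have w_lim: "w \<longlonglongrightarrow> t - f p" unfolding w_def[abs_def] by (rule tendsto_diff[OF T fP])
  have "f p \<noteq> t"
  proof
    assume "f p = t"
    then have "filterlim w (at_right 0) sequentially"
      using w_lim w_pos less_imp_neq[OF w_pos] by (simp add: filterlim_at)
    from filterlim_compose[OF ln_at_0 this]
    have "eventually (\<lambda>n. ln (w n) \<le> F p - s - 1) sequentially"
      unfolding filterlim_at_bot by blast
    moreover have "eventually (\<lambda>n. F p - s - 1 < F (P n) - S n) sequentially"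
      by (rule order_tendstoD(1)[OF tendsto_diff[OF FP S]]) simp
    ultimately have "eventually (\<lambda>n. False) sequentially"
    proof eventually_elim
      case (elim n)
      then show ?case using le[of n] by linarith
    qed
    then show False by simp
  qed
  then have ft: "f p < t" using pt(2) ext(2)[OF p] by simp
  have "(\<lambda>n. - ln (w n) + F (P n)) \<longlonglongrightarrow> - ln (t - f p) + F p"
    using ft by (intro tendsto_intros w_lim FP) simp
  then have "- ln (t - f p) + F p \<le> s" using S le by (intro LIMSEQ_le) auto
  then show "l \<in> {(z, s). z \<in> open_epigraph D f \<and> log_barrier f F z \<le> s}"
    using p ft unfolding l open_epigraph_def log_barrier_def by simp
qed

section \<open>The epigraph barrier on the product manifold\<close>

locale convex_pair =
  fixes A :: "('m::{t2_space, second_countable_topology}, 'e::real_inner) rchart set"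
    and D :: "'m set" and f F :: "'m \<Rightarrow> real"
  assumes manifold: "riemannian_manifold A" and complete: "geodesically_complete A"
    and D: "open D"
    and f_smooth: "smooth_fun A D f" and F_smooth: "smooth_fun A D F"
    and f_convex: "convex_fun A D f" and F_convex: "convex_fun A D F"
begin

abbreviation E where "E \<equiv> open_epigraph D f"
abbreviation G where "G \<equiv> log_barrier f F"

text \<open>Everything about the barrier is proved in one product chart; this lemma supplies, for any chart of the
  product, the facts on \<open>f\<close> and \<open>F\<close> in the chart of the base manifold that those proofs start from.\<close>

lemma cyl_chart_cases:
  assumes "d \<in> cyl ` A" "z \<in> E" "z \<in> chart_dom d"
  obtains c where "c \<in> A" "d = cyl c" "riemannian_chart c" "fst z \<in> D" "fst z \<in> chart_dom c"
    "riemannian_chart.csmooth c (chart_dom c \<inter> D) f" "riemannian_chart.csmooth c (chart_dom c \<inter> D) F"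
    "z \<in> open_epigraph (chart_dom c \<inter> D) f"
    "\<And>v. 0 \<le> hess c f (fst z) v v" "\<And>v. 0 \<le> hess c F (fst z) v v"
proof -
  obtain c where c: "c \<in> A" "d = cyl c" using assms(1) by blast
  have z: "fst z \<in> D" "fst z \<in> chart_dom c"
    using assms(2,3) unfolding c(2) cyl_dom open_epigraph_def by auto
  show ?thesis
  proof (rule that[OF c riemannian_manifold_chart[OF manifold c(1)] z
        smooth_fun_csmooth[OF manifold c(1) D f_smooth] smooth_fun_csmooth[OF manifold c(1) D F_smooth]])
    show "z \<in> open_epigraph (chart_dom c \<inter> D) f" using assms(2) z unfolding open_epigraph_def by auto
    show "0 \<le> hess c f (fst z) v v" for v
      by (rule convex_fun_hess_nonneg[OF manifold complete D f_smooth f_convex z(1) c(1) z(2)])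
    show "0 \<le> hess c F (fst z) v v" for v
      by (rule convex_fun_hess_nonneg[OF manifold complete D F_smooth F_convex z(1) c(1) z(2)])
  qed
qed

lemma E_open: "open E"
proof -
  have c: "continuous_on (D \<times> UNIV) (\<lambda>z. snd z - f (fst z))"
    by (intro continuous_intros continuous_on_compose2[OF smooth_fun_continuous_on[OF manifold D f_smooth]])
      auto
  have "E = (D \<times> UNIV) \<inter> (\<lambda>z. snd z - f (fst z)) -` {0<..}" unfolding open_epigraph_def by auto
  then show ?thesis
    using continuous_open_preimage[OF c open_Times[OF D open_UNIV] open_greaterThan] by simp
qed

lemma E_chart:
  assumes c: "c \<in> A"
  shows "riemannian_chart.csmooth (cyl c) (chart_dom (cyl c) \<inter> E) G"
proof -
  interpret riemannian_chart c by (rule riemannian_manifold_chart[OF manifold c])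
  have "open_epigraph (chart_dom c \<inter> D) f = chart_dom (cyl c) \<inter> E"
    unfolding open_epigraph_def cyl_dom by auto
  then show ?thesis
    using log_barrier_csmooth[OF smooth_fun_csmooth[OF manifold c D f_smooth]
        smooth_fun_csmooth[OF manifold c D F_smooth]] by simp
qed

lemma G_convex: "convex_fun (cyl ` A) E G"
  by (rule log_barrier_convex_fun[OF manifold f_convex F_convex])

lemma G_smooth: "smooth_fun (cyl ` A) E G"
  unfolding smooth_fun_def
proof
  fix d assume "d \<in> cyl ` A"
  then obtain c where c: "c \<in> A" "d = cyl c" by blast
  interpret riemannian_chart c by (rule riemannian_manifold_chart[OF manifold c(1)])
  interpret cyl: riemannian_chart "cyl c" by (rule cyl_chart)
  show "smooth_on (chart_map d ` (chart_dom d \<inter> E)) (G \<circ> chart_inv d)"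
    using E_chart[OF c(1)] unfolding c(2) cyl.csmooth_def by blast
qed

lemma G_self_concordant:
  assumes comp: "compatible A D \<beta>1 \<beta>2 f F" and F: "self_concordant A 1 D F"
    and \<alpha>: "0 < \<alpha>" "1 + \<beta>1\<^sup>2 \<le> 1 / \<alpha>" "\<beta>1 + 1/2 * \<beta>2\<^sup>2 \<le> 1 / \<alpha>" "2/3 * \<beta>2\<^sup>2 \<le> 1 / \<alpha>"
  shows "self_concordant (cyl ` A) \<alpha> E G"
  unfolding self_concordant_def
proof (intro conjI ballI impI allI \<alpha>(1) E_open G_smooth G_convex)
  fix z d x y y' assume "z \<in> E" "d \<in> cyl ` A" "z \<in> chart_dom d"
  from this(2,1,3) show "\<bar>nabla3 d G z x y y'\<bar> \<le>
      2 / sqrt \<alpha> * sqrt (hess d G z x x) * sqrt (hess d G z y y) * sqrt (hess d G z y' y')"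
  proof (cases rule: cyl_chart_cases)
    case (1 c)
    interpret riemannian_chart c by (rule 1(3))
    have C: "0 \<le> 1 / sqrt \<alpha>" "(1 / sqrt \<alpha>)\<^sup>2 = 1 / \<alpha>"
      using \<alpha>(1) by (simp_all add: power_divide)
    have F3: "\<bar>nabla3 c F (fst z) u v v\<bar> \<le> 2 * sqrt (hess c F (fst z) u u) * hess c F (fst z) v v" for u v
    proof -
      have "\<bar>nabla3 c F (fst z) u v v\<bar> \<le> 2 / sqrt 1 * sqrt (hess c F (fst z) u u)
          * sqrt (hess c F (fst z) v v) * sqrt (hess c F (fst z) v v)"
        using F 1(1,4,5) unfolding self_concordant_def by blast
      then show ?thesis using 1(10)[of v] by (simp add: mult.assoc)
    qed
    have f3: "\<bar>nabla3 c f (fst z) u v v\<bar> \<le>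
          2 * \<beta>1 * sqrt (hess c F (fst z) u u) * hess c f (fst z) v v +
          2 * \<beta>2 * sqrt (hess c F (fst z) v v) * sqrt (hess c f (fst z) u u) * sqrt (hess c f (fst z) v v)"
      for u v
      using comp 1(1,4,5) unfolding compatible_def by blast
    show ?thesis
      using log_barrier_nabla3_bound[OF 1(6,7,8,9,10) C(1) _ _ _ f3 F3, of x y y'] \<alpha> unfolding C(2) 1(2)
      by simp
  qed
qed

text \<open>If \<open>k\<close> is the Newton decrement of \<open>F\<close> then \<open>sqrt (1 + k\<^sup>2)\<close> is an admissible constant for the
  barrier; the summand \<open>1\<close> is the contribution of the logarithm.\<close>

lemma newton_decrement_G:
  assumes z: "z \<in> E"
  shows "(newton_decrement (cyl ` A) G 1 z)\<^sup>2 \<le> 1 + (newton_decrement A F 1 (fst z))\<^sup>2"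
proof (cases "newton_decrement A F 1 (fst z) = top")
  case True
  then show ?thesis by (simp add: power2_eq_square ennreal_top_mult)
next
  case False
  obtain k where k: "0 \<le> k" "newton_decrement A F 1 (fst z) = ennreal k"
    "\<And>c v. c \<in> A \<Longrightarrow> fst z \<in> chart_dom c \<Longrightarrow> \<bar>cderiv c F (fst z) v\<bar> \<le> k * sqrt (1 * hess c F (fst z) v v)"
    using newton_decrement_attained[OF False] by blast
  have "newton_decrement (cyl ` A) G 1 z \<le> ennreal (sqrt (1 + k\<^sup>2))"
  proof (rule newton_decrement_le)
    fix d x assume "d \<in> cyl ` A" "z \<in> chart_dom d"
    from this(1) z this(2) show "\<bar>cderiv d G z x\<bar> \<le> sqrt (1 + k\<^sup>2) * sqrt (1 * hess d G z x x)"
    proof (cases rule: cyl_chart_cases)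
      case (1 c)
      interpret riemannian_chart c by (rule 1(3))
      show ?thesis
        unfolding 1(2) by (rule log_barrier_cderiv_bound[OF 1(6-10) k(3)[OF 1(1,5)]])
    qed
  qed simp
  then have "(newton_decrement (cyl ` A) G 1 z)\<^sup>2 \<le> (ennreal (sqrt (1 + k\<^sup>2)))\<^sup>2"
    by (rule power_mono) simp
  also have "\<dots> = ennreal (1 + k\<^sup>2)" by (simp add: ennreal_power)
  also have "\<dots> = 1 + (newton_decrement A F 1 (fst z))\<^sup>2"
    using k(1) by (simp add: k(2) ennreal_power)
  finally show ?thesis .
qed

lemma G_closed_convex:
  assumes F: "closed_convex_fun A D F" and f: "has_closed_convex_extension A D f"
  shows "closed_convex_fun (cyl ` A) E G"
proof -
  obtain D' f' where ext: "D \<subseteq> D'" "closed {(x, s). x \<in> D' \<and> f' x \<le> s}" "\<And>x. x \<in> D \<Longrightarrow> f' x = f x"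
    using f unfolding has_closed_convex_extension_def closed_convex_fun_def by blast
  have "closed {(z, s). z \<in> E \<and> G z \<le> s}"
    by (rule log_barrier_closed_epigraph[OF D smooth_fun_continuous_on[OF manifold D f_smooth]
          smooth_fun_continuous_on[OF manifold D F_smooth] _ ext(1,3,2)])
      (use F in \<open>auto simp: closed_convex_fun_def\<close>)
  then show ?thesis using G_convex unfolding closed_convex_fun_def by blast
qed

lemma G_scaled_derivs:
  assumes "d \<in> cyl ` A" "z \<in> E" "z \<in> chart_dom d"
  shows "cderiv d (\<lambda>x. a * G x) z u = a * cderiv d G z u"
    "hess d (\<lambda>x. a * G x) z u v = a * hess d G z u v"
    "nabla3 d (\<lambda>x. a * G x) z u v w = a * nabla3 d G z u v w"
proof -
  obtain c where c: "c \<in> A" "d = cyl c" using assms(1) by blast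
  interpret riemannian_chart c by (rule riemannian_manifold_chart[OF manifold c(1)])
  interpret cyl: riemannian_chart "cyl c" by (rule cyl_chart)
  have z: "z \<in> chart_dom (cyl c) \<inter> E" using assms c by simp
  note G = E_chart[OF c(1)]
  show "cderiv d (\<lambda>x. a * G x) z u = a * cderiv d G z u"
    unfolding c(2) by (simp add: cyl.cdiff_cmult(2)[OF cyl.csmooth_cdiff[OF G z]])
  show "hess d (\<lambda>x. a * G x) z u v = a * hess d G z u v"
    "nabla3 d (\<lambda>x. a * G x) z u v w = a * nabla3 d G z u v w"
    unfolding c(2) by (rule cyl.hess_cmult[OF G z] cyl.nabla3_cmult[OF G z])+
qed

text \<open>The third derivative scales with \<open>1 / \<alpha>\<close> and the product of the three roots with \<open>\<alpha>\<^sup>-\<^sup>3\<^sup>/\<^sup>2\<close>, which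
  absorbs the constant \<open>1 / sqrt \<alpha>\<close>.\<close>

lemma G_scaled_strongly_self_concordant:
  assumes \<alpha>: "0 < \<alpha>" and G: "strongly_self_concordant (cyl ` A) \<alpha> E G"
  shows "strongly_self_concordant (cyl ` A) 1 E (\<lambda>x. 1 / \<alpha> * G x)"
proof -
  have convex: "convex_fun (cyl ` A) E (\<lambda>x. 1 / \<alpha> * G x)"
  proof -
    have "convex_on S (\<lambda>x. 1 / \<alpha> * h x)" if "convex_on S h" for S :: "real set" and h
      using convex_on_cmul[OF _ that, of "1 / \<alpha>"] \<alpha> by simp
    then show ?thesis using G_convex unfolding convex_fun_def o_def by blast
  qed
  have smooth: "smooth_fun (cyl ` A) E (\<lambda>x. 1 / \<alpha> * G x)"
    unfolding smooth_fun_def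
  proof
    fix d assume "d \<in> cyl ` A"
    then obtain c where c: "c \<in> A" "d = cyl c" by blast
    interpret riemannian_chart c by (rule riemannian_manifold_chart[OF manifold c(1)])
    interpret cyl: riemannian_chart "cyl c" by (rule cyl_chart)
    show "smooth_on (chart_map d ` (chart_dom d \<inter> E)) ((\<lambda>x. 1 / \<alpha> * G x) \<circ> chart_inv d)"
      using cyl.csmooth_cmult[OF E_chart[OF c(1)]] unfolding c(2) cyl.csmooth_def by blast
  qed
  have closed: "closed {(z, s). z \<in> E \<and> 1 / \<alpha> * G z \<le> s}"
  proof -
    have "closed {(z, s). z \<in> E \<and> G z \<le> s}"
      using G unfolding strongly_self_concordant_def closed_convex_fun_def by blast
    moreover have "continuous_on UNIV (\<lambda>y :: ('m \<times> real) \<times> real. (fst y, \<alpha> * snd y))"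
      by (intro continuous_intros)
    ultimately have "closed ((\<lambda>y. (fst y, \<alpha> * snd y)) -` {(z, s). z \<in> E \<and> G z \<le> s})"
      by (rule closed_vimage)
    moreover have "(\<lambda>y. (fst y, \<alpha> * snd y)) -` {(z, s). z \<in> E \<and> G z \<le> s}
        = {(z, s). z \<in> E \<and> 1 / \<alpha> * G z \<le> s}"
      using \<alpha> by (auto simp: field_simps)
    ultimately show ?thesis by simp
  qed
  have sc: "\<bar>nabla3 d (\<lambda>x. 1 / \<alpha> * G x) z x y y'\<bar> \<le> 2 / sqrt 1 * sqrt (hess d (\<lambda>x. 1 / \<alpha> * G x) z x x)
      * sqrt (hess d (\<lambda>x. 1 / \<alpha> * G x) z y y) * sqrt (hess d (\<lambda>x. 1 / \<alpha> * G x) z y' y')"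
    if z: "z \<in> E" and d: "d \<in> cyl ` A" "z \<in> chart_dom d" for z d x y y'
  proof -
    have "\<bar>nabla3 d G z x y y'\<bar> \<le>
      2 / sqrt \<alpha> * sqrt (hess d G z x x) * sqrt (hess d G z y y) * sqrt (hess d G z y' y')"
      using G z d unfolding strongly_self_concordant_def self_concordant_def by blast
    from mult_left_mono[OF this, of "1 / \<alpha>"] show ?thesis
      using \<alpha> by (simp add: G_scaled_derivs[OF d(1) z d(2), of "1 / \<alpha>", simplified] abs_mult real_sqrt_mult
          real_sqrt_divide field_simps)
  qed
  show ?thesis
    unfolding strongly_self_concordant_def self_concordant_def closed_convex_fun_def
    using E_open convex smooth closed sc by auto
qed

lemma G_scaled_barrier:
  assumes \<alpha>: "0 < \<alpha>" and G: "strongly_self_concordant (cyl ` A) \<alpha> E G" and F: "barrier A \<theta> D F"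
  shows "barrier (cyl ` A) ((1 + \<theta>) / \<alpha>) E (\<lambda>x. 1 / \<alpha> * G x)"
  unfolding barrier_def
proof (intro conjI ballI impI allI G_scaled_strongly_self_concordant[OF \<alpha> G])
  have \<theta>: "0 \<le> \<theta>" using F unfolding barrier_def by blast
  then show "0 \<le> (1 + \<theta>) / \<alpha>" using \<alpha> by simp
  fix z assume z: "z \<in> E"
  show "0 < hess d (\<lambda>x. 1 / \<alpha> * G x) z x x" if d: "d \<in> cyl ` A" "z \<in> chart_dom d" and x: "x \<noteq> 0" for d x
    using d(1) z d(2)
  proof (cases rule: cyl_chart_cases)
    case (1 c)
    interpret riemannian_chart c by (rule 1(3))
    have "0 < hess (cyl c) G z x x"
      by (rule log_barrier_hess_pos[OF 1(6-10) _ x]) (use F 1(1,4,5) in \<open>auto simp: barrier_def\<close>)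
    then show ?thesis using \<alpha> unfolding G_scaled_derivs(2)[OF d(1) z d(2)] unfolding 1(2) by simp
  qed
  have "newton_decrement A F 1 (fst z) \<le> ennreal (sqrt \<theta>)"
    using F z unfolding barrier_def open_epigraph_def by auto
  then obtain k where k: "0 \<le> k" "k \<le> sqrt \<theta>"
    "\<And>c v. c \<in> A \<Longrightarrow> fst z \<in> chart_dom c \<Longrightarrow> \<bar>cderiv c F (fst z) v\<bar> \<le> k * sqrt (1 * hess c F (fst z) v v)"
    using newton_decrement_attained[of A F 1 "fst z"] \<theta>
    by (metis ennreal_le_iff ennreal_less_top not_le real_sqrt_ge_zero)
  show "newton_decrement (cyl ` A) (\<lambda>x. 1 / \<alpha> * G x) 1 z \<le> ennreal (sqrt ((1 + \<theta>) / \<alpha>))"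
  proof (rule newton_decrement_le)
    fix d x assume d: "d \<in> cyl ` A" "z \<in> chart_dom d"
    from d(1) z d(2)
    show "\<bar>cderiv d (\<lambda>x. 1 / \<alpha> * G x) z x\<bar>
        \<le> sqrt ((1 + \<theta>) / \<alpha>) * sqrt (1 * hess d (\<lambda>x. 1 / \<alpha> * G x) z x x)"
    proof (cases rule: cyl_chart_cases)
      case (1 c)
      interpret riemannian_chart c by (rule 1(3))
      have nn: "0 \<le> hess (cyl c) G z x x" by (rule log_barrier_hess_nonneg[OF 1(6-10)])
      have "\<bar>cderiv (cyl c) G z x\<bar> \<le> sqrt (1 + k\<^sup>2) * sqrt (1 * hess (cyl c) G z x x)"
        by (rule log_barrier_cderiv_bound[OF 1(6-10) k(3)[OF 1(1,5)]])
      also have "\<dots> \<le> sqrt (1 + \<theta>) * sqrt (hess (cyl c) G z x x)"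
      proof -
        have "k\<^sup>2 \<le> (sqrt \<theta>)\<^sup>2" using k by (intro power_mono) auto
        then show ?thesis using \<theta> nn by (simp add: mult_right_mono)
      qed
      finally have "\<bar>cderiv d G z x\<bar> / \<alpha> \<le> sqrt (1 + \<theta>) * sqrt (hess d G z x x) / \<alpha>"
        unfolding 1(2) using \<alpha> by (simp add: divide_right_mono)
      also have "\<dots> = sqrt ((1 + \<theta>) / \<alpha>) * sqrt (1 * (1 / \<alpha> * hess d G z x x))"
        using \<alpha> by (simp add: real_sqrt_divide real_sqrt_mult)
      finally show ?thesis
        unfolding G_scaled_derivs[OF d(1) z d(2)] using \<alpha> by (simp add: abs_mult)
    qed
  qed (use \<alpha> \<theta> in simp)
qed

end

theorem theorem4p11:
  fixes A :: "('m::{t2_space, second_countable_topology}, 'e::real_inner) rchart set"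
    and D :: "'m set" and f F :: "'m \<Rightarrow> real" and \<beta>1 \<beta>2 \<alpha> :: real
    and N :: "('m \<times> real, 'e \<times> real) rchart set"
    and E :: "('m \<times> real) set" and G :: "'m \<times> real \<Rightarrow> real"
  assumes "riemannian_manifold A" and "connected (UNIV :: 'm set)" and "geodesically_complete A"
    and "open D" and "geod_convex A D"
    and "smooth_fun A D f" and "smooth_fun A D F"
    and "convex_fun A D f" and "convex_fun A D F"
    and "\<beta>1 \<ge> 0" and "\<beta>2 \<ge> 0" and "compatible A D \<beta>1 \<beta>2 f F"
    and "self_concordant A 1 D F"
  defines "N \<equiv> prod_manifold A real_line"
    and "E \<equiv> open_epigraph D f"
    and "G \<equiv> (\<lambda>(p, t). - ln (t - f p) + F p)"
    and "\<alpha> \<equiv> 1 / Max {1 + \<beta>1\<^sup>2, \<beta>1 + 1/2 * \<beta>2\<^sup>2, 2/3 * \<beta>2\<^sup>2}"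
  shows "convex_fun N E G \<and> self_concordant N \<alpha> E G \<and>
    (\<forall>(p, t) \<in> E.
       (newton_decrement N G \<alpha> (p, t))\<^sup>2 = (newton_decrement N G 1 (p, t))\<^sup>2 / ennreal \<alpha> \<and>
       (newton_decrement N G 1 (p, t))\<^sup>2 / ennreal \<alpha>
         \<le> (1 + (newton_decrement A F 1 p)\<^sup>2) / ennreal \<alpha>) \<and>
    (strongly_self_concordant A 1 D F \<and> has_closed_convex_extension A D f \<longrightarrow>
       strongly_self_concordant N \<alpha> E G) \<and>
    (\<forall>\<theta>. barrier A \<theta> D F \<and> has_closed_convex_extension A D f \<longrightarrow>
       barrier N ((1 + \<theta>) / \<alpha>) E (\<lambda>x. G x / \<alpha>))"
proof -
  interpret P: convex_pair A D f F
    by unfold_locales (rule assms)+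
  have N: "N = cyl ` A" unfolding N_def by (rule prod_real_line)
  have G: "G = log_barrier f F" unfolding G_def log_barrier_def by auto
  define M where "M = Max {1 + \<beta>1\<^sup>2, \<beta>1 + 1/2 * \<beta>2\<^sup>2, 2/3 * \<beta>2\<^sup>2}"
  have M: "1 + \<beta>1\<^sup>2 \<le> M" "\<beta>1 + 1/2 * \<beta>2\<^sup>2 \<le> M" "2/3 * \<beta>2\<^sup>2 \<le> M"
    unfolding M_def by (rule Max_ge; simp)+
  have M_pos: "0 < M" using M(1) zero_le_power2[of \<beta>1] by linarith
  have \<alpha>: "0 < \<alpha>" "1 / \<alpha> = M" using M_pos unfolding \<alpha>_def M_def[symmetric] by simp_all
  have sc: "self_concordant N \<alpha> E G"
    unfolding N G E_def
    by (rule P.G_self_concordant[OF \<open>compatible A D \<beta>1 \<beta>2 f F\<close> \<open>self_concordant A 1 D F\<close> \<alpha>(1)])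
      (use M in \<open>simp_all add: \<alpha>(2)\<close>)
  have strong: "strongly_self_concordant N \<alpha> E G"
    if "strongly_self_concordant A 1 D F" "has_closed_convex_extension A D f"
    using sc P.G_closed_convex that unfolding strongly_self_concordant_def N G E_def by blast
  have "barrier N ((1 + \<theta>) / \<alpha>) E (\<lambda>x. G x / \<alpha>)"
    if "barrier A \<theta> D F" "has_closed_convex_extension A D f" for \<theta>
    using P.G_scaled_barrier[OF \<alpha>(1) _ that(1)] strong that unfolding barrier_def N G E_def
    by simp
  moreover have "(newton_decrement N G \<alpha> z)\<^sup>2 = (newton_decrement N G 1 z)\<^sup>2 / ennreal \<alpha>" for z
    using \<alpha>(1) by (simp add: newton_decrement_rescale[OF \<alpha>(1)] ennreal_divide_power2)
  moreover have "(newton_decrement N G 1 z)\<^sup>2 / ennreal \<alpha>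
      \<le> (1 + (newton_decrement A F 1 (fst z))\<^sup>2) / ennreal \<alpha>" if "z \<in> E" for z
    using that unfolding N G E_def by (intro divide_right_mono_ennreal P.newton_decrement_G)
  moreover have "convex_fun N E G" unfolding N G E_def by (rule P.G_convex)
  ultimately show ?thesis using sc strong by fastforce
qed

end
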